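(* Let $p\ge 5$ be a prime, $n,m\in \mathbb{Z}^{+}$, and $r,s,t\in \mathbb{N}$ with $r\ge 2$. Define \[ A_n^{(r,s,t)}=\sum_{k=0}^n{n\choose k}^r{n+k\choose k}^s{2k\choose n}^t . \] Then \[ A_{np^m}^{(r,s,t)}\equiv A_{np^{m-1}}^{(r,s,t)}+p^{3m}B_{p-3}\, \mathcal{A}^{(r,s,t)}_n\pmod{p^{3m+1}}, \] where the rational numbers $\mathcal{A}^{(r,s,t)}_n$ (independent of $m$ and $p$) are given by \begin{align*} \mathcal{A}^{(2,s,t)}_n &=-\frac{1}{3}\sum_{k=0}^{n} {n\choose k}^2 {n+k\choose k}^s {2k\choose n}^t nk(sn+sk+2n-2k+4tk-2tn)\\ &\quad+\frac{1}{6}\sum_{k=0}^{n-1} {n\choose k}^2{n+k\choose k}^s {2k\choose n}^t (n-k)^2\left(9nt-3ns+24k-18n+14\right)\\ &\quad+\frac{1}{6}\sum_{k=0}^{n-1}{n\choose k}^2 {n+k\choose k}^s {2k+1\choose n}^t (n-k)^2\left(9ns+15nt-24k+6n-10\right), \end{align*} \begin{align*} \mathcal{A}_{n}^{(3,s,t)} &=-\frac{1}{3}\sum_{k=0}^{n} {n\choose k}^3 {n+k\choose k}^s {2k\choose n}^t nk(sn+sk+3n-3k+4tk-2tn)\\ &\quad+\frac{1}{4}\sum_{k=0}^{n-1}(n-k)^3{n\choose k}^3 {n+k\choose k}^s\left({2k\choose n}^t+{2k+1\choose n}^t\right), \end{align*} and, for $r\ge 4$, \[ \mathcal{A}_{n}^{(r,s,t)}=-\frac{1}{3}\sum_{k=0}^{n}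 {n\choose k}^r {n+k\choose k}^s {2k\choose n}^t nk(sn+sk+rn-rk+4tk-2tn). \]
   Context: $\mathbb{N}$ denotes the non-negative integers and $\mathbb{Z}^+$ the positive integers. Binomial coefficients ${a\choose b}$ with $0\le a<b$ are $0$ (so ${2k\choose n}=0$ when $2k<n$). The Bernoulli numbers $B_n$ are defined by $\frac{z}{e^z-1}=\sum_{n\ge0}B_n\frac{z^n}{n!}$. For rationals $x,y$ and an integer $j$, $x\equiv y \pmod{p^j}$ means that $(x-y)/p^j$ is a rational number whose denominator is not divisible by $p$. *)

theory Defs
  imports "HOL-Computational_Algebra.Computational_Algebra"
begin

definition bernoulli :: "nat \<Rightarrow> rat" where
  "bernoulli n = fact n * fps_nth (fps_X / (fps_exp 1 - 1)) n"

lemma bernoulli_egf: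
  "Abs_fps (\<lambda>n. bernoulli n / fact n) = fps_X / (fps_exp 1 - 1)"
  by (rule fps_ext) (simp add: bernoulli_def)

(* The quotient of formal power series above is the true one:
   it does not hit a default value of division. *)
lemma bernoulli_egf_mult:
  "Abs_fps (\<lambda>n. bernoulli n / fact n) * (fps_exp 1 - 1) = fps_X"
proof -
  have nz: "fps_nth (fps_exp (1::rat) - 1) 1 \<noteq> 0" by simp
  then have "subdegree (fps_exp (1::rat) - 1) = 1"
    by (intro subdegreeI) auto
  then have "(fps_exp (1::rat) - 1) dvd fps_X"
    using nz by (subst fps_dvd_iff) (auto simp: fps_eq_iff)
  then show ?thesis
    unfolding bernoulli_egf by (rule dvd_div_mult_self)
qed

(* Congruence of rationals modulo p^j. The second component of quotient_of is the
   positive denominator in lowest terms. *)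
definition rat_cong :: "nat \<Rightarrow> int \<Rightarrow> rat \<Rightarrow> rat \<Rightarrow> bool" where
  "rat_cong p j x y \<longleftrightarrow> \<not> int p dvd snd (quotient_of ((x - y) / of_nat p powi j))"

definition A_seq :: "nat \<Rightarrow> nat \<Rightarrow> nat \<Rightarrow> nat \<Rightarrow> nat" where
  "A_seq r s t n = (\<Sum>k=0..n. (n choose k) ^ r * ((n + k) choose k) ^ s * ((2 * k) choose n) ^ t)"

definition calA_generic :: "nat \<Rightarrow> nat \<Rightarrow> nat \<Rightarrow> nat \<Rightarrow> rat" where
  "calA_generic r s t n =
    - (1 / 3) * (\<Sum>k=0..n.
        of_nat (n choose k) ^ r * of_nat ((n + k) choose k) ^ s * of_nat ((2 * k) choose n) ^ t
        * of_nat n * of_nat k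
        * (of_nat s * of_nat n + of_nat s * of_nat k + of_nat r * of_nat n - of_nat r * of_nat k
           + 4 * of_nat t * of_nat k - 2 * of_nat t * of_nat n))"

(* Only meaningful for r >= 2; the value for r < 2 is arbitrary. *)
definition calA :: "nat \<Rightarrow> nat \<Rightarrow> nat \<Rightarrow> nat \<Rightarrow> rat" where
  "calA r s t n =
    (if r = 2 then
       calA_generic 2 s t n
       + 1 / 6 * (\<Sum>k<n.
           of_nat (n choose k) ^ 2 * of_nat ((n + k) choose k) ^ s * of_nat ((2 * k) choose n) ^ t
           * (of_nat n - of_nat k) ^ 2
           * (9 * of_nat n * of_nat t - 3 * of_nat n * of_nat s + 24 * of_nat k
              - 18 * of_nat n + 14))
       + 1 / 6 * (\<Sum>k<n.
           of_nat (n choose k) ^ 2 * of_nat ((n + k) choose k) ^ s * of_nat ((2 * k + 1) choose n) ^ t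
           * (of_nat n - of_nat k) ^ 2
           * (9 * of_nat n * of_nat s + 15 * of_nat n * of_nat t - 24 * of_nat k
              + 6 * of_nat n - 10))
     else if r = 3 then
       calA_generic 3 s t n
       + 1 / 4 * (\<Sum>k<n.
           (of_nat n - of_nat k) ^ 3 * of_nat (n choose k) ^ 3 * of_nat ((n + k) choose k) ^ s
           * (of_nat ((2 * k) choose n) ^ t + of_nat ((2 * k + 1) choose n) ^ t))
     else calA_generic r s t n)"

end

theory Submission
  imports Defs "HOL-Number_Theory.Residues"
begin

text \<open>
  Write \<open>N = p M\<close> with \<open>M = n p\<^sup>m\<^sup>-\<^sup>1\<close> and split the sum for \<open>N\<close> according to whether \<open>p\<close> divides the
  index. The terms with index \<open>p j\<close> are compared with those of index \<open>j\<close> in the sum for \<open>M\<close> by a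
  refined Jacobsthal congruence, which gives the part of the correction common to all \<open>r\<close>, and for
  \<open>r = 2\<close> an extra contribution from the \<open>j\<close> that \<open>p\<^sup>m\<^sup>-\<^sup>1\<close> does not divide.

  The other terms are divisible by \<open>p\<^sup>r\<^sup>m\<close>, so they matter only for \<open>r = 2\<close> and \<open>r = 3\<close>. There
  \<open>N choose k\<close> is \<open>N / (N - k)\<close> times \<open>N - 1 choose k\<close>, and the remaining binomial factors depend, up to
  a factor \<open>1 + N c\<close>, only on \<open>z = \<lfloor>2 k / p\<rfloor>\<close>. This leaves sums of \<open>1 / k\<^sup>2\<close> (or of \<open>\<plusminus> 1 / k\<^sup>3\<close>) over
  half blocks of length \<open>p / 2\<close>. The weights again vary slowly in \<open>z\<close>, so the half blocks can be
  merged into half blocks of length \<open>p\<^sup>2 / 2\<close> and so on up to \<open>p\<^sup>m / 2\<close>, where the weights are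
  those of \<open>n\<close> itself. All sums that occur are multiples of the Bernoulli number because the
  basic harmonic sums over half a period satisfy three linear relations.
\<close>

section \<open>Congruences of rationals modulo powers of a prime\<close>

text \<open>The obstacle is precision. For r = 2 the units carry the factor \<open>N^2\<close>, so
  the remaining weighted sum of \<open>1 / k^2\<close> is needed modulo \<open>p^(m+1)\<close>,
  whereas its inner sum over a half block of length p/2 is known only modulo \<open>p^2\<close>.
  Each merge of p half blocks moves a factor p from \<open>M\<close> to the block length and gains
  one power of p in the inner sum, at the price of a first-order correction. That correction is
  proportional to the sum of all weights, which is divisible by p unless the weights are those of n,
  so only the last merge leaves a trace. Half periods are also the source of the Bernoulli number:
  the sum of \<open>1 / k^3\<close> over a full period vanishes modulo p, over half a period it is
  -2 B. For r = 2 the answer must not depend on m although several contributions do. They recombine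
  because the constants for multiples of p, for merging and for units are linked: the same factor s
  - 2 + 4 t appears in all three, see \<open>unit_coeff_sum\<close>.\<close>

locale prime_ge5 =
  fixes p :: nat
  assumes prime_p: "prime p" and p_ge5: "p \<ge> 5"
begin

definition Zp :: "rat set" where
  "Zp = {x. \<exists>a b. \<not> int p dvd b \<and> x = of_int a / of_int b}"

text \<open>\<open>Zp\<close> is the localisation of the integers at \<open>p\<close> and \<open>I k\<close> is its ideal \<open>p\<^sup>k Zp\<close>.\<close>

definition I :: "nat \<Rightarrow> rat set" where
  "I k = {x. x / of_nat p ^ k \<in> Zp}"

definition cg :: "nat \<Rightarrow> rat \<Rightarrow> rat \<Rightarrow> bool" where
  "cg k x y \<longleftrightarrow> x - y \<in> I k"

lemma prime_int_p: "prime (int p)"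
  using prime_p by simp

lemma p_neq_0 [simp]: "p \<noteq> 0" "of_nat p \<noteq> (0::rat)" and p_pos [simp]: "0 < p"
  using p_ge5 by auto

lemma p_odd: "odd p"
  using prime_p p_ge5 prime_odd_nat by auto

lemma not_p_dvd_small [simp]:
  "\<not> p dvd 2" "\<not> p dvd 3" "\<not> p dvd 4" "\<not> p dvd 6" "\<not> p dvd 8" "\<not> p dvd Suc 0"
proof -
  show 2: "\<not> p dvd 2" and 3: "\<not> p dvd 3" and "\<not> p dvd 4" and "\<not> p dvd Suc 0"
    using p_ge5 by (auto dest: dvd_imp_le)
  have "\<not> p dvd 2 * 3" "\<not> p dvd 2 * (2 * 2)"
    using 2 3 prime_p by (metis prime_dvd_mult_iff)+
  then show "\<not> p dvd 6" "\<not> p dvd 8" by simp_all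
qed

lemma ZpI: "\<not> int p dvd b \<Longrightarrow> of_int a / of_int b \<in> Zp"
  unfolding Zp_def by blast

text \<open>The denominator in lowest terms divides every other denominator of \<open>x\<close>, so
  p-integrality may be checked on any representation. This links \<open>Zp\<close> to
  \<open>rat_cong\<close>.\<close>

lemma Zp_iff_quotient: "x \<in> Zp \<longleftrightarrow> \<not> int p dvd snd (quotient_of x)"
proof
  assume "x \<in> Zp"
  then obtain a b where b: "\<not> int p dvd b" and x: "x = of_int a / of_int b"
    by (auto simp: Zp_def)
  obtain c d where cd: "quotient_of x = (c, d)" by fastforce
  from b have "b \<noteq> 0" by auto
  have d: "d > 0" "coprime c d" and x': "x = of_int c / of_int d"
    using cd quotient_of_denom_pos quotient_of_coprime quotient_of_div by auto
  have "(of_int (a * d) :: rat) = of_int (c * b)"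
    using x x' \<open>b \<noteq> 0\<close> d by (simp add: field_simps)
  then have "a * d = c * b" by (simp only: of_int_eq_iff)
  then have "d dvd c * b" by (metis dvd_triv_right)
  then have "d dvd b" using d(2) by (simp add: coprime_commute coprime_dvd_mult_right_iff)
  with b show "\<not> int p dvd snd (quotient_of x)"
    using cd dvd_trans by auto
next
  assume "\<not> int p dvd snd (quotient_of x)"
  then show "x \<in> Zp"
    using quotient_of_div[of x "fst (quotient_of x)" "snd (quotient_of x)"]
      ZpI[of "snd (quotient_of x)" "fst (quotient_of x)"] by simp
qed

lemma Zp_of_int [simp]: "of_int a \<in> Zp"
  using ZpI[of 1 a] p_ge5 by simp

lemma Zp_of_nat [simp]: "of_nat a \<in> Zp"
  using Zp_of_int[of "int a"] by simp

lemma Zp_numeral [simp]: "0 \<in> Zp" "1 \<in> Zp" "numeral w \<in> Zp"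
  using Zp_of_nat[of 0] Zp_of_nat[of 1] Zp_of_nat[of "numeral w"] by simp_all

lemma Zp_add [simp, intro]:
  assumes "x \<in> Zp" "y \<in> Zp"
  shows "x + y \<in> Zp"
proof -
  obtain a b c d where "\<not> int p dvd b" "x = of_int a / of_int b"
    "\<not> int p dvd d" "y = of_int c / of_int d"
    using assms by (auto simp: Zp_def)
  moreover from this have "b \<noteq> 0" "d \<noteq> 0" by auto
  ultimately show ?thesis
    using prime_int_p ZpI[of "b * d" "a * d + c * b"]
    by (simp add: prime_dvd_mult_iff add_frac_eq)
qed

lemma Zp_mult [simp, intro]:
  assumes "x \<in> Zp" "y \<in> Zp"
  shows "x * y \<in> Zp"
proof -
  obtain a b c d where "\<not> int p dvd b" "x = of_int a / of_int b"
    "\<not> int p dvd d" "y = of_int c / of_int d"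
    using assms by (auto simp: Zp_def)
  then show ?thesis
    using prime_int_p ZpI[of "b * d" "a * c"] by (simp add: prime_dvd_mult_iff)
qed

lemma Zp_minus [simp, intro]: "x \<in> Zp \<Longrightarrow> - x \<in> Zp"
  using Zp_mult[of "-1" x] Zp_of_int[of "-1"] by simp

lemma Zp_diff [simp, intro]: "x \<in> Zp \<Longrightarrow> y \<in> Zp \<Longrightarrow> x - y \<in> Zp"
  using Zp_add[of x "- y"] by simp

lemma Zp_power [simp, intro]: "x \<in> Zp \<Longrightarrow> x ^ n \<in> Zp"
  by (induction n) auto

lemma Zp_sum [simp, intro]: "(\<And>i. i \<in> A \<Longrightarrow> f i \<in> Zp) \<Longrightarrow> sum f A \<in> Zp"
  by (induction A rule: infinite_finite_induct) auto

lemma Zp_prod [simp, intro]: "(\<And>i. i \<in> A \<Longrightarrow> f i \<in> Zp) \<Longrightarrow> prod f A \<in> Zp"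
  by (induction A rule: infinite_finite_induct) auto

lemma Zp_inverse_int: "\<not> int p dvd b \<Longrightarrow> 1 / of_int b \<in> Zp"
  using ZpI[of b 1] by simp

lemma Zp_divide_of_nat [simp]:
  assumes "x \<in> Zp" "\<not> p dvd n"
  shows "x / of_nat n \<in> Zp" "x / of_nat n ^ e \<in> Zp"
proof -
  have *: "1 / of_nat n \<in> Zp"
    using assms Zp_inverse_int[of "int n"] by simp
  show "x / of_nat n \<in> Zp"
    using Zp_mult[OF assms(1) *] by simp
  show "x / of_nat n ^ e \<in> Zp"
    using Zp_mult[OF assms(1) Zp_power[OF *, of e]] by (simp add: power_one_over)
qed

lemma Zp_divide_numeral [simp]:
  assumes "x \<in> Zp"
  shows "x / 2 \<in> Zp" "x / 3 \<in> Zp" "x / 4 \<in> Zp" "x / 6 \<in> Zp" "x / 8 \<in> Zp"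
  using Zp_divide_of_nat(1)[OF assms, of 2] Zp_divide_of_nat(1)[OF assms, of 3]
    Zp_divide_of_nat(1)[OF assms, of 4] Zp_divide_of_nat(1)[OF assms, of 6]
    Zp_divide_of_nat(1)[OF assms, of 8] by simp_all

lemma I_iff: "x \<in> I k \<longleftrightarrow> (\<exists>y\<in>Zp. x = of_nat p ^ k * y)"
  unfolding I_def by (auto simp: field_simps intro!: bexI[of _ "x / of_nat p ^ k"])

lemma I_0 [simp]: "I 0 = Zp"
  by (auto simp: I_def)

lemma I_zero [simp]: "0 \<in> I k"
  by (simp add: I_def)

lemma I_add: "x \<in> I k \<Longrightarrow> y \<in> I k \<Longrightarrow> x + y \<in> I k"
  by (simp add: I_def add_divide_distrib)

lemma I_minus: "x \<in> I k \<Longrightarrow> - x \<in> I k"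
  by (simp add: I_def)

lemma I_diff: "x \<in> I k \<Longrightarrow> y \<in> I k \<Longrightarrow> x - y \<in> I k"
  by (simp add: I_def diff_divide_distrib)

lemma I_sum: "(\<And>i. i \<in> A \<Longrightarrow> f i \<in> I k) \<Longrightarrow> sum f A \<in> I k"
  by (induction A rule: infinite_finite_induct) (auto intro: I_add)

lemma I_mult: "x \<in> I a \<Longrightarrow> y \<in> I b \<Longrightarrow> x * y \<in> I (a + b)"
  using Zp_mult[of "x / of_nat p ^ a" "y / of_nat p ^ b"]
  by (simp add: I_def power_add)

lemma I_mult_Zp: "x \<in> I k \<Longrightarrow> y \<in> Zp \<Longrightarrow> x * y \<in> I k"
  and Zp_mult_I: "y \<in> Zp \<Longrightarrow> x \<in> I k \<Longrightarrow> y * x \<in> I k"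
  using I_mult[of x k y 0] I_mult[of y 0 x k] by simp_all

lemma I_p_power: "of_nat p ^ k \<in> I k"
  by (simp add: I_def)

lemma I_p: "of_nat p \<in> I 1"
  by (simp add: I_def)

lemma I_power: "x \<in> I k \<Longrightarrow> x ^ n \<in> I (k * n)"
  by (induction n) (auto dest: I_mult)

lemma I_mono: "x \<in> I b \<Longrightarrow> a \<le> b \<Longrightarrow> x \<in> I a"
proof -
  assume "x \<in> I b" "a \<le> b"
  then obtain y where "y \<in> Zp" "x = of_nat p ^ a * (of_nat p ^ (b - a) * y)"
    by (auto simp: I_iff mult.assoc[symmetric] power_add[symmetric])
  then show ?thesis unfolding I_iff by (intro bexI[of _ "of_nat p ^ (b - a) * y"]) auto
qed

lemma I_Zp: "x \<in> I k \<Longrightarrow> x \<in> Zp"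
  using I_mono[of x k 0] by simp

lemma I_of_nat: "p ^ k dvd n \<Longrightarrow> of_nat n \<in> I k"
  by (auto simp: I_iff elim!: dvdE intro!: bexI[of _ "of_nat _"])

lemma I_divide: "x \<in> I k \<Longrightarrow> \<not> p dvd n \<Longrightarrow> x / of_nat n \<in> I k"
  using I_mult_Zp[of x k "1 / of_nat n"] by simp

lemma cg_refl [simp]: "cg k x x"
  by (simp add: cg_def)

lemma cg_sym: "cg k x y \<Longrightarrow> cg k y x"
  unfolding cg_def using I_minus by fastforce

lemma cg_trans [trans]: "cg k x y \<Longrightarrow> cg k y z \<Longrightarrow> cg k x z"
  unfolding cg_def using I_add[of "x - y" k "y - z"] by simp

lemma cg_eq_trans [trans]: "cg k x y \<Longrightarrow> y = z \<Longrightarrow> cg k x z"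
  and eq_cg_trans [trans]: "x = y \<Longrightarrow> cg k y z \<Longrightarrow> cg k x z"
  by simp_all

lemma cg_0: "cg k x 0 \<longleftrightarrow> x \<in> I k"
  by (simp add: cg_def)

lemma cg_add: "cg k x y \<Longrightarrow> cg k x' y' \<Longrightarrow> cg k (x + x') (y + y')"
  unfolding cg_def using I_add[of "x - y" k "x' - y'"] by (simp add: algebra_simps)

lemma cg_diff: "cg k x y \<Longrightarrow> cg k x' y' \<Longrightarrow> cg k (x - x') (y - y')"
  unfolding cg_def using I_diff[of "x - y" k "x' - y'"] by (simp add: algebra_simps)

lemma cg_minus: "cg k x y \<Longrightarrow> cg k (- x) (- y)"
  using cg_diff[of k 0 0 x y] by simp

lemma cg_sum: "(\<And>i. i \<in> A \<Longrightarrow> cg k (f i) (g i)) \<Longrightarrow> cg k (sum f A) (sum g A)"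
  unfolding cg_def sum_subtractf[symmetric] by (rule I_sum)

lemma cg_mono: "cg b x y \<Longrightarrow> a \<le> b \<Longrightarrow> cg a x y"
  unfolding cg_def by (rule I_mono)

lemma cg_scale: "c \<in> I a \<Longrightarrow> cg k x y \<Longrightarrow> cg (a + k) (c * x) (c * y)"
  unfolding cg_def right_diff_distrib[symmetric] by (rule I_mult)

lemma cg_mult_left: "c \<in> Zp \<Longrightarrow> cg k x y \<Longrightarrow> cg k (c * x) (c * y)"
  using cg_scale[of c 0] by simp

lemma cg_mult_right: "c \<in> Zp \<Longrightarrow> cg k x y \<Longrightarrow> cg k (x * c) (y * c)"
  using cg_mult_left by (simp add: mult.commute)

lemma cg_divide: "cg k x y \<Longrightarrow> \<not> p dvd n \<Longrightarrow> cg k (x / of_nat n) (y / of_nat n)"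
  using cg_mult_right[of "1 / of_nat n"] by simp

lemma cg_divide_power: "cg k x y \<Longrightarrow> \<not> p dvd n \<Longrightarrow> cg k (x / of_nat n ^ e) (y / of_nat n ^ e)"
  using cg_mult_right[of "1 / of_nat n ^ e"] by simp

lemma cg_mult: "cg k x y \<Longrightarrow> cg k x' y' \<Longrightarrow> y \<in> Zp \<Longrightarrow> x' \<in> Zp \<Longrightarrow> cg k (x * x') (y * y')"
  by (meson cg_mult_left cg_mult_right cg_trans)

lemma cg_Zp: "cg k x y \<Longrightarrow> y \<in> Zp \<Longrightarrow> x \<in> Zp"
  unfolding cg_def using Zp_add[of "x - y" y] I_Zp by simp

lemma cg_Zp': "cg k x y \<Longrightarrow> x \<in> Zp \<Longrightarrow> y \<in> Zp"
  using cg_Zp cg_sym by blast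

lemma cg_power: "cg k x y \<Longrightarrow> y \<in> Zp \<Longrightarrow> cg k (x ^ n) (y ^ n)"
  by (induction n) (auto intro!: cg_mult intro: Zp_power cg_Zp)

lemma cg_prod:
  "(\<And>i. i \<in> A \<Longrightarrow> cg k (f i) (g i)) \<Longrightarrow> (\<And>i. i \<in> A \<Longrightarrow> g i \<in> Zp) \<Longrightarrow> cg k (prod f A) (prod g A)"
proof (induction A rule: infinite_finite_induct)
  case (insert x A)
  then show ?case
    by (auto intro!: cg_mult Zp_prod intro: cg_Zp)
qed auto

lemma cg_imp_I: "cg k x y \<Longrightarrow> y \<in> I k \<Longrightarrow> x \<in> I k"
  unfolding cg_def using I_add[of "x - y" k y] by simp

lemma I_double: "2 * x \<in> I k \<Longrightarrow> x \<in> I k"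
  using I_divide[of "2 * x" k 2] by simp

lemma rat_cong_iff: "rat_cong p (int k) x y \<longleftrightarrow> cg k x y"
  unfolding rat_cong_def cg_def I_def by (simp add: Zp_iff_quotient)

end

section \<open>Power sums, Bernoulli numbers and harmonic sums modulo p\<close>

text \<open>Faulhaber's formula. The geometric sum of \<open>exp (i z)\<close> over i < v is
  \<open>(exp (v z) - 1) / (exp z - 1)\<close>; multiplied by z it is the Bernoulli series times
  \<open>exp (v z) - 1\<close>, and the coefficients of degree n + 1 are compared.\<close>

lemma sum_power_bernoulli:
  "(\<Sum>i<v. of_nat i ^ n) / fact n =
    (\<Sum>k\<le>n. bernoulli k / fact k * (of_nat v ^ (n + 1 - k) / fact (n + 1 - k)))"
proof -
  define S :: "rat fps" where "S = (\<Sum>i<v. fps_exp (of_nat i))"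
  define Bf where "Bf = Abs_fps (\<lambda>n. bernoulli n / fact n)"
  have "(fps_exp 1 - 1) * S = fps_exp (of_nat v) - 1"
    unfolding S_def
    by (induction v) (simp_all add: algebra_simps fps_exp_add_mult[symmetric] add.commute)
  then have "Bf * (fps_exp (of_nat v) - 1) = fps_X * S"
    using bernoulli_egf_mult by (metis Bf_def mult.assoc)
  then have "fps_nth (Bf * (fps_exp (of_nat v) - 1)) (Suc n) = fps_nth S n"
    by simp
  also have "fps_nth S n = (\<Sum>i<v. of_nat i ^ n) / fact n"
    by (simp add: S_def fps_sum_nth sum_divide_distrib)
  finally have "fps_nth (Bf * (fps_exp (of_nat v) - 1)) (Suc n) = (\<Sum>i<v. of_nat i ^ n) / fact n" .
  moreover have "fps_nth (Bf * (fps_exp (of_nat v) - 1)) (Suc n) =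
    (\<Sum>k\<le>n. bernoulli k / fact k * (of_nat v ^ (n + 1 - k) / fact (n + 1 - k)))"
    unfolding fps_mult_nth atLeast0AtMost Bf_def
    by (simp del: fact_Suc add: Suc_diff_le ac_simps)
  ultimately show ?thesis by simp
qed

text \<open>For \<open>2 * M + 1 = p\<close> the odd numbers below p are, modulo p, the negatives of
  the even ones; this enumeration exhibits them as such. \<open>sum_half_reflect\<close> does the
  same for the upper half of the range.\<close>

lemma sum_even_odd_reflect:
  fixes f :: "nat \<Rightarrow> 'a :: comm_monoid_add"
  shows "(\<Sum>v=1..2 * M. f v) = (\<Sum>w=1..M. f (2 * w) + f (2 * M + 1 - 2 * w))"
proof -
  have "(\<Sum>v=1..2 * M. f v) = (\<Sum>w=1..M. f (2 * w)) + (\<Sum>w=1..M. f (2 * w - 1))"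
    by (induction M) (simp_all add: algebra_simps)
  also have "(\<Sum>w=1..M. f (2 * w - 1)) = (\<Sum>w=1..M. f (2 * (M + 1 - w) - 1))"
    by (subst sum.atLeastAtMost_rev) simp
  also have "\<dots> = (\<Sum>w=1..M. f (2 * M + 1 - 2 * w))"
    by (intro sum.cong refl arg_cong[of _ _ f]) auto
  finally show ?thesis by (simp add: sum.distrib)
qed

lemma sum_half_reflect:
  fixes f :: "nat \<Rightarrow> 'a :: comm_monoid_add"
  shows "(\<Sum>v=1..2 * M. f v) = (\<Sum>w=1..M. f w + f (2 * M + 1 - w))"
proof -
  have "(\<Sum>v=1..2 * M. f v) = (\<Sum>w=1..M. f w) + (\<Sum>v=M+1..2 * M. f v)"
    using sum.ub_add_nat[of 1 M f M] by (simp add: mult_2)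
  also have "(\<Sum>v=M+1..2 * M. f v) = (\<Sum>w=1..M. f (2 * M + 1 - w))"
    by (rule sum.reindex_bij_witness[of _ "\<lambda>w. 2 * M + 1 - w" "\<lambda>w. 2 * M + 1 - w"]) auto
  finally show ?thesis by (simp add: sum.distrib)
qed

definition harm_sum :: "nat \<Rightarrow> rat" where
  "harm_sum n = (\<Sum>i=1..n. 1 / of_nat i)"

lemma harm_sum_0 [simp]: "harm_sum 0 = 0"
  by (simp add: harm_sum_def)

lemma harm_sum_Suc: "harm_sum (Suc n) = harm_sum n + 1 / of_nat (Suc n)"
  by (simp add: harm_sum_def)

lemma harm_sum_pred: "n > 0 \<Longrightarrow> harm_sum (n - Suc 0) = harm_sum n - 1 / of_nat n"
  using harm_sum_Suc[of "n - 1"] by simp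

context prime_ge5
begin

definition L :: nat where "L = (p - 1) div 2"

lemma p_eq: "p = 2 * L + 1"
  using p_odd p_ge5 unfolding L_def by (auto elim!: oddE)

lemma sum_half_reflect_p:
  fixes f :: "nat \<Rightarrow> 'a :: comm_monoid_add"
  shows "(\<Sum>v=1..p - 1. f v) = (\<Sum>w=1..L. f w + f (p - w))"
proof -
  have "p - 1 = 2 * L" using p_eq by simp
  then show ?thesis using sum_half_reflect[of f L] by (simp only: p_eq[symmetric])
qed

lemma sum_even_odd_reflect_p:
  fixes f :: "nat \<Rightarrow> 'a :: comm_monoid_add"
  shows "(\<Sum>v=1..p - 1. f v) = (\<Sum>w=1..L. f (2 * w) + f (p - 2 * w))"
proof -
  have "p - 1 = 2 * L" using p_eq by simp
  then show ?thesis using sum_even_odd_reflect[of f L] by (simp only: p_eq[symmetric])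
qed

lemma not_dvd_between: "0 < u \<Longrightarrow> u < p \<Longrightarrow> \<not> p dvd u"
  using dvd_imp_le by fastforce

lemma not_dvd_fact: "n < p \<Longrightarrow> \<not> p dvd fact n"
  using prime_p by (simp add: prime_dvd_fact_iff)

lemma Zp_divide_fact: "x \<in> Zp \<Longrightarrow> n < p \<Longrightarrow> x / fact n \<in> Zp"
  using Zp_divide_of_nat(1)[of x "fact n"] not_dvd_fact by simp

text \<open>The easy part of von Staudt's theorem: Faulhaber's formula with the single summand i = 0
  is a recurrence whose denominators are factorials of numbers at most k + 1 < p.\<close>

lemma bernoulli_over_fact_Zp: "k + 2 \<le> p \<Longrightarrow> bernoulli k / fact k \<in> Zp"
proof (induction k rule: less_induct)
  case (less k)
  have split: "(\<Sum>i<1. of_nat i ^ k) / fact k =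
      (\<Sum>i<k. bernoulli i / fact i * (1 / fact (k + 1 - i))) + bernoulli k / fact k"
    using sum_power_bernoulli[of k 1] by (simp add: lessThan_Suc_atMost[symmetric])
  have "(\<Sum>i<k. bernoulli i / fact i * (1 / fact (k + 1 - i))) \<in> Zp"
  proof (intro Zp_sum Zp_mult)
    fix i assume "i \<in> {..<k}"
    then show "bernoulli i / fact i \<in> Zp" "1 / fact (k + 1 - i) \<in> Zp"
      using less by (auto intro!: Zp_divide_fact simp del: fact_Suc)
  qed
  moreover have "(\<Sum>i<1. (of_nat i :: rat) ^ k) / fact k \<in> Zp"
    using less.prems by (intro Zp_divide_fact) auto
  ultimately show ?case
    unfolding split using Zp_diff by fastforce
qed

text \<open>Every term of Faulhaber's formula with upper limit p contains a positive power of p, and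
  for \<open>j + 2 \<le> p\<close> neither the Bernoulli numbers nor the factorials in it introduce
  a p in the denominator.\<close>

lemma sum_power_p:
  assumes "0 < j" "j + 2 \<le> p"
  shows "(\<Sum>v=1..p - 1. of_nat v ^ j) \<in> I 1"
proof -
  have "{..<p} = insert 0 {1..p - 1}" using p_ge5 by auto
  then have "(\<Sum>v=1..p - 1. of_nat v ^ j) = (\<Sum>v<p. (of_nat v :: rat) ^ j)"
    using assms by simp
  also have "\<dots> = fact j *
      (\<Sum>k\<le>j. bernoulli k / fact k * (of_nat p ^ (j + 1 - k) / fact (j + 1 - k)))"
    using sum_power_bernoulli[of j p] by (simp add: field_simps)
  also have "\<dots> \<in> I 1"
  proof (intro Zp_mult_I I_sum)
    show "(fact j :: rat) \<in> Zp" using Zp_of_nat[of "fact j"] by simp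
    fix k assume k: "k \<in> {..j}"
    then show "bernoulli k / fact k \<in> Zp" using assms by (intro bernoulli_over_fact_Zp) auto
    have "(of_nat p :: rat) ^ (j + 1 - k) \<in> I 1"
      by (rule I_mono[OF I_p_power]) (use k in auto)
    then show "(of_nat p :: rat) ^ (j + 1 - k) / fact (j + 1 - k) \<in> I 1"
      using I_divide[of _ 1 "fact (j + 1 - k)"] not_dvd_fact[of "j + 1 - k"] assms
      by simp
  qed
  finally show ?thesis .
qed

lemma cg_of_nat: "[a = b] (mod p ^ k) \<Longrightarrow> cg k (of_nat a) (of_nat b)"
proof (induction a b rule: linorder_wlog)
  case (le a b)
  then have "p ^ k dvd b - a"
    by (metis cong_def mod_eq_dvd_iff_nat)
  then have "cg k (of_nat b) (of_nat a)"
    using I_of_nat[of k "b - a"] le by (simp add: cg_def of_nat_diff)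
  then show ?case by (rule cg_sym)
qed (simp add: cg_sym cong_sym)

lemma cg_inverse_neg:
  assumes "\<not> p dvd i" "\<not> p dvd j" "p ^ k dvd i + j"
  shows "cg k (1 / of_nat i) (- 1 / of_nat j)"
proof -
  have "i \<noteq> 0" "j \<noteq> 0" using assms by (metis dvd_0_right)+
  then have "1 / of_nat i - (- 1 / of_nat j) = (of_nat (i + j) / of_nat i / of_nat j :: rat)"
    by (simp add: field_simps)
  then show ?thesis
    unfolding cg_def using I_divide[OF I_divide[OF I_of_nat[OF assms(3)] assms(1)] assms(2)] by simp
qed

lemma cg_inverse_reflect:
  assumes "0 < u" "u < p"
  shows "cg 1 (1 / of_nat (p - u) ^ e) ((- 1) ^ e / of_nat u ^ e)"
proof -
  have "cg 1 (1 / of_nat (p - u)) (- 1 / of_nat u)"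
    using assms by (intro cg_inverse_neg not_dvd_between) auto
  from cg_power[OF this, of e] show ?thesis
    using assms not_dvd_between[of u] Zp_divide_of_nat(1)[of "- 1" u]
    unfolding power_divide power_one by simp
qed

lemma harm_sum_Zp: "n < p \<Longrightarrow> harm_sum n \<in> Zp"
  unfolding harm_sum_def by (intro Zp_sum Zp_divide_of_nat not_dvd_between) auto

lemma harm_sum_p_minus_1: "harm_sum (p - 1) \<in> I 1"
proof -
  have "harm_sum (p - 1) = (\<Sum>w=1..L. 1 / of_nat w + 1 / of_nat (p - w))"
    unfolding harm_sum_def by (rule sum_half_reflect_p)
  also have "cg 1 \<dots> (\<Sum>w=1..L. 1 / of_nat w + (- 1) / of_nat w)"
    using p_eq cg_inverse_reflect[of _ 1] by (intro cg_sum cg_add) auto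
  finally show ?thesis by (simp add: cg_0)
qed

lemma harm_sum_reflect: "u < p \<Longrightarrow> cg 1 (harm_sum (p - 1 - u)) (harm_sum u)"
proof (induction u)
  case 0
  then show ?case using harm_sum_p_minus_1 by (simp add: cg_0)
next
  case (Suc u)
  have "harm_sum (p - 1 - Suc u) = harm_sum (p - 1 - u) - 1 / of_nat (p - Suc u)"
    using harm_sum_pred[of "p - 1 - u"] Suc.prems by simp
  also have "cg 1 \<dots> (harm_sum u - (- 1) / of_nat (Suc u))"
    using Suc cg_inverse_reflect[of "Suc u" 1] by (intro cg_diff) auto
  finally show ?case by (simp add: harm_sum_Suc)
qed

text \<open>Inverses become positive powers, to which Faulhaber's formula applies.\<close>

lemma fermat_inverse:
  assumes "0 < i" "i < p"
  shows "cg 1 (1 / of_nat i) (of_nat i ^ (p - 2))"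
proof -
  have "[i ^ (p - 1) = 1] (mod p)"
    using fermat_theorem[OF prime_p not_dvd_between[OF assms]] .
  then have "cg 1 (of_nat (i ^ (p - 1))) (of_nat 1)"
    by (intro cg_of_nat) simp
  then have "cg 1 (of_nat (i ^ (p - 1)) / of_nat i) (of_nat 1 / of_nat i)"
    using assms by (intro cg_divide not_dvd_between) auto
  moreover have "p - 1 = Suc (p - 2)" using p_ge5 by simp
  ultimately show ?thesis using assms by (simp add: cg_sym)
qed

abbreviation B :: rat where "B \<equiv> bernoulli (p - 3)"

lemma B_Zp: "B \<in> Zp"
proof -
  have "bernoulli (p - 3) / fact (p - 3) * of_nat (fact (p - 3)) \<in> Zp"
    using p_ge5 by (intro Zp_mult bernoulli_over_fact_Zp Zp_of_nat) auto
  then show ?thesis by simp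
qed

text \<open>The entry point of the Bernoulli number. With \<open>1 / i\<close> replaced by
  \<open>i^(p-2)\<close>, Faulhaber's formula makes the harmonic number a polynomial in v whose
  coefficients are Bernoulli numbers. Summing over v picks out the single coefficient whose power of
  v becomes \<open>v^0\<close> after division by \<open>v^2\<close>.\<close>

lemma sum_harm_over_square: "cg 1 (\<Sum>v=1..p - 1. harm_sum (v - 1) / of_nat v ^ 2) B"
proof -
  define c where "c k = bernoulli k / fact k * (1 / fact (p - 1 - k))" for k
  define T :: "nat \<Rightarrow> rat" where "T k = (\<Sum>v=1..p - 1. of_nat v ^ (p - 1 - k) / of_nat v ^ 2)" for k
  have p2: "p - 2 + 1 = p - 1" "Suc (p - 2) = p - 1" using p_ge5 by auto
  have c: "c k \<in> Zp" if "k \<le> p - 2" for k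
    unfolding c_def using that p_ge5 by (intro Zp_mult bernoulli_over_fact_Zp Zp_divide_fact) auto
  have "cg 1 (\<Sum>v=1..p - 1. harm_sum (v - 1) / of_nat v ^ 2)
      (\<Sum>v=1..p - 1. (\<Sum>i<v. of_nat i ^ (p - 2)) / of_nat v ^ 2)"
  proof (intro cg_sum cg_divide_power not_dvd_between)
    fix v assume v: "v \<in> {1..p - 1}"
    then have "{..<v} = insert 0 {1..v - 1}" by auto
    then have "(\<Sum>i<v. (of_nat i :: rat) ^ (p - 2)) = (\<Sum>i=1..v - 1. of_nat i ^ (p - 2))"
      using p_ge5 by simp
    moreover have "cg 1 (harm_sum (v - 1)) (\<Sum>i=1..v - 1. of_nat i ^ (p - 2))"
      unfolding harm_sum_def using v by (intro cg_sum fermat_inverse) auto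
    ultimately show "cg 1 (harm_sum (v - 1)) (\<Sum>i<v. of_nat i ^ (p - 2))"
      by simp
  qed auto
  also have "(\<Sum>v=1..p - 1. (\<Sum>i<v. of_nat i ^ (p - 2)) / of_nat v ^ 2) =
      (\<Sum>v=1..p - 1. \<Sum>k\<le>p - 2. fact (p - 2) * c k * (of_nat v ^ (p - 1 - k) / of_nat v ^ 2))"
  proof (intro sum.cong refl)
    fix v
    have "(\<Sum>i<v. of_nat i ^ (p - 2)) = fact (p - 2) * (\<Sum>k\<le>p - 2. c k * of_nat v ^ (p - 1 - k))"
      using sum_power_bernoulli[of "p - 2" v] unfolding p2 c_def by (simp add: field_simps)
    then show "(\<Sum>i<v. of_nat i ^ (p - 2)) / of_nat v ^ 2 =
      (\<Sum>k\<le>p - 2. fact (p - 2) * c k * (of_nat v ^ (p - 1 - k) / of_nat v ^ 2))"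
      by (simp add: sum_distrib_left sum_divide_distrib mult.assoc)
  qed
  also have "\<dots> = (\<Sum>k\<le>p - 2. fact (p - 2) * c k * T k)"
    by (subst sum.swap) (simp add: T_def sum_distrib_left)
  also have "cg 1 \<dots> (\<Sum>k\<le>p - 2. fact (p - 2) * c k * (if k = p - 3 then - 1 else 0))"
  proof (intro cg_sum cg_mult_left Zp_mult c)
    show "(fact (p - 2) :: rat) \<in> Zp" using Zp_of_nat[of "fact (p - 2)"] by simp
    fix k assume k: "k \<in> {..p - 2}"
    \<comment> \<open>The exponent of v is p - 3 - k. Positive exponents give power sums divisible
      by p, exponent -1 gives the full harmonic sum, and only exponent 0 survives with value p -
      1.\<close>
    consider "k + 4 \<le> p" | "k = p - 3" | "k = p - 2" using k by fastforce
    then show "cg 1 (T k) (if k = p - 3 then - 1 else 0)"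
    proof cases
      case 1
      then have *: "p - 1 - k = (p - 3 - k) + 2" by simp
      have "T k = (\<Sum>v=1..p - 1. of_nat v ^ (p - 3 - k))"
        unfolding T_def * power_add by (intro sum.cong) auto
      moreover have "k \<noteq> p - 3" using 1 by simp
      ultimately show ?thesis using 1 sum_power_p[of "p - 3 - k"] by (simp add: cg_0)
    next
      case 2
      then have "p - 1 - k = 2" using p_ge5 by simp
      then have "T k = of_nat p - 1"
        unfolding T_def using p_ge5 by (simp add: of_nat_diff)
      then show ?thesis using 2 I_p by (simp add: cg_def)
    next
      case 3
      then have "p - 1 - k = 1" using p_ge5 by simp
      then have "T k = harm_sum (p - 1)"
        unfolding T_def harm_sum_def by (intro sum.cong) (auto simp: power2_eq_square)
      moreover have "k \<noteq> p - 3" using 3 p_ge5 by simp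
      ultimately show ?thesis using harm_sum_p_minus_1 by (simp add: cg_0)
    qed
  qed auto
  also have "\<dots> = - (fact (p - 2) * c (p - 3))"
    using p_ge5 by (simp add: if_distrib cong: if_cong)
  \<comment> \<open>(p - 2)! / ((p - 3)! 2!) is (p - 2) / 2, which is -1 modulo p.\<close>
  also have "\<dots> = - (of_nat p - 2) / 2 * B"
  proof -
    have "p - 2 = Suc (p - 3)" "p - 1 - (p - 3) = 2" using p_ge5 by auto
    then have "fact (p - 2) = (of_nat p - 2) * (fact (p - 3) :: rat)" "p - 1 - (p - 3) = 2"
      using p_ge5 by (auto simp: of_nat_diff)
    then show ?thesis by (simp add: c_def) (simp add: algebra_simps)
  qed
  also have "cg 1 \<dots> B"
  proof -
    have "- (of_nat p - 2) / 2 * B - B = of_nat p * (- 1 / 2 * B)" by (simp add: field_simps)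
    moreover have "of_nat p * (- 1 / 2 * B) \<in> I 1"
      using I_p B_Zp by (intro I_mult_Zp Zp_mult) auto
    ultimately show ?thesis unfolding cg_def by metis
  qed
  finally show ?thesis .
qed

section \<open>Harmonic sums over half a period\<close>

definition h_half :: rat where "h_half = (\<Sum>v=1..L. 1 / of_nat v ^ 3)"
definition a_half :: rat where "a_half = (\<Sum>v=1..L. harm_sum v / of_nat v ^ 2)"
definition b_half :: rat where "b_half = (\<Sum>v=1..L. harm_sum (2 * v) / of_nat v ^ 2)"

text \<open>Folding v with p - v: the lower half contributes \<open>harm_sum v - 1 / v\<close>, the
  upper half \<open>harm_sum v\<close>. The next lemma folds 2 v with p - 2 v instead, which gives a
  second relation for the same sum.\<close>

lemma harm_over_square_half:
  "cg 1 (\<Sum>v=1..p - 1. harm_sum (v - 1) / of_nat v ^ 2) (2 * a_half - h_half)"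
proof -
  have "(\<Sum>v=1..p - 1. harm_sum (v - 1) / of_nat v ^ 2) =
    (\<Sum>v=1..L. harm_sum (v - 1) / of_nat v ^ 2 + harm_sum (p - v - 1) / of_nat (p - v) ^ 2)"
    by (rule sum_half_reflect_p)
  also have "cg 1 \<dots> (\<Sum>v=1..L. (harm_sum v - 1 / of_nat v) / of_nat v ^ 2 + harm_sum v * (1 / of_nat v ^ 2))"
  proof (intro cg_sum cg_add)
    fix v assume v: "v \<in> {1..L}"
    then have v': "0 < v" "v < p" using p_eq by auto
    show "cg 1 (harm_sum (v - 1) / of_nat v ^ 2) ((harm_sum v - 1 / of_nat v) / of_nat v ^ 2)"
      using v' by (simp add: harm_sum_pred)
    have "cg 1 (harm_sum (p - v - 1) * (1 / of_nat (p - v) ^ 2)) (harm_sum v * (1 / of_nat v ^ 2))"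
      using v' harm_sum_reflect[of v] cg_inverse_reflect[of v 2]
      by (intro cg_mult harm_sum_Zp Zp_divide_of_nat not_dvd_between) (auto simp: diff_commute)
    then show "cg 1 (harm_sum (p - v - 1) / of_nat (p - v) ^ 2) (harm_sum v * (1 / of_nat v ^ 2))"
      by simp
  qed
  also have "\<dots> = 2 * a_half - h_half"
    unfolding a_half_def h_half_def sum_distrib_left sum_subtractf[symmetric]
    by (intro sum.cong refl) (simp add: field_simps power3_eq_cube power2_eq_square)
  finally show ?thesis .
qed

lemma harm_over_square_parity:
  "cg 1 (\<Sum>v=1..p - 1. harm_sum (v - 1) / of_nat v ^ 2) (b_half / 2 - h_half / 8)"
proof -
  have "(\<Sum>v=1..p - 1. harm_sum (v - 1) / of_nat v ^ 2) =
    (\<Sum>v=1..L. harm_sum (2 * v - 1) / of_nat (2 * v) ^ 2 + harm_sum (p - 2 * v - 1) / of_nat (p - 2 * v) ^ 2)"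
    by (rule sum_even_odd_reflect_p)
  also have "cg 1 \<dots> (\<Sum>v=1..L. (harm_sum (2 * v) - 1 / of_nat (2 * v)) / of_nat (2 * v) ^ 2
      + harm_sum (2 * v) * (1 / of_nat (2 * v) ^ 2))"
  proof (intro cg_sum cg_add)
    fix v assume v: "v \<in> {1..L}"
    then have v': "0 < 2 * v" "2 * v < p" using p_eq by auto
    show "cg 1 (harm_sum (2 * v - 1) / of_nat (2 * v) ^ 2) ((harm_sum (2 * v) - 1 / of_nat (2 * v)) / of_nat (2 * v) ^ 2)"
      using v' by (simp add: harm_sum_pred)
    have "cg 1 (harm_sum (p - 2 * v - 1) * (1 / of_nat (p - 2 * v) ^ 2)) (harm_sum (2 * v) * (1 / of_nat (2 * v) ^ 2))"
      using v' harm_sum_reflect[of "2 * v"] cg_inverse_reflect[of "2 * v" 2]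
      by (intro cg_mult harm_sum_Zp Zp_divide_of_nat not_dvd_between) (auto simp: diff_commute)
    then show "cg 1 (harm_sum (p - 2 * v - 1) / of_nat (p - 2 * v) ^ 2) (harm_sum (2 * v) * (1 / of_nat (2 * v) ^ 2))"
      by simp
  qed
  also have "\<dots> = b_half / 2 - h_half / 8"
    unfolding b_half_def h_half_def sum_divide_distrib sum_subtractf[symmetric]
    by (intro sum.cong refl) (simp add: field_simps power3_eq_cube power2_eq_square)
  finally show ?thesis .
qed

lemma sum_one_over_prod:
  assumes "w > 0"
  shows "(\<Sum>i=1..w - 1. 1 / (of_nat i * of_nat (w - i))) = 2 * harm_sum (w - 1) / of_nat w"
proof -
  have "(\<Sum>i=1..w - 1. 1 / (of_nat i * of_nat (w - i))) =
      (\<Sum>i=1..w - 1. (1 / of_nat i + 1 / of_nat (w - i)) / of_nat w :: rat)"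
    by (intro sum.cong refl) (auto simp: field_simps of_nat_diff)
  also have "(\<Sum>i=1..w - 1. 1 / of_nat (w - i) :: rat) = harm_sum (w - 1)"
    unfolding harm_sum_def using assms by (subst (2) sum.atLeastAtMost_rev) simp
  then have "(\<Sum>i=1..w - 1. (1 / of_nat i + 1 / of_nat (w - i)) / of_nat w :: rat) =
      2 * harm_sum (w - 1) / of_nat w"
    unfolding sum_divide_distrib[symmetric] sum.distrib harm_sum_def[symmetric] by simp
  finally show ?thesis .
qed

text \<open>
  The sum of \<open>1 / (2 i \<cdot> 2 j \<cdot> 2 (i + j))\<close> over \<open>i + j \<le> L\<close> is evaluated in two ways: directly,
  and after the substitution of \<open>p - 2 j\<close> and \<open>p - 2 i - 2 j\<close> for the last two factors, which
  turns it into a sum over pairs of odd numbers below \<open>p\<close>.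
\<close>

lemma a_minus_h_half: "cg 1 (a_half - h_half) b_half"
proof -
  define G :: "nat \<Rightarrow> nat \<Rightarrow> rat" where
    "G i j = 1 / of_nat (2 * i) * (1 / of_nat (2 * j) * (1 / of_nat (2 * (i + j))))" for i j
  define G' :: "nat \<Rightarrow> nat \<Rightarrow> rat" where
    "G' i j = 1 / of_nat (2 * i) * (1 / of_nat (p - 2 * j) * (1 / of_nat (p - 2 * (i + j))))" for i j
  have "(a_half - h_half) / 4 = (\<Sum>w=1..L. harm_sum (w - 1) / (4 * of_nat w ^ 2))"
    unfolding a_half_def h_half_def sum_divide_distrib sum_subtractf[symmetric]
    by (intro sum.cong refl)
      (auto simp: harm_sum_pred field_simps power3_eq_cube power2_eq_square)
  also have "\<dots> = (\<Sum>w=1..L. \<Sum>i=1..w - 1. G i (w - i))"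
  proof (intro sum.cong refl)
    fix w assume "w \<in> {1..L}"
    then have w: "w > 0" by auto
    have "harm_sum (w - 1) / (4 * of_nat w ^ 2) = 2 * harm_sum (w - 1) / of_nat w * (1 / (8 * of_nat w))"
      using w by (simp add: field_simps power2_eq_square)
    also have "\<dots> = (\<Sum>i=1..w - 1. 1 / (of_nat i * of_nat (w - i)) * (1 / (8 * of_nat w)))"
      by (simp only: sum_one_over_prod[OF w, symmetric] sum_distrib_right)
    also have "\<dots> = (\<Sum>i=1..w - 1. G i (w - i))"
      by (intro sum.cong refl) (auto simp: G_def)
    finally show "harm_sum (w - 1) / (4 * of_nat w ^ 2) = (\<Sum>i=1..w - 1. G i (w - i))" .
  qed
  also have "\<dots> = (\<Sum>j=1..L. \<Sum>i=1..L - j. G i j)"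
    unfolding sum.Sigma[OF finite_atLeastAtMost ballI[OF finite_atLeastAtMost]]
    by (rule sum.reindex_bij_witness[of _ "\<lambda>(j, i). (i + j, i)" "\<lambda>(w, i). (w - i, i)"]) auto
  also have "cg 1 \<dots> (\<Sum>j=1..L. \<Sum>i=1..L - j. G' i j)"
  proof (intro cg_sum)
    fix j i assume "j \<in> {1..L}" "i \<in> {1..L - j}"
    then have ij: "0 < i" "0 < j" "2 * (i + j) < p" using p_eq by auto
    have "cg 1 (1 / of_nat (p - 2 * j) * (1 / of_nat (p - 2 * (i + j))))
        ((- 1) ^ 1 / of_nat (2 * j) ^ 1 * ((- 1) ^ 1 / of_nat (2 * (i + j)) ^ 1))"
      using ij cg_inverse_reflect[of "2 * j" 1] cg_inverse_reflect[of "2 * (i + j)" 1]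
      using not_dvd_between[of "2 * j"] not_dvd_between[of "p - 2 * (i + j)"]
        Zp_divide_of_nat(1)[of "- 1" "2 * j"] Zp_divide_of_nat(1)[of 1 "p - 2 * (i + j)"]
      by (intro cg_mult) simp_all
    then have "cg 1 (1 / of_nat (2 * i) * (1 / of_nat (p - 2 * j) * (1 / of_nat (p - 2 * (i + j)))))
        (1 / of_nat (2 * i) * ((- 1) ^ 1 / of_nat (2 * j) ^ 1 * ((- 1) ^ 1 / of_nat (2 * (i + j)) ^ 1)))"
      using ij by (intro cg_mult_left Zp_divide_of_nat not_dvd_between) auto
    then show "cg 1 (G i j) (G' i j)"
      unfolding G_def G'_def by (simp add: cg_sym)
  qed
  also have "(\<Sum>j=1..L. \<Sum>i=1..L - j. G' i j) = (\<Sum>j=1..L. harm_sum (p - 1 - 2 * j) * (1 / of_nat (p - 2 * j) ^ 2))"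
  proof (intro sum.cong refl)
    fix j assume j: "j \<in> {1..L}"
    then have q: "p - 2 * j = 2 * (L - j) + 1" using p_eq by auto
    \<comment> \<open>The outer factors have denominators 2 i and p - 2 j - 2 i with sum p - 2 j, so
      partial fractions apply once more. As i varies, these are the even and the odd numbers below p
      - 2 j, and a full harmonic number results.\<close>
    have "(\<Sum>i=1..L - j. G' i j) = (\<Sum>i=1..L - j.
       (1 / of_nat (2 * i) + 1 / of_nat (p - 2 * j - 2 * i)) * (1 / of_nat (p - 2 * j) ^ 2))"
    proof (intro sum.cong refl)
      fix i assume i: "i \<in> {1..L - j}"
      define x :: rat where "x = of_nat (2 * i)"
      define y :: rat where "y = of_nat (p - 2 * j - 2 * i)"
      have "p - 2 * j = 2 * i + (p - 2 * j - 2 * i)" using i q by auto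
      then have xy: "of_nat (p - 2 * j) = x + y" unfolding x_def y_def by (metis of_nat_add)
      have pos: "x > 0" "y > 0" using i q by (auto simp: x_def y_def)
      then have "1 / x + 1 / y = (x + y) / (x * y)" "x + y \<noteq> 0"
        by (simp_all add: field_simps)
      then have "1 / x * (1 / (x + y) * (1 / y)) = (1 / x + 1 / y) * (1 / (x + y) ^ 2)"
        by (simp add: power2_eq_square)
      moreover have "p - 2 * (i + j) = p - 2 * j - 2 * i" by simp
      ultimately show "G' i j = (1 / of_nat (2 * i) + 1 / of_nat (p - 2 * j - 2 * i)) * (1 / of_nat (p - 2 * j) ^ 2)"
        unfolding G'_def x_def[symmetric] y_def[symmetric] xy by (simp add: y_def)
    qed
    also have "\<dots> = harm_sum (2 * (L - j)) * (1 / of_nat (p - 2 * j) ^ 2)"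
      unfolding harm_sum_def sum_even_odd_reflect sum_distrib_right q by simp
    also have "2 * (L - j) = p - 1 - 2 * j" using p_eq by simp
    finally show "(\<Sum>i=1..L - j. G' i j) = harm_sum (p - 1 - 2 * j) * (1 / of_nat (p - 2 * j) ^ 2)" .
  qed
  also have "cg 1 \<dots> (\<Sum>j=1..L. harm_sum (2 * j) * ((- 1) ^ 2 / of_nat (2 * j) ^ 2))"
  proof (intro cg_sum cg_mult)
    fix j assume j: "j \<in> {1..L}"
    then have j': "0 < 2 * j" "2 * j < p" using p_eq by auto
    show "cg 1 (harm_sum (p - 1 - 2 * j)) (harm_sum (2 * j))"
      using j'(2) by (rule harm_sum_reflect)
    show "harm_sum (2 * j) \<in> Zp"
      using j'(2) by (rule harm_sum_Zp)
    show "cg 1 (1 / of_nat (p - 2 * j) ^ 2) ((- 1) ^ 2 / of_nat (2 * j) ^ 2)"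
      using j' by (rule cg_inverse_reflect)
    show "1 / of_nat (p - 2 * j) ^ 2 \<in> Zp"
      using j' by (intro Zp_divide_of_nat not_dvd_between) auto
  qed
  also have "\<dots> = b_half / 4"
    unfolding b_half_def sum_divide_distrib by (intro sum.cong) auto
  finally have "cg 1 ((a_half - h_half) / 4) (b_half / 4)" .
  then have "cg 1 (4 * ((a_half - h_half) / 4)) (4 * (b_half / 4))"
    by (intro cg_mult_left) simp
  moreover have "4 * ((a_half - h_half) / 4) = a_half - h_half" "4 * (b_half / 4) = b_half"
    by simp_all
  ultimately show ?thesis by (simp only:)
qed

text \<open>The relations 2 a - h = B, b/2 - h/8 = B and a - h = b have determinant -3/4 in a, b, h,
  a unit for p > 3. The coefficients passed to \<open>comb\<close> are the corresponding rows of the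
  inverse matrix.\<close>

lemma h_half_B: "cg 1 h_half (- 2 * B)"
  and a_half_B: "cg 1 a_half (- B / 2)"
  and b_half_B: "cg 1 b_half (3 * B / 2)"
proof -
  have 1: "2 * a_half - h_half - B \<in> I 1"
    using cg_trans[OF cg_sym[OF harm_over_square_half] sum_harm_over_square] by (simp add: cg_def)
  have 2: "b_half / 2 - h_half / 8 - B \<in> I 1"
    using cg_trans[OF cg_sym[OF harm_over_square_parity] sum_harm_over_square] by (simp add: cg_def)
  have 3: "a_half - h_half - b_half \<in> I 1"
    using a_minus_h_half by (simp add: cg_def)
  have comb: "u \<in> I 1"
    if "u = x * (2 * a_half - h_half - B) + y * (b_half / 2 - h_half / 8 - B) + z * (a_half - h_half - b_half)"
      "x \<in> Zp" "y \<in> Zp" "z \<in> Zp" for u x y z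
    unfolding that(1) using that(2-) 1 2 3 by (intro I_add Zp_mult_I)
  show "cg 1 h_half (- 2 * B)"
    unfolding cg_def
    by (rule comb[of _ "2 / 3" "- (8 / 3)" "- (4 / 3)"]) (simp_all add: field_simps)
  show "cg 1 a_half (- B / 2)"
    unfolding cg_def
    by (rule comb[of _ "5 / 6" "- (4 / 3)" "- (2 / 3)"]) (simp_all add: field_simps)
  show "cg 1 b_half (3 * B / 2)"
    unfolding cg_def
    by (rule comb[of _ "1 / 6" "4 / 3" "- (1 / 3)"]) (simp_all add: field_simps)
qed

end

section \<open>Inverse power sums over half blocks\<close>

lemma div_eq_iff_bounds: "0 < b \<Longrightarrow> x div b = z \<longleftrightarrow> z * b \<le> x \<and> x < (z + 1) * b" for x b z :: nat
  using div_nat_eqI[of b z x] dividend_less_times_div[of b x] times_div_less_eq_dividend[of b x]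
  by (auto simp: mult.commute)

context prime_ge5
begin

text \<open>
  \<open>block a z\<close> consists of the integers prime to \<open>p\<close> in the half-open interval from \<open>z p\<^sup>a / 2\<close>
  to \<open>(z + 1) p\<^sup>a / 2\<close>. Half intervals are needed because \<open>2 k choose n\<close> depends on \<open>2 k\<close>.
\<close>

definition block :: "nat \<Rightarrow> nat \<Rightarrow> nat set" where
  "block a z = {k. \<not> p dvd k \<and> 2 * k div p ^ a = z}"

definition phi :: "nat \<Rightarrow> nat \<Rightarrow> nat \<Rightarrow> rat" where
  "phi e a z = (\<Sum>k\<in>block a z. 1 / of_nat k ^ e)"

lemma finite_block [simp]: "finite (block a z)"
proof (rule finite_subset)
  show "block a z \<subseteq> {..(z + 1) * p ^ a}"
  proof
    fix k assume "k \<in> block a z"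
    then have "2 * k < (z + 1) * p ^ a"
      by (auto simp: block_def div_eq_iff_bounds)
    then show "k \<in> {..(z + 1) * p ^ a}" by auto
  qed
qed simp

text \<open>Nested floors: dividing 2 k by \<open>p^(a+1)\<close> is dividing by \<open>p^a\<close>
  and then by p, so p consecutive half blocks form one of the next size.\<close>

lemma sum_block_Suc:
  fixes f :: "nat \<Rightarrow> 'a :: comm_monoid_add"
  shows "(\<Sum>k\<in>block (Suc a) y. f k) = (\<Sum>z=y * p..<y * p + p. \<Sum>k\<in>block a z. f k)"
proof -
  have *: "2 * k div p ^ Suc a = y \<longleftrightarrow> 2 * k div p ^ a \<in> {y * p..<y * p + p}" for k
  proof -
    have "2 * k div p ^ Suc a = 2 * k div p ^ a div p"
      by (simp only: power_Suc2 div_mult2_eq)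
    moreover have "n div p = y \<longleftrightarrow> y * p \<le> n \<and> n < y * p + p" for n
      by (simp add: div_eq_iff_bounds algebra_simps)
    ultimately show ?thesis by simp
  qed
  have "block (Suc a) y = (\<Union>z\<in>{y * p..<y * p + p}. block a z)"
  proof (rule Set.set_eqI)
    fix k
    show "k \<in> block (Suc a) y \<longleftrightarrow> k \<in> (\<Union>z\<in>{y * p..<y * p + p}. block a z)"
      unfolding block_def using *[of k] by blast
  qed
  moreover have "(\<Sum>k\<in>(\<Union>z\<in>{y * p..<y * p + p}. block a z). f k) =
      (\<Sum>z=y * p..<y * p + p. \<Sum>k\<in>block a z. f k)"
    by (rule sum.UNION_disjoint) (simp_all, auto simp: block_def)
  ultimately show ?thesis by simp
qed

lemma phi_Suc: "phi e (Suc a) y = (\<Sum>z=y * p..<y * p + p. phi e a z)"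
  unfolding phi_def by (rule sum_block_Suc)

lemma block_half_iff: "u \<in> block a 0 \<longleftrightarrow> \<not> p dvd u \<and> 2 * u < p ^ a"
  unfolding block_def using div_eq_iff_bounds[of "p ^ a" "2 * u" 0] by simp

text \<open>An even half block is a translate of the block 0, an odd one (next lemma) is its mirror
  image. All later distinctions by the parity of z come from this.\<close>

lemma sum_block_even:
  fixes f :: "nat \<Rightarrow> 'a :: comm_monoid_add"
  assumes "a > 0"
  shows "(\<Sum>k\<in>block a (2 * y). f k) = (\<Sum>u\<in>block a 0. f (y * p ^ a + u))"
proof (rule sum.reindex_bij_witness[of _ "\<lambda>u. y * p ^ a + u" "\<lambda>k. k - y * p ^ a"])
  have dvd: "p dvd y * p ^ a" using assms by simp
  fix k assume "k \<in> block a (2 * y)"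
  then have k: "\<not> p dvd k" "y * p ^ a \<le> k" "2 * k < 2 * y * p ^ a + p ^ a"
    by (auto simp: block_def div_eq_iff_bounds algebra_simps)
  then show "y * p ^ a + (k - y * p ^ a) = k" by simp
  then show "f (y * p ^ a + (k - y * p ^ a)) = f k" by simp
  show "k - y * p ^ a \<in> block a 0"
    using k dvd by (auto simp: block_half_iff dvd_diff_nat dest: dvd_diffD)
next
  have dvd: "p dvd y * p ^ a" using assms by simp
  fix u assume "u \<in> block a 0"
  then have u: "\<not> p dvd u" "2 * u < p ^ a" by (auto simp: block_half_iff)
  show "y * p ^ a + u - y * p ^ a = u" by simp
  show "y * p ^ a + u \<in> block a (2 * y)"
    using u dvd dvd_add_right_iff[OF dvd, of u]
    by (simp add: block_def div_eq_iff_bounds algebra_simps)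
qed

lemma sum_block_odd:
  fixes f :: "nat \<Rightarrow> 'a :: comm_monoid_add"
  assumes "a > 0"
  shows "(\<Sum>k\<in>block a (2 * y + 1). f k) = (\<Sum>u\<in>block a 0. f ((y + 1) * p ^ a - u))"
proof (rule sum.reindex_bij_witness[of _ "\<lambda>u. (y + 1) * p ^ a - u" "\<lambda>k. (y + 1) * p ^ a - k"])
  have dvd: "p dvd (y + 1) * p ^ a" using assms by simp
  fix k assume "k \<in> block a (2 * y + 1)"
  then have k: "\<not> p dvd k" "2 * y * p ^ a + p ^ a \<le> 2 * k" "2 * k < 2 * ((y + 1) * p ^ a)"
    by (auto simp: block_def div_eq_iff_bounds algebra_simps)
  \<comment> \<open>Since \<open>p^a\<close> is odd, the left boundary
    \<open>(2 y + 1) p^a / 2\<close> is not an integer; this gives the strict inequality needed on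
    the reflected side.\<close>
  have "odd (p ^ a)" using p_odd by simp
  then have "2 * y * p ^ a + p ^ a \<noteq> 2 * k" by (metis even_add even_mult_iff dvd_triv_left)
  with k have k': "2 * y * p ^ a + p ^ a < 2 * k" "k < (y + 1) * p ^ a" by auto
  then show "(y + 1) * p ^ a - ((y + 1) * p ^ a - k) = k" by simp
  then show "f ((y + 1) * p ^ a - ((y + 1) * p ^ a - k)) = f k" by simp
  have "\<not> p dvd (y + 1) * p ^ a - k"
    using k(1) k'(2) dvd by (metis dvd_diffD1 less_imp_le)
  then show "(y + 1) * p ^ a - k \<in> block a 0"
    using k' by (auto simp: block_half_iff algebra_simps)
next
  have dvd: "p dvd (y + 1) * p ^ a" using assms by simp
  fix u assume "u \<in> block a 0"
  then have u: "\<not> p dvd u" "2 * u < p ^ a" by (auto simp: block_half_iff)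
  then have u': "0 < u" "u < (y + 1) * p ^ a" by (auto intro: Nat.gr0I)
  then show "(y + 1) * p ^ a - ((y + 1) * p ^ a - u) = u" by simp
  have "\<not> p dvd (y + 1) * p ^ a - u"
    using u(1) u'(2) dvd by (metis dvd_diffD1 less_imp_le)
  then show "(y + 1) * p ^ a - u \<in> block a (2 * y + 1)"
    using u u' by (auto simp: block_def div_eq_iff_bounds algebra_simps)
qed

text \<open>The hypothesis says that v is the inverse of \<open>1 / u - x\<close>. Keeping u and v
  abstract lets one expansion serve for translation, where x = \<open>- y p^a\<close>, and for
  reflection, where v is the negative of an inverse.\<close>

lemma inverse_shift:
  assumes "u \<in> Zp" "v \<in> Zp" "x \<in> I f" "v - u = x * u * v"
  shows "cg f v u" and "cg (2 * f) (v ^ 2) (u ^ 2 + 2 * x * u ^ 3)"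
proof -
  have "x * (u * v) \<in> I f" using assms(1-3) by (intro I_mult_Zp) auto
  then show "cg f v u" unfolding cg_def assms(4) by (simp only: mult.assoc)
  \<comment> \<open>The difference is written as a multiple of the vanishing \<open>d\<close> plus a
    multiple of \<open>x^2\<close>, a pure polynomial identity.\<close>
  define d where "d = v - u - x * u * v"
  have d: "d = 0" unfolding d_def assms(4) by (rule diff_self)
  have "v ^ 2 - (u ^ 2 + 2 * x * u ^ 3) =
      d * (2 * u + 2 * x * u ^ 2 + (v - u) + x * u * v) + x * x * (2 * u ^ 3 * v + u ^ 2 * v ^ 2)"
    unfolding d_def by (simp add: power2_eq_square power3_eq_cube algebra_simps)
  then have "v ^ 2 - (u ^ 2 + 2 * x * u ^ 3) = x * x * (2 * u ^ 3 * v + u ^ 2 * v ^ 2)"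
    by (simp only: d mult_zero_left add_0_left)
  moreover have "x * x * (2 * u ^ 3 * v + u ^ 2 * v ^ 2) \<in> I (f + f)"
    using assms(1-3) by (intro I_mult_Zp[OF I_mult] Zp_add Zp_mult Zp_power) simp_all
  ultimately show "cg (2 * f) (v ^ 2) (u ^ 2 + 2 * x * u ^ 3)"
    unfolding cg_def mult_2 by (simp only:)
qed

lemma p_power_mult_I: "c \<in> Zp \<Longrightarrow> c * of_nat p ^ a \<in> I a"
  using Zp_mult_I[OF _ I_p_power] .

lemma inverse_add_block:
  assumes "u \<in> block a 0" "a > 0"
  shows "cg a (1 / of_nat (y * p ^ a + u)) (1 / of_nat u)"
    and "cg (2 * a) (1 / of_nat (y * p ^ a + u) ^ 2)
           (1 / of_nat u ^ 2 - 2 * of_nat y * of_nat p ^ a * (1 / of_nat u ^ 3))"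
proof -
  have nd: "\<not> p dvd u" using assms by (simp add: block_half_iff)
  then have nz: "u \<noteq> 0" by (metis dvd_0_right)
  have "p dvd y * p ^ a" using assms by simp
  then have nd': "\<not> p dvd y * p ^ a + u" using nd dvd_add_right_iff by blast
  define x :: rat where "x = - of_nat y * of_nat p ^ a"
  define V :: rat where "V = of_nat (y * p ^ a + u)"
  have "V \<noteq> 0" unfolding V_def of_nat_eq_0_iff using nz by simp
  moreover have V: "V = of_nat u - x" by (simp add: x_def V_def)
  ultimately have eq: "1 / V - 1 / of_nat u = x * (1 / of_nat u) * (1 / V)"
    using nz by (simp add: field_simps)
  have "1 / V \<in> Zp" unfolding V_def using nd' by (rule Zp_divide_of_nat[OF Zp_numeral(2)])
  moreover have "x \<in> I a" unfolding x_def by (intro p_power_mult_I) simp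
  ultimately have *: "1 / of_nat u \<in> Zp" "1 / V \<in> Zp" "x \<in> I a"
    using nd by simp_all
  show "cg a (1 / of_nat (y * p ^ a + u)) (1 / of_nat u)"
    using inverse_shift(1)[OF * eq] by (simp add: V_def)
  show "cg (2 * a) (1 / of_nat (y * p ^ a + u) ^ 2)
           (1 / of_nat u ^ 2 - 2 * of_nat y * of_nat p ^ a * (1 / of_nat u ^ 3))"
    using inverse_shift(2)[OF * eq] unfolding V_def[symmetric] by (simp add: x_def power_one_over mult.assoc)
qed

lemma inverse_sub_block:
  assumes "\<not> p dvd u" "a > 0" "u < y * p ^ a"
  shows "cg a (1 / of_nat (y * p ^ a - u)) (- 1 / of_nat u)"
    and "cg (2 * a) (1 / of_nat (y * p ^ a - u) ^ 2)
           (1 / of_nat u ^ 2 + 2 * of_nat y * of_nat p ^ a * (1 / of_nat u ^ 3))"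
proof -
  have nz: "u \<noteq> 0" using assms(1) by (metis dvd_0_right)
  have "p dvd y * p ^ a" using assms by simp
  then have nd': "\<not> p dvd y * p ^ a - u" using assms by (metis dvd_diffD1 less_imp_le)
  define x :: rat where "x = of_nat y * of_nat p ^ a"
  define V :: rat where "V = of_nat (y * p ^ a - u)"
  have "V \<noteq> 0" unfolding V_def of_nat_eq_0_iff using assms(3) by simp
  moreover have V: "x = V + of_nat u" using assms(3) by (simp add: x_def V_def of_nat_diff)
  ultimately have eq: "- 1 / V - 1 / of_nat u = x * (1 / of_nat u) * (- 1 / V)"
    unfolding V using nz by (simp add: field_simps)
  have "1 / V \<in> Zp" unfolding V_def using nd' by (rule Zp_divide_of_nat[OF Zp_numeral(2)])
  then have *: "1 / of_nat u \<in> Zp" "- 1 / V \<in> Zp" "x \<in> I a"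
    unfolding x_def using assms(1) by (auto intro!: p_power_mult_I)
  show "cg a (1 / of_nat (y * p ^ a - u)) (- 1 / of_nat u)"
    using cg_minus[OF inverse_shift(1)[OF * eq]] by (simp add: V_def)
  show "cg (2 * a) (1 / of_nat (y * p ^ a - u) ^ 2)
           (1 / of_nat u ^ 2 + 2 * of_nat y * of_nat p ^ a * (1 / of_nat u ^ 3))"
    using inverse_shift(2)[OF * eq] unfolding V_def[symmetric] by (simp add: x_def power_one_over mult.assoc)
qed

lemma block_half_less: "u \<in> block a 0 \<Longrightarrow> u < (y + 1) * p ^ a"
  by (auto simp: block_half_iff)

lemma phi_3_parity:
  assumes "a > 0"
  shows "cg a (phi 3 a z) ((- 1) ^ z * phi 3 a 0)"
proof (cases "even z")
  case True
  then obtain y where z: "z = 2 * y" by (elim evenE)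
  have "cg a (phi 3 a z) (\<Sum>u\<in>block a 0. 1 / of_nat u ^ 3)"
    unfolding z phi_def sum_block_even[OF assms]
  proof (intro cg_sum)
    fix u assume u: "u \<in> block a 0"
    then have "1 / of_nat u \<in> Zp" by (simp add: block_half_iff)
    from cg_power[OF inverse_add_block(1)[OF u assms] this, of y 3]
    show "cg a (1 / of_nat (y * p ^ a + u) ^ 3) (1 / of_nat u ^ 3)"
      by (simp only: power_one_over)
  qed
  then show ?thesis using True by (simp add: phi_def)
next
  case False
  then obtain y where z: "z = 2 * y + 1" by (elim oddE)
  have "cg a (phi 3 a z) (\<Sum>u\<in>block a 0. - (1 / of_nat u ^ 3))"
    unfolding z phi_def sum_block_odd[OF assms]
  proof (intro cg_sum)
    fix u assume u: "u \<in> block a 0"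
    then have "- 1 / of_nat u \<in> Zp" "\<not> p dvd u" by (simp_all add: block_half_iff)
    from cg_power[OF inverse_sub_block(1)[OF this(2) assms block_half_less[OF u]] this(1), of y 3]
    show "cg a (1 / of_nat ((y + 1) * p ^ a - u) ^ 3) (- (1 / of_nat u ^ 3))"
      by (simp only: power_one_over power_divide) simp
  qed
  then show ?thesis using False by (simp add: phi_def sum_negf)
qed

text \<open>An odd number of alternating signs leaves the first one, and y p has the parity of
  y.\<close>

lemma sum_alternating_block:
  "(\<Sum>z=y * p..<y * p + p. (- 1) ^ z) = ((- 1) ^ y :: rat)"
proof -
  have "(\<Sum>z<2 * l + 1. (- 1) ^ z) = (1 :: rat)" for l
    by (induction l) simp_all
  then have *: "(\<Sum>z<p. (- 1) ^ z) = (1 :: rat)" using p_eq by metis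
  have "(\<Sum>z=y * p..<y * p + p. (- 1) ^ z) = (\<Sum>u<p. (- 1) ^ (y * p + u) :: rat)"
    using sum.shift_bounds_nat_ivl[of "\<lambda>z. (- 1) ^ z :: rat" 0 "y * p" p]
    by (simp add: lessThan_atLeast0 add.commute)
  also have "\<dots> = (- 1) ^ y"
    unfolding power_add sum_distrib_left[symmetric] * using p_odd by (simp add: power_mult[symmetric] mult.commute minus_one_power_iff)
  finally show ?thesis .
qed

lemma block_1_0: "block 1 0 = {1..L}"
  using p_eq not_dvd_between by (auto simp: block_half_iff Suc_le_eq intro: Nat.gr0I)

text \<open>Enlarging the block replaces the sum by p alternating copies of itself, of which one
  remains; hence the residue modulo p does not depend on a.\<close>

lemma phi_3_0: "a > 0 \<Longrightarrow> cg 1 (phi 3 a 0) h_half"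
proof (induction a rule: nat_induct_non_zero)
  case 1
  show ?case using block_1_0 by (simp add: phi_def h_half_def)
next
  case (Suc a)
  have "cg 1 (phi 3 (Suc a) 0) (\<Sum>z=0 * p..<0 * p + p. (- 1) ^ z * phi 3 a 0)"
    unfolding phi_Suc using Suc.hyps by (intro cg_sum cg_mono[OF phi_3_parity]) auto
  also have "\<dots> = phi 3 a 0"
    unfolding sum_distrib_right[symmetric] sum_alternating_block by simp
  also note Suc.IH
  finally show ?case .
qed

text \<open>First-order expansion in \<open>p^a\<close>; the neglected terms have order 2 a, which
  is at least a + 1.\<close>

lemma phi_2_even_odd:
  assumes "a > 0"
  shows "cg (a + 1) (phi 2 a (2 * y)) (phi 2 a 0 - 2 * of_nat y * (of_nat p ^ a * phi 3 a 0))"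
    and "cg (a + 1) (phi 2 a (2 * y + 1)) (phi 2 a 0 + 2 * of_nat (y + 1) * (of_nat p ^ a * phi 3 a 0))"
proof -
  have le: "a + 1 \<le> 2 * a" using assms by simp
  have "cg (a + 1) (phi 2 a (2 * y))
    (\<Sum>u\<in>block a 0. 1 / of_nat u ^ 2 - 2 * of_nat y * of_nat p ^ a * (1 / of_nat u ^ 3))"
    unfolding phi_def sum_block_even[OF assms]
    by (intro cg_sum cg_mono[OF inverse_add_block(2) le] assms)
  then show "cg (a + 1) (phi 2 a (2 * y)) (phi 2 a 0 - 2 * of_nat y * (of_nat p ^ a * phi 3 a 0))"
    unfolding phi_def sum_subtractf sum_distrib_left[symmetric] by (simp only: mult.assoc)
  have "cg (a + 1) (phi 2 a (2 * y + 1))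
    (\<Sum>u\<in>block a 0. 1 / of_nat u ^ 2 + 2 * of_nat (y + 1) * of_nat p ^ a * (1 / of_nat u ^ 3))"
    unfolding phi_def sum_block_odd[OF assms]
    by (intro cg_sum cg_mono[OF inverse_sub_block(2) le] assms block_half_less) 
      (auto simp: block_half_iff)
  then show "cg (a + 1) (phi 2 a (2 * y + 1)) (phi 2 a 0 + 2 * of_nat (y + 1) * (of_nat p ^ a * phi 3 a 0))"
    unfolding phi_def sum.distrib sum_distrib_left[symmetric] by (simp only: mult.assoc)
qed

text \<open>
  The units below \<open>p\<^sup>a\<close> are enumerated once by halves and once by parity. Comparing the two
  expressions for the sum of their inverse squares determines \<^term>\<open>phi 2 a 0\<close> from
  \<^term>\<open>phi 3 a 0\<close>.
\<close>

lemma units_below_split: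
  fixes f :: "nat \<Rightarrow> 'a :: comm_monoid_add"
  assumes "a > 0"
  shows "(\<Sum>k\<in>block a 0. f k) + (\<Sum>k\<in>block a 1. f k) =
    (\<Sum>k\<in>block a 0. f (2 * k)) + (\<Sum>k\<in>block a 0. f (p ^ a - 2 * k))"
proof -
  let ?U = "{k. \<not> p dvd k \<and> k < p ^ a}"
  have fin: "finite ?U" by simp
  have P: "odd (p ^ a)" "p dvd p ^ a" using p_odd assms by auto
  have dvd2: "p dvd 2 * k \<longleftrightarrow> p dvd k" for k
    using prime_p by (simp add: prime_dvd_mult_iff)
  have dvd_sub: "p dvd p ^ a - k \<longleftrightarrow> p dvd k" if "k < p ^ a" for k
    using that P(2) by (metis dvd_diffD1 dvd_diff_nat less_imp_le)
  have "(\<Sum>k\<in>block a 0. f k) + (\<Sum>k\<in>block a 1. f k) = sum f (block a 0 \<union> block a 1)"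
    by (rule sum.union_disjoint[OF finite_block finite_block, symmetric]) (auto simp: block_def)
  also have "block a 0 \<union> block a 1 = ?U"
    by (auto simp: block_def div_eq_iff_bounds)
  also have "?U = {k\<in>?U. even k} \<union> {k\<in>?U. odd k}" by auto
  also have "sum f \<dots> = sum f {k\<in>?U. even k} + sum f {k\<in>?U. odd k}"
    by (rule sum.union_disjoint) auto
  also have "sum f {k\<in>?U. even k} = (\<Sum>k\<in>block a 0. f (2 * k))"
    by (rule sum.reindex_bij_witness[of _ "\<lambda>k. 2 * k" "\<lambda>k. k div 2"])
      (auto simp: block_half_iff dvd2 elim!: evenE)
  also have "sum f {k\<in>?U. odd k} = (\<Sum>k\<in>block a 0. f (p ^ a - 2 * k))"
  proof (rule sum.reindex_bij_witness[of _ "\<lambda>k. p ^ a - 2 * k" "\<lambda>k. (p ^ a - k) div 2"])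
    fix k assume k: "k \<in> {k\<in>?U. odd k}"
    then have "even (p ^ a - k)" using P by simp
    then have e: "2 * ((p ^ a - k) div 2) = p ^ a - k" by simp
    with k show "p ^ a - 2 * ((p ^ a - k) div 2) = k" by simp
    then show "f (p ^ a - 2 * ((p ^ a - k) div 2)) = f k" by simp
    have "k > 0" using k by (auto intro: Nat.gr0I)
    then show "(p ^ a - k) div 2 \<in> block a 0"
      using e k dvd_sub[of k] dvd2[of "(p ^ a - k) div 2"] by (simp add: block_half_iff)
  next
    fix k assume k: "k \<in> block a 0"
    then show "(p ^ a - (p ^ a - 2 * k)) div 2 = k" by (simp add: block_half_iff)
    have "k > 0" using k by (auto simp: block_half_iff intro: Nat.gr0I)
    then show "p ^ a - 2 * k \<in> {k\<in>?U. odd k}"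
      using k P dvd_sub[of "2 * k"] dvd2 by (auto simp: block_half_iff)
  qed
  finally show ?thesis .
qed

lemma phi_2_0:
  assumes "a > 0"
  shows "cg (a + 1) (phi 2 a 0) (of_nat p ^ a * (7 / 3 * B))"
proof -
  define h2 where "h2 = phi 2 a 0"
  define h3 where "h3 = phi 3 a 0"
  define P :: rat where "P = of_nat p ^ a"
  have h3: "cg (a + 1) (P * h3) (P * (- 2 * B))"
    unfolding P_def h3_def using assms
    by (intro cg_scale I_p_power cg_trans[OF phi_3_0 h_half_B])
  have 1: "cg (a + 1) (h2 + phi 2 a 1) (h2 + (h2 + 2 * (P * h3)))"
    using phi_2_even_odd(2)[OF assms, of 0] by (intro cg_add) (simp_all add: h2_def h3_def P_def)
  have "h2 + phi 2 a 1 = (\<Sum>k\<in>block a 0. 1 / of_nat (2 * k) ^ 2) + (\<Sum>k\<in>block a 0. 1 / of_nat (p ^ a - 2 * k) ^ 2)"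
    unfolding h2_def phi_def by (rule units_below_split[OF assms])
  also have "cg (a + 1) \<dots> ((\<Sum>k\<in>block a 0. 1 / of_nat (2 * k) ^ 2) +
      (\<Sum>k\<in>block a 0. 1 / of_nat (2 * k) ^ 2 + 2 * P * (1 / of_nat (2 * k) ^ 3)))"
  proof (intro cg_add cg_sum cg_refl)
    fix k assume "k \<in> block a 0"
    then have "\<not> p dvd 2 * k" "2 * k < 1 * p ^ a"
      using prime_p by (auto simp: block_half_iff prime_dvd_mult_iff)
    from cg_mono[OF inverse_sub_block(2)[OF this(1) assms this(2)], of "a + 1"]
    show "cg (a + 1) (1 / of_nat (p ^ a - 2 * k) ^ 2) (1 / of_nat (2 * k) ^ 2 + 2 * P * (1 / of_nat (2 * k) ^ 3))"
      using assms by (simp add: P_def)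
  qed
  also have "\<dots> = h2 / 2 + P * h3 / 4"
    unfolding h2_def h3_def phi_def
    by (simp add: sum.distrib sum_divide_distrib sum_distrib_left)
      (simp add: sum.distrib[symmetric] power3_eq_cube power2_eq_square ac_simps)
  finally have "cg (a + 1) (h2 + phi 2 a 1) (h2 / 2 + P * h3 / 4)" .
  from cg_trans[OF cg_sym[OF 1] this]
  have 2: "h2 + (h2 + 2 * (P * h3)) - (h2 / 2 + P * h3 / 4) \<in> I (a + 1)"
    by (simp add: cg_def)
  have 3: "P * h3 - P * (- 2 * B) \<in> I (a + 1)"
    using h3 by (simp add: cg_def)
  \<comment> \<open>The comparison reads 3/2 h2 = -7/4 P h3, so h2 = -7/6 P h3, and h3 = -2 B yields
    7/3 P B.\<close>
  have "2 / 3 * (h2 + (h2 + 2 * (P * h3)) - (h2 / 2 + P * h3 / 4)) - 7 / 6 * (P * h3 - P * (- 2 * B)) \<in> I (a + 1)"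
    by (rule I_diff[OF Zp_mult_I[OF _ 2] Zp_mult_I[OF _ 3]]) simp_all
  moreover have "h2 - P * (7 / 3 * B) =
      2 / 3 * (h2 + (h2 + 2 * (P * h3)) - (h2 / 2 + P * h3 / 4)) - 7 / 6 * (P * h3 - P * (- 2 * B))"
    by (simp add: field_simps)
  ultimately show ?thesis
    unfolding cg_def h2_def[symmetric] P_def[symmetric] by (simp only:)
qed

text \<open>One formula for both parities: divided by B it is 7/3 + 4 y at z = 2 y and 7/3 - 4 (y +
  1) at z = 2 y + 1. It is independent of a, which makes merging possible.\<close>

definition phi_coeff :: "nat \<Rightarrow> rat" where
  "phi_coeff z = B * (4 / 3 + (- 1) ^ z * (2 * of_nat z + 1))"

lemma phi_coeff_Zp: "phi_coeff z \<in> Zp"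
  unfolding phi_coeff_def using B_Zp Zp_of_int[of "- 1"] by (intro Zp_mult Zp_add Zp_power) auto

lemma phi_2:
  assumes "a > 0"
  shows "cg (a + 1) (phi 2 a z) (of_nat p ^ a * phi_coeff z)"
proof -
  define P :: rat where "P = of_nat p ^ a"
  have h3: "cg (a + 1) (P * phi 3 a 0) (P * (- 2 * B))"
    unfolding P_def using assms by (intro cg_scale I_p_power cg_trans[OF phi_3_0 h_half_B])
  show ?thesis
  proof (cases "even z")
    case True
    then obtain y where z: "z = 2 * y" by (elim evenE)
    have "cg (a + 1) (phi 2 a z) (P * (7 / 3 * B) - 2 * of_nat y * (P * (- 2 * B)))"
      unfolding z
      using cg_trans[OF phi_2_even_odd(1)[OF assms] cg_diff[OF phi_2_0[OF assms] cg_mult_left[OF _ h3[unfolded P_def], of "2 * of_nat y"]]]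
      by (simp add: P_def)
    also have "\<dots> = P * phi_coeff z"
      by (simp add: z phi_coeff_def field_simps)
    finally show ?thesis by (simp add: P_def)
  next
    case False
    then obtain y where z: "z = 2 * y + 1" by (elim oddE)
    have "cg (a + 1) (phi 2 a z) (P * (7 / 3 * B) + 2 * of_nat (y + 1) * (P * (- 2 * B)))"
      unfolding z
      using cg_trans[OF phi_2_even_odd(2)[OF assms] cg_add[OF phi_2_0[OF assms] cg_mult_left[OF _ h3[unfolded P_def], of "2 * of_nat (y + 1)"]]]
      by (simp add: P_def)
    also have "\<dots> = P * phi_coeff z"
      by (simp add: z phi_coeff_def field_simps)
    finally show ?thesis by (simp add: P_def)
  qed
qed

end

section \<open>Binomial coefficients\<close>

text \<open>The polynomial "x + k choose k". Positive x gives \<open>(n + k) choose k\<close>,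
  negative x gives \<open>(n - 1) choose k\<close> up to sign, so both are split by the same
  lemma.\<close>

definition shifted_prod :: "rat \<Rightarrow> nat \<Rightarrow> rat" where
  "shifted_prod x k = (\<Prod>i=1..k. 1 + x / of_nat i)"

lemma choose_add_eq_shifted_prod: "of_nat ((n + k) choose k) = shifted_prod (of_nat n) k"
proof (induction k)
  case (Suc k)
  have "(of_nat (Suc k * ((n + Suc k) choose Suc k)) :: rat) = of_nat ((n + k + 1) * ((n + k) choose k))"
    using Suc_times_binomial_eq[of "n + k" k] by (simp only: of_nat_eq_iff) (simp add: mult.commute)
  then have "of_nat ((n + Suc k) choose Suc k) =
      (1 + of_nat n / of_nat (Suc k)) * (of_nat ((n + k) choose k) :: rat)"
    unfolding of_nat_mult by (simp add: field_simps del: binomial_Suc_Suc)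
  then show ?case
    by (simp add: Suc.IH shifted_prod_def mult.commute del: binomial_Suc_Suc)
qed (simp add: shifted_prod_def)

lemma choose_pred_eq_shifted_prod:
  assumes "n > 0"
  shows "of_nat ((n - 1) choose k) = (- 1) ^ k * shifted_prod (- of_nat n) k"
proof (induction k)
  case (Suc k)
  have "(of_nat (Suc k * ((n - 1) choose Suc k)) :: rat) = (of_nat n - 1 - of_nat k) * of_nat ((n - 1) choose k)"
  proof (cases "k \<le> n - 1")
    case True
    have "Suc k * ((n - 1) choose Suc k) = (n - 1 - k) * ((n - 1) choose k)"
      using binomial_absorption[of k "n - 1"] binomial_absorb_comp[of "n - 1" k] by simp
    then show ?thesis using True assms by (simp only: of_nat_mult) (simp add: of_nat_diff)
  next
    case False
    then show ?thesis by (simp add: binomial_eq_0)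
  qed
  then have "of_nat ((n - 1) choose Suc k) =
      - (1 + (- of_nat n) / of_nat (Suc k)) * (of_nat ((n - 1) choose k) :: rat)"
    by (simp add: field_simps del: binomial_Suc_Suc)
  also have "\<dots> = (- 1) ^ Suc k * (shifted_prod (- of_nat n) k * (1 + (- of_nat n) / of_nat (Suc k)))"
    unfolding Suc.IH by (simp only: power_Suc mult_minus_left mult_minus_right mult_1_left ac_simps)
  finally show ?case
    by (simp add: shifted_prod_def mult.commute del: binomial_Suc_Suc)
qed (simp add: shifted_prod_def)

context prime_ge5
begin

definition units_upto :: "nat \<Rightarrow> nat set" where
  "units_upto k = {i\<in>{1..k}. \<not> p dvd i}"

lemma finite_units_upto [simp]: "finite (units_upto k)"
  by (simp add: units_upto_def)

lemma units_upto_0 [simp]: "units_upto 0 = {}"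
  by (simp add: units_upto_def)

lemma units_upto_Suc:
  "units_upto (Suc k) = (if p dvd Suc k then units_upto k else insert (Suc k) (units_upto k))"
  by (auto simp: units_upto_def le_Suc_eq)

lemma Suc_notin_units_upto [simp]: "Suc k \<notin> units_upto k"
  by (simp add: units_upto_def)

lemma units_upto_not_dvd: "i \<in> units_upto k \<Longrightarrow> \<not> p dvd i"
  by (simp add: units_upto_def)

lemma Suc_div_p: "Suc k div p = (if p dvd Suc k then Suc (k div p) else k div p)"
  by (simp add: div_Suc dvd_eq_mod_eq_0)

lemma Suc_mod_p: "Suc k mod p = (if p dvd Suc k then 0 else Suc (k mod p))"
  by (simp add: mod_Suc dvd_eq_mod_eq_0 split: if_splits)

lemma Suc_mod_p_lt: "\<not> p dvd Suc k \<Longrightarrow> Suc (k mod p) < p"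
  using Suc_mod_p[of k] by (metis mod_less_divisor p_pos)

text \<open>In the factors with index p i the prime cancels, and these factors form the same product
  for x with length \<open>k div p\<close>. Only the units measure how a binomial coefficient
  changes when its arguments are multiplied by p.\<close>

lemma shifted_prod_split:
  "shifted_prod (of_nat p * x) k =
    shifted_prod x (k div p) * (\<Prod>i\<in>units_upto k. 1 + of_nat p * x / of_nat i)"
proof (induction k)
  case (Suc k)
  have step: "shifted_prod y (Suc j) = shifted_prod y j * (1 + y / of_nat (Suc j))" for y j
    by (simp add: shifted_prod_def mult.commute)
  show ?case
  proof (cases "p dvd Suc k")
    case True
    then have "Suc k = p * Suc (k div p)"
      using Suc_div_p[of k] by (metis dvd_mult_div_cancel)
    then have "of_nat p * x / of_nat (Suc k) = x / of_nat (Suc (k div p))"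
      by (metis mult_divide_mult_cancel_left of_nat_mult p_neq_0(2))
    then show ?thesis
      using True Suc.IH unfolding Suc_div_p units_upto_Suc by (simp add: step del: of_nat_Suc)
  next
    case False
    then show ?thesis
      using Suc.IH unfolding step Suc_div_p units_upto_Suc by (simp del: of_nat_Suc add: mult.commute mult.left_commute)
  qed
qed (simp add: shifted_prod_def)

lemma sum_units_upto_inverse: "cg 1 (\<Sum>i\<in>units_upto k. 1 / of_nat i) (harm_sum (k mod p))"
proof (induction k)
  case (Suc k)
  show ?case
  proof (cases "p dvd Suc k")
    case True
    then have "k mod p = p - 1"
      using mod_Suc[of k p] by (auto simp: dvd_eq_mod_eq_0 split: if_splits)
    then have "cg 1 (harm_sum (k mod p)) 0"
      using harm_sum_p_minus_1 by (simp add: cg_0)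
    with Suc.IH have "cg 1 (\<Sum>i\<in>units_upto k. 1 / of_nat i) 0" by (rule cg_trans)
    then show ?thesis
      using True unfolding units_upto_Suc Suc_mod_p by simp
  next
    case False
    note lt = Suc_mod_p_lt[OF False]
    \<comment> \<open>Two reflections, one in a multiple of p and one in p itself, replace k + 1 by
      its residue.\<close>
    have "Suc (p * q + r) + (p - Suc r) = p * (q + 1)" if "Suc r < p" for q r
      using that by simp
    from this[OF lt, of "k div p"] have "Suc k + (p - Suc (k mod p)) = p * (k div p + 1)"
      by simp
    then have *: "p ^ 1 dvd Suc k + (p - Suc (k mod p))"
      by (metis dvd_triv_left power_one_right)
    have nd: "\<not> p dvd p - Suc (k mod p)"
      using lt by (intro not_dvd_between) auto
    have "cg 1 (1 / of_nat (Suc k)) (- 1 / of_nat (p - Suc (k mod p)))"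
      using False nd * by (rule cg_inverse_neg)
    also have "cg 1 \<dots> (- (- 1 / of_nat (Suc (k mod p))))"
      using cg_minus[OF cg_inverse_reflect[of "Suc (k mod p)" 1]] lt by simp
    finally have "cg 1 (1 / of_nat (Suc k)) (1 / of_nat (Suc (k mod p)))" by simp
    from cg_add[OF Suc.IH this] show ?thesis
      using False unfolding units_upto_Suc Suc_mod_p by (simp add: harm_sum_Suc add.commute)
  qed
qed simp

section \<open>Products of factors close to 1, and binomial coefficients to first order\<close>

lemma cg_one_plus_mult:
  assumes "x \<in> I f" "y \<in> I f" "k \<le> 2 * f" "cg k u (1 + x)" "cg k v (1 + y)"
  shows "cg k (u * v) (1 + (x + y))"
proof -
  have "x \<in> Zp" "y \<in> Zp" using assms(1,2) I_Zp by auto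
  then have "cg k (u * v) ((1 + x) * (1 + y))"
    using assms(4,5) cg_Zp[OF assms(5)] by (intro cg_mult) auto
  also have "cg k ((1 + x) * (1 + y)) (1 + (x + y))"
    using I_mono[OF I_mult[OF assms(1,2)], of k] assms(3) by (simp add: cg_def algebra_simps)
  finally show ?thesis .
qed

lemma cg_one_plus_power:
  assumes "x \<in> I f" "k \<le> 2 * f" "cg k u (1 + x)"
  shows "cg k (u ^ n) (1 + of_nat n * x)"
proof (induction n)
  case (Suc n)
  have "cg k (u * u ^ n) (1 + (x + of_nat n * x))"
    using assms Suc by (intro cg_one_plus_mult[where f = f] Zp_mult_I) auto
  then show ?case by (simp add: algebra_simps)
qed simp

lemma cg_one_plus_scaled_mult:
  assumes "x \<in> I f" "f > 0" "c \<in> Zp" "d \<in> Zp"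
    "cg (f + 1) y (1 + x * c)" "cg (f + 1) z (1 + x * d)"
  shows "cg (f + 1) (y * z) (1 + x * (c + d))"
  unfolding distrib_left[of x]
  by (rule cg_one_plus_mult[OF I_mult_Zp[OF assms(1,3)] I_mult_Zp[OF assms(1,4)] _ assms(5,6)])
    (use assms(2) in simp)

lemma cg_one_plus_scaled_power:
  assumes "x \<in> I f" "f > 0" "c \<in> Zp" "cg (f + 1) y (1 + x * c)"
  shows "cg (f + 1) (y ^ n) (1 + x * (of_nat n * c))"
  using cg_one_plus_power[OF I_mult_Zp[OF assms(1,3)] _ assms(4), of n] assms(2)
  by (simp add: mult.left_commute)

lemma cg_prod_one_plus:
  assumes "x \<in> I f" "finite A" "\<And>i. i \<in> A \<Longrightarrow> c i \<in> Zp"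
  shows "cg (2 * f) (\<Prod>i\<in>A. 1 + x * c i) (1 + x * (\<Sum>i\<in>A. c i))"
  using assms(2,3)
proof (induction A rule: finite_induct)
  case (insert j A)
  have S: "(\<Sum>i\<in>A. c i) \<in> Zp" "c j \<in> Zp"
    using insert.prems by auto
  have "cg (2 * f) ((1 + x * c j) * (\<Prod>i\<in>A. 1 + x * c i)) ((1 + x * c j) * (1 + x * (\<Sum>i\<in>A. c i)))"
    using insert S I_Zp[OF assms(1)] by (intro cg_mult_left insert.IH) auto
  also have "cg (2 * f) \<dots> (1 + x * (c j + (\<Sum>i\<in>A. c i)))"
  proof -
    have "x * x * (c j * (\<Sum>i\<in>A. c i)) \<in> I (2 * f)"
      unfolding mult_2 using S by (intro I_mult_Zp[OF I_mult[OF assms(1) assms(1)]]) auto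
    then show ?thesis by (simp add: cg_def algebra_simps)
  qed
  finally show ?case using insert.hyps by simp
qed simp

lemma units_prod_cg:
  assumes "x \<in> I f" "f > 0"
  shows "cg (f + 1) (\<Prod>i\<in>units_upto k. 1 + x / of_nat i) (1 + x * harm_sum (k mod p))"
proof -
  have "cg (f + 1) (\<Prod>i\<in>units_upto k. 1 + x * (1 / of_nat i)) (1 + x * (\<Sum>i\<in>units_upto k. 1 / of_nat i))"
    using assms(2) units_upto_not_dvd
    by (intro cg_mono[OF cg_prod_one_plus[OF assms(1)]]) (auto intro: Zp_divide_of_nat)
  moreover have "cg (f + 1) (1 + x * (\<Sum>i\<in>units_upto k. 1 / of_nat i)) (1 + x * harm_sum (k mod p))"
    using assms(1) by (intro cg_add cg_refl cg_scale sum_units_upto_inverse)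
  ultimately show ?thesis by (simp add: cg_trans)
qed

lemma harm_sum_mod_Zp: "harm_sum (k mod p) \<in> Zp"
  by (intro harm_sum_Zp) simp

lemma choose_add_cg:
  assumes "of_nat (p * M) \<in> I f" "f > 0"
  shows "cg (f + 1) (of_nat ((p * M + k) choose k))
    (of_nat ((M + k div p) choose (k div p)) * (1 + of_nat (p * M) * harm_sum (k mod p)))"
proof -
  have "of_nat ((p * M + k) choose k) =
    of_nat ((M + k div p) choose (k div p)) * (\<Prod>i\<in>units_upto k. 1 + of_nat (p * M) / of_nat i :: rat)"
    unfolding choose_add_eq_shifted_prod of_nat_mult by (rule shifted_prod_split)
  then show ?thesis
    using units_prod_cg[OF assms] by (simp only: cg_mult_left Zp_of_nat)
qed

lemma choose_pred_eq:
  assumes "M > 0"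
  shows "of_nat ((p * M - 1) choose k) = (- 1) ^ (k mod p) * of_nat ((M - 1) choose (k div p)) *
    (\<Prod>i\<in>units_upto k. 1 + (- of_nat (p * M)) / of_nat i :: rat)"
proof -
  \<comment> \<open>As p is odd, the sign splits into the one absorbed by
    \<open>(M - 1) choose (k div p)\<close> and one depending only on the residue of k.\<close>
  have "(- 1 :: rat) ^ k = (- 1) ^ (p * (k div p) + k mod p)" by simp
  also have "\<dots> = (- 1) ^ (k mod p) * (- 1) ^ (k div p)"
    unfolding power_add power_mult using p_odd by (simp add: mult.commute)
  finally have sign: "(- 1 :: rat) ^ k = (- 1) ^ (k mod p) * (- 1) ^ (k div p)" .
  have "p * M > 0" using assms by simp
  from choose_pred_eq_shifted_prod[OF this, of k] choose_pred_eq_shifted_prod[OF assms, of "k div p"]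
    shifted_prod_split[of "- of_nat M" k]
  show ?thesis unfolding sign by simp
qed

lemma choose_pred_cg:
  assumes "M > 0"
  shows "cg 1 (of_nat ((p * M - 1) choose k)) ((- 1) ^ (k mod p) * of_nat ((M - 1) choose (k div p)))"
proof -
  have "- of_nat (p * M) \<in> I 1"
    using I_mult_Zp[OF I_p, of "of_nat M"] by (intro I_minus) simp
  from cg_mono[OF units_prod_cg[OF this], of 1 k]
  have "cg 1 (\<Prod>i\<in>units_upto k. 1 + (- of_nat (p * M)) / of_nat i) (1 + (- of_nat (p * M)) * harm_sum (k mod p))"
    by simp
  also have "cg 1 \<dots> (1 + 0)"
    using I_mult_Zp[OF \<open>- of_nat (p * M) \<in> I 1\<close> harm_sum_mod_Zp] by (intro cg_add cg_refl) (simp only: cg_0)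
  finally show ?thesis
    unfolding choose_pred_eq[OF assms]
    using cg_mult_left[of "(- 1) ^ (k mod p) * of_nat ((M - 1) choose (k div p))" 1 _ 1] Zp_of_int[of "- 1"]
    by simp
qed

text \<open>Squaring removes the sign of \<open>choose_pred_eq\<close>, so for r = 2 the leading
  terms do not alternate and the first-order term is needed. For r = 3 the sign survives but leading
  order suffices.\<close>

lemma choose_pred_square_cg:
  assumes "of_nat (p * M) \<in> I f" "f > 0" "M > 0"
  shows "cg (f + 1) (of_nat ((p * M - 1) choose k) ^ 2)
    (of_nat ((M - 1) choose (k div p)) ^ 2 * (1 + of_nat (p * M) * (- 2 * harm_sum (k mod p))))"
proof -
  have "cg (f + 1) (\<Prod>i\<in>units_upto k. 1 + (- of_nat (p * M)) / of_nat i)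
      (1 + of_nat (p * M) * (- harm_sum (k mod p)))"
    using units_prod_cg[OF I_minus[OF assms(1)] assms(2), of k] by simp
  from cg_one_plus_scaled_power[OF assms(1,2) Zp_minus[OF harm_sum_mod_Zp] this, of 2]
  have *: "cg (f + 1) ((\<Prod>i\<in>units_upto k. 1 + (- of_nat (p * M)) / of_nat i) ^ 2)
      (1 + of_nat (p * M) * (- 2 * harm_sum (k mod p)))"
    by simp
  have "of_nat ((p * M - 1) choose k) ^ 2 =
    of_nat ((M - 1) choose (k div p)) ^ 2 * (\<Prod>i\<in>units_upto k. 1 + (- of_nat (p * M)) / of_nat i :: rat) ^ 2"
    unfolding choose_pred_eq[OF assms(3)] power_mult_distrib
    by (simp add: power_mult[symmetric] mult.commute)
  then show ?thesis using cg_mult_left[OF _ *] by simp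
qed

text \<open>Symmetry of binomial coefficients reduces this to \<open>choose_add_cg\<close>; for z <
  p M both binomial coefficients have the default value 0.\<close>

lemma choose_lower_cg:
  assumes "of_nat (p * M) \<in> I f" "f > 0"
  shows "cg (f + 1) (of_nat (z choose (p * M)))
    (of_nat ((z div p) choose M) * (1 + of_nat (p * M) * harm_sum (z mod p)))"
proof (cases "z < p * M")
  case True
  then have "z div p < M" by (simp add: div_less_iff_less_mult mult.commute)
  with True show ?thesis by (simp add: binomial_eq_0)
next
  case False
  define k where "k = z - p * M"
  have z: "z = p * M + k" using False by (simp add: k_def)
  have "z choose (p * M) = (p * M + k) choose k" "(z div p) choose M = (M + k div p) choose (k div p)"
    "z mod p = k mod p"
    unfolding z using binomial_symmetric[of k "p * M + k"] binomial_symmetric[of "k div p" "M + k div p"]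
    by simp_all
  then show ?thesis using choose_add_cg[OF assms, of k] by simp
qed

text \<open>
  The value of \<open>W s t M\<close> at \<open>2 k\<close> is the summand for \<open>r = 2\<close> without the factor
  \<open>(M / (M - k))\<^sup>2\<close>. The odd arguments enter when a block of \<open>k\<close> is split into halves.
\<close>

definition W :: "nat \<Rightarrow> nat \<Rightarrow> nat \<Rightarrow> nat \<Rightarrow> rat" where
  "W s t M z = of_nat ((M - 1) choose (z div 2)) ^ 2 * of_nat ((M + z div 2) choose (z div 2)) ^ s
     * of_nat (z choose M) ^ t"

text \<open>The relative first-order change, divided by p M, of the summand without its prefactor:
  -2 from the squared binomial and s from the second factor share the harmonic number at k, the
  third factor contributes t times the one at z.\<close>

definition W_slope :: "nat \<Rightarrow> nat \<Rightarrow> nat \<Rightarrow> nat \<Rightarrow> rat" where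
  "W_slope s t k z = (of_nat s - 2) * harm_sum (k mod p) + of_nat t * harm_sum (z mod p)"

lemma W_Zp: "W s t M z \<in> Zp"
  unfolding W_def by (intro Zp_mult Zp_power Zp_of_nat)

lemma W_slope_Zp: "W_slope s t k z \<in> Zp"
  unfolding W_slope_def by (intro Zp_add Zp_mult harm_sum_mod_Zp Zp_diff) auto

lemma W_cg:
  assumes "of_nat (p * M) \<in> I f" "f > 0" "M > 0" "k div p = z div p div 2"
  shows "cg (f + 1) (of_nat ((p * M - 1) choose k) ^ 2 * of_nat ((p * M + k) choose k) ^ s * of_nat (z choose (p * M)) ^ t)
    (W s t M (z div p) * (1 + of_nat (p * M) * W_slope s t k z))"
proof -
  define x :: rat where "x = of_nat (p * M)"
  note x = assms(1)[folded x_def]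
  note H = harm_sum_mod_Zp
  have scale: "cg (f + 1) u (v * (1 + x * c)) \<Longrightarrow> cg (f + 1) (u ^ n) (v ^ n * (1 + x * (of_nat n * c)))"
    if "v \<in> Zp" "c \<in> Zp" for u v c n
  proof -
    assume "cg (f + 1) u (v * (1 + x * c))"
    then have "cg (f + 1) (u ^ n) ((v * (1 + x * c)) ^ n)"
      using that x by (intro cg_power) (auto intro!: Zp_mult Zp_add dest: I_Zp)
    also have "(v * (1 + x * c)) ^ n = v ^ n * (1 + x * c) ^ n" by (rule power_mult_distrib)
    also have "cg (f + 1) \<dots> (v ^ n * (1 + x * (of_nat n * c)))"
      using that by (intro cg_mult_left cg_one_plus_scaled_power[OF x assms(2)] Zp_power) auto
    finally show ?thesis .
  qed
  have combine: "cg (f + 1) u (v * (1 + x * c)) \<Longrightarrow> cg (f + 1) u' (v' * (1 + x * c')) \<Longrightarrow>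
      cg (f + 1) (u * u') (v * v' * (1 + x * (c + c')))"
    if "v \<in> Zp" "c \<in> Zp" "v' \<in> Zp" "c' \<in> Zp" for u v c u' v' c'
  proof -
    assume 1: "cg (f + 1) u (v * (1 + x * c))" and 2: "cg (f + 1) u' (v' * (1 + x * c'))"
    have xz: "x \<in> Zp" using x by (rule I_Zp)
    have "cg (f + 1) (u * u') (v * (1 + x * c) * (v' * (1 + x * c')))"
      using 1 2 that xz cg_Zp[OF 2] by (intro cg_mult) auto
    also have "\<dots> = v * v' * ((1 + x * c) * (1 + x * c'))" by (simp only: ac_simps)
    also have "cg (f + 1) \<dots> (v * v' * (1 + x * (c + c')))"
      using that by (intro cg_mult_left cg_one_plus_scaled_mult[OF x assms(2)]) auto
    finally show ?thesis .
  qed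
  have "cg (f + 1) (of_nat ((p * M - 1) choose k) ^ 2 * of_nat ((p * M + k) choose k) ^ s * of_nat (z choose (p * M)) ^ t)
    (of_nat ((M - 1) choose (k div p)) ^ 2 * of_nat ((M + k div p) choose (k div p)) ^ s * of_nat ((z div p) choose M) ^ t
      * (1 + x * (- 2 * harm_sum (k mod p) + of_nat s * harm_sum (k mod p) + of_nat t * harm_sum (z mod p))))"
    using choose_pred_square_cg[OF assms(1-3)] choose_add_cg[OF assms(1,2)] choose_lower_cg[OF assms(1,2)]
      Zp_of_int[of "- 2"]
    by (intro combine scale Zp_mult Zp_add Zp_power H) (simp_all add: x_def)
  moreover have "- 2 * harm_sum (k mod p) + of_nat s * harm_sum (k mod p) + of_nat t * harm_sum (z mod p) =
    W_slope s t k z"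
    by (simp add: W_slope_def algebra_simps)
  ultimately show ?thesis
    unfolding W_def assms(4) x_def by (simp only:)
qed

lemma div_p_div_2: "z div 2 div p = z div p div 2"
  by (simp add: div_mult2_eq[symmetric] mult.commute)

lemma W_step:
  assumes "of_nat (p * M) \<in> I f" "f > 0" "M > 0"
  shows "cg (f + 1) (W s t (p * M) z) (W s t M (z div p) * (1 + of_nat (p * M) * W_slope s t (z div 2) z))"
  unfolding W_def[of s t "p * M" z] by (rule W_cg[OF assms div_p_div_2])

lemma W_step_1:
  assumes "M > 0"
  shows "cg 1 (W s t (p * M) z) (W s t M (z div p))"
proof -
  have I: "of_nat (p * M) \<in> I 1"
    using I_mult_Zp[OF I_p, of "of_nat M"] by simp
  have "cg 1 (W s t (p * M) z) (W s t M (z div p) * (1 + of_nat (p * M) * W_slope s t (z div 2) z))"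
    using cg_mono[OF W_step[OF I _ assms], of 1] by simp
  also have "cg 1 \<dots> (W s t M (z div p) * (1 + 0))"
    using I_mult_Zp[OF I W_slope_Zp] by (intro cg_mult_left W_Zp cg_add cg_refl) (simp only: cg_0)
  finally show ?thesis by simp
qed

section \<open>Terms whose index is divisible by the prime\<close>

lemma sum_units_upto:
  fixes f :: "nat \<Rightarrow> 'a :: comm_monoid_add"
  assumes "a > 0"
  shows "(\<Sum>k\<in>units_upto (M * p ^ a). f k) = (\<Sum>z<2 * M. \<Sum>k\<in>block a z. f k)"
proof -
  have "k \<in> units_upto (M * p ^ a) \<longleftrightarrow> k \<in> (\<Union>z\<in>{..<2 * M}. block a z)" for k
  proof (cases "p dvd k")
    case False
    then have "k > 0" "k \<noteq> M * p ^ a" using assms by (auto intro: Nat.gr0I)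
    then have "k \<in> units_upto (M * p ^ a) \<longleftrightarrow> 2 * k < 2 * M * p ^ a"
      using False by (auto simp: units_upto_def)
    also have "\<dots> \<longleftrightarrow> 2 * k div p ^ a < 2 * M"
      by (rule div_less_iff_less_mult[symmetric]) simp
    finally show ?thesis using False by (simp add: block_def)
  qed (auto simp: units_upto_def block_def)
  then have "units_upto (M * p ^ a) = (\<Union>z\<in>{..<2 * M}. block a z)"
    by blast
  moreover have "(\<Sum>k\<in>(\<Union>z\<in>{..<2 * M}. block a z). f k) = (\<Sum>z<2 * M. \<Sum>k\<in>block a z. f k)"
    by (rule sum.UNION_disjoint) (simp_all, auto simp: block_def)
  ultimately show ?thesis by simp
qed

lemma sum_even_odd: "(\<Sum>z<2 * M. f z) = (\<Sum>y<M. f (2 * y) + f (2 * y + 1))"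
  for f :: "nat \<Rightarrow> 'a :: comm_monoid_add"
  by (induction M) (simp_all add: ac_simps)

lemma sum_inverse_square_units:
  assumes "a > 0"
  shows "cg (a + 1) (\<Sum>k\<in>units_upto (M * p ^ a). 1 / of_nat k ^ 2) (of_nat (M * p ^ a) * (2 / 3 * B))"
proof -
  have "(\<Sum>k\<in>units_upto (M * p ^ a). 1 / of_nat k ^ 2) = (\<Sum>z<2 * M. phi 2 a z)"
    unfolding phi_def by (rule sum_units_upto[OF assms])
  also have "cg (a + 1) \<dots> (\<Sum>z<2 * M. of_nat p ^ a * phi_coeff z)"
    by (intro cg_sum phi_2 assms)
  \<comment> \<open>Over a pair 2 y, 2 y + 1 the linear parts of \<open>phi_coeff\<close> cancel and
    14/3 - 4 = 2/3 is left.\<close>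
  also have "\<dots> = of_nat (M * p ^ a) * (2 / 3 * B)"
    unfolding sum_even_odd by (simp add: phi_coeff_def algebra_simps)
  finally show ?thesis .
qed

lemma sum_inverse_cube_units:
  assumes "a > 0"
  shows "(\<Sum>k\<in>units_upto (M * p ^ a). 1 / of_nat k ^ 3) \<in> I a"
proof -
  have "(\<Sum>k\<in>units_upto (M * p ^ a). 1 / of_nat k ^ 3) = (\<Sum>z<2 * M. phi 3 a z)"
    unfolding phi_def by (rule sum_units_upto[OF assms])
  also have "cg a \<dots> (\<Sum>z<2 * M. (- 1) ^ z * phi 3 a 0)"
    by (intro cg_sum phi_3_parity assms)
  also have "\<dots> = 0"
    unfolding sum_even_odd by (simp add: power_mult)
  finally show ?thesis by (simp add: cg_0)
qed

text \<open>\<open>2 + w\<close> is a unit. The induction gains one power of p at a time: if x is in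
  \<open>I k\<close>, then \<open>w * x\<close> already lies in \<open>I (Suc k)\<close>.\<close>

lemma I_cancel_near_2:
  assumes "x \<in> Zp" "w \<in> I 1" "(2 + w) * x \<in> I k"
  shows "x \<in> I k"
  using assms(3)
proof (induction k)
  case (Suc k)
  then have "x \<in> I k" using I_mono[of _ "Suc k" k] by simp
  then have "w * x \<in> I (Suc k)" using I_mult[OF assms(2)] by simp
  from I_diff[OF Suc.prems this] have "2 * x \<in> I (Suc k)" by (simp add: algebra_simps)
  then show ?case by (rule I_double)
qed (use assms in simp)

text \<open>A square root near 1: \<open>P^2 - (1 + y)^2\<close> factors, and since P is 1 modulo p
  the factor \<open>P + 1 + y\<close> is a unit close to 2.\<close>

lemma cg_cancel_square:
  assumes "cg k (P ^ 2) (1 + 2 * y)" "y \<in> I f" "k \<le> 2 * f" "f > 0" "cg 1 P 1"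
  shows "cg k P (1 + y)"
proof -
  have "P \<in> Zp" using cg_Zp[OF assms(5)] by simp
  have "y \<in> I 1" using I_mono[OF assms(2), of 1] assms(4) by simp
  have "y * y \<in> I k"
    using I_mono[OF I_mult[OF assms(2) assms(2)]] assms(3) by simp
  then have "P ^ 2 - (1 + 2 * y) - y * y \<in> I k"
    using I_diff[OF assms(1)[unfolded cg_def]] by simp
  then have prod: "(2 + ((P - 1) + y)) * (P - (1 + y)) \<in> I k"
    by (simp add: power2_eq_square algebra_simps)
  have near_2: "(P - 1) + y \<in> I 1"
    using assms(5) \<open>y \<in> I 1\<close> unfolding cg_def by (rule I_add)
  have "P - (1 + y) \<in> Zp"
    using \<open>P \<in> Zp\<close> I_Zp[OF assms(2)] by auto
  then show ?thesis unfolding cg_def using near_2 prod by (rule I_cancel_near_2)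
qed

lemma prod_units_reflect:
  "(\<Prod>i\<in>units_upto (p * b). f (p * b - i)) = (\<Prod>i\<in>units_upto (p * b). f i)"
proof (rule prod.reindex_bij_witness[of _ "\<lambda>i. p * b - i" "\<lambda>i. p * b - i"])
  fix i assume "i \<in> units_upto (p * b)"
  then have i: "\<not> p dvd i" "i \<le> p * b" by (auto simp: units_upto_def)
  then have "i \<noteq> p * b" "i \<noteq> 0" by (metis dvd_triv_left, metis dvd_0_right)
  moreover have "\<not> p dvd p * b - i" using i by (metis dvd_diffD1 dvd_triv_left)
  ultimately show "p * b - i \<in> units_upto (p * b)" "p * b - (p * b - i) = i"
    using i by (auto simp: units_upto_def)
  then show "p * b - (p * b - i) = i" "p * b - i \<in> units_upto (p * b)" by auto
qed auto

text \<open>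
  A refinement of Jacobsthal's congruence: pairing the factors of index \<open>i\<close> and \<open>p b - i\<close> turns the
  square of the quotient into a product of terms close to 1.
\<close>

lemma choose_p_multiple:
  assumes "p ^ e dvd b" "p ^ g dvd (b + d) * d" "e \<le> g"
  obtains P where "of_nat ((p * (b + d)) choose (p * b)) = of_nat ((b + d) choose b) * P"
    and "cg (4 + e + g) P (1 + - B / 3 * of_nat p ^ 3 * of_nat (b * ((b + d) * d)))"
proof -
  obtain b' where b': "b = b' * p ^ e" using assms(1) by (metis dvdE mult.commute)
  then have pb: "p * b = b' * p ^ (e + 1)" by simp
  define U where "U = units_upto (p * b)"
  have U: "finite U" by (simp add: U_def)
  define P where "P = (\<Prod>i\<in>U. 1 + of_nat (p * d) / of_nat i :: rat)"
  have "of_nat ((p * d + p * b) choose (p * b)) = of_nat ((d + b) choose b) * P"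
    using shifted_prod_split[of "of_nat d" "p * b"]
    by (simp only: choose_add_eq_shifted_prod of_nat_mult P_def U_def) simp
  then have eq: "of_nat ((p * (b + d)) choose (p * b)) = of_nat ((b + d) choose b) * P"
    by (simp add: algebra_simps)
  have unit: "\<not> p dvd i" "i < p * b" "0 < i" "\<not> p dvd p * b - i" if "i \<in> U" for i
  proof -
    show i: "\<not> p dvd i" "0 < i" using that by (auto simp: U_def units_upto_def)
    have "i \<le> p * b" using that by (simp add: U_def units_upto_def)
    moreover have "i \<noteq> p * b" using i(1) by (metis dvd_triv_left)
    ultimately show "i < p * b" by simp
    then show "\<not> p dvd p * b - i" using i(1) by (metis dvd_diffD1 dvd_triv_left less_imp_le)
  qed
  \<comment> \<open>The factors at i and p b - i multiply to \<open>1 + X / (i (p b - i))\<close>,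
    because the linear and quadratic terms have the common numerator
    \<open>p d (p b) + (p d)^2\<close>.\<close>
  define X :: rat where "X = of_nat p ^ 2 * of_nat ((b + d) * d)"
  define c :: "nat \<Rightarrow> rat" where "c i = 1 / of_nat i * (1 / of_nat (p * b - i))" for i
  have X: "X \<in> I (2 + g)"
    unfolding X_def by (intro I_mult I_p_power I_of_nat assms(2))
  have c: "c i \<in> Zp" if "i \<in> U" for i
    unfolding c_def using unit[OF that] by (intro Zp_mult Zp_divide_of_nat) auto
  have "P ^ 2 = (\<Prod>i\<in>U. 1 + of_nat (p * d) / of_nat i) * (\<Prod>i\<in>U. 1 + of_nat (p * d) / of_nat (p * b - i))"
    using prod_units_reflect[of "\<lambda>i. 1 + of_nat (p * d) / of_nat i :: rat" b]
    by (simp add: P_def U_def power2_eq_square)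
  also have "\<dots> = (\<Prod>i\<in>U. 1 + X * c i)"
    unfolding prod.distrib[symmetric]
  proof (intro prod.cong refl)
    fix i assume i: "i \<in> U"
    define u :: rat where "u = of_nat i"
    define v :: rat where "v = of_nat (p * b - i)"
    have "p * b = i + (p * b - i)" using unit(2)[OF i] by simp
    then have "of_nat p * of_nat b = u + v" unfolding u_def v_def by (metis of_nat_add of_nat_mult)
    moreover have "u \<noteq> 0" "v \<noteq> 0" using unit[OF i] unfolding u_def v_def of_nat_eq_0_iff by auto
    ultimately have "(1 + of_nat (p * d) / u) * (1 + of_nat (p * d) / v) =
        1 + (of_nat p * of_nat d * (of_nat p * of_nat b) + (of_nat p * of_nat d) ^ 2) * (1 / u * (1 / v))"
      by (simp add: field_simps power2_eq_square)
    also have "of_nat p * of_nat d * (of_nat p * of_nat b) + (of_nat p * of_nat d) ^ 2 = X"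
      by (simp add: X_def power2_eq_square algebra_simps)
    finally show "(1 + of_nat (p * d) / of_nat i) * (1 + of_nat (p * d) / of_nat (p * b - i)) = 1 + X * c i"
      by (simp only: u_def v_def c_def)
  qed
  finally have "cg (2 * (2 + g)) (P ^ 2) (1 + X * (\<Sum>i\<in>U. c i))"
    using cg_prod_one_plus[OF X U c] by simp
  then have P2: "cg (4 + e + g) (P ^ 2) (1 + X * (\<Sum>i\<in>U. c i))"
    by (rule cg_mono) (use assms(3) in simp)
  \<comment> \<open>Geometric expansion of \<open>1 / (p b - i)\<close> in powers of p b up to first
    order; the error has order 2 e + 2. The inverse cubes then drop out, since their sum has the
    factor \<open>p^(e+1)\<close> and is multiplied by p b.\<close>
  have "cg (2 + e) (\<Sum>i\<in>U. c i) (\<Sum>i\<in>U. - (1 / of_nat i ^ 2 + of_nat (p * b) * (1 / of_nat i ^ 3)))"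
  proof (intro cg_sum)
    fix i assume i: "i \<in> U"
    have pbq: "(of_nat (p * b) :: rat) = of_nat b' * of_nat p ^ (e + 1)"
      unfolding pb by simp
    have ib: "i < b' * p ^ (e + 1)" using unit(2)[OF i] pb by simp
    define u :: rat where "u = 1 / of_nat i"
    define v :: rat where "v = 1 / of_nat (p * b - i)"
    define x :: rat where "x = of_nat (p * b)"
    have nz: "(of_nat i :: rat) \<noteq> 0" "(of_nat (p * b - i) :: rat) \<noteq> 0"
      using unit[OF i] by (simp_all only: of_nat_eq_0_iff)
    have x: "x = of_nat i + of_nat (p * b - i)"
      unfolding x_def using unit(2)[OF i] by (metis le_add_diff_inverse less_imp_le of_nat_add)
    have uv: "u \<in> Zp" "v \<in> Zp" "x \<in> I (e + 1)"
      unfolding u_def v_def x_def pbq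
      by (rule Zp_divide_of_nat(1)[OF Zp_numeral(2) unit(1)[OF i]]
          Zp_divide_of_nat(1)[OF Zp_numeral(2) unit(4)[OF i]] p_power_mult_I[OF Zp_of_nat])+
    have "1 / c + 1 / d - (c + d) * (1 / c) * (1 / d) = 0" if "c \<noteq> 0" "d \<noteq> 0" for c d :: rat
      using that by (simp add: field_simps)
    from this[OF nz] have rel: "u + v - x * u * v = 0"
      unfolding u_def v_def x .
    have "u * v - - (u ^ 2 + x * u ^ 3) = (u + v - x * u * v) * (u + x * u ^ 2) + x * x * (u ^ 3 * v)"
      by (simp add: power2_eq_square power3_eq_cube algebra_simps)
    then have eq: "u * v - - (u ^ 2 + x * u ^ 3) = x * x * (u ^ 3 * v)"
      unfolding rel by simp
    have "x * x * (u ^ 3 * v) \<in> I (e + 1 + (e + 1))"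
      using uv by (intro I_mult_Zp[OF I_mult] Zp_mult Zp_power)
    then have "cg (2 + e) (u * v) (- (u ^ 2 + x * u ^ 3))"
      unfolding cg_def eq by (rule I_mono) simp
    then show "cg (2 + e) (c i) (- (1 / of_nat i ^ 2 + of_nat (p * b) * (1 / of_nat i ^ 3)))"
      by (simp only: c_def u_def v_def x_def power_one_over)
  qed
  also have "(\<Sum>i\<in>U. - (1 / of_nat i ^ 2 + of_nat (p * b) * (1 / of_nat i ^ 3)) :: rat) =
      - ((\<Sum>i\<in>U. 1 / of_nat i ^ 2) + of_nat (p * b) * (\<Sum>i\<in>U. 1 / of_nat i ^ 3))"
    by (simp only: sum_negf sum.distrib sum_distrib_left)
  also have "cg (2 + e) \<dots> (- (of_nat (p * b) * (2 / 3 * B) + 0))"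
  proof (intro cg_minus cg_add)
    show "cg (2 + e) (\<Sum>i\<in>U. 1 / of_nat i ^ 2) (of_nat (p * b) * (2 / 3 * B))"
      using sum_inverse_square_units[of "e + 1" b'] by (simp add: U_def pb del: of_nat_mult)
    have 1: "of_nat (p * b) \<in> I (e + 1)"
      by (rule I_of_nat) (simp add: pb)
    have 2: "(\<Sum>i\<in>U. 1 / of_nat i ^ 3) \<in> I (e + 1)"
      unfolding U_def pb by (rule sum_inverse_cube_units) simp
    show "cg (2 + e) (of_nat (p * b) * (\<Sum>i\<in>U. 1 / of_nat i ^ 3)) 0"
      unfolding cg_0 by (rule I_mono[OF I_mult[OF 1 2]]) simp
  qed
  finally have "cg (2 + g + (2 + e)) (X * (\<Sum>i\<in>U. c i)) (X * (- (of_nat (p * b) * (2 / 3 * B) + 0)))"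
    by (rule cg_scale[OF X])
  moreover define y where "y = - B / 3 * of_nat p ^ 3 * of_nat (b * ((b + d) * d))"
  have "X * (- (of_nat (p * b) * (2 / 3 * B) + 0)) = 2 * y"
    by (simp add: X_def y_def power2_eq_square power3_eq_cube algebra_simps)
  moreover have "2 + g + (2 + e) = 4 + e + g" by simp
  ultimately have "cg (4 + e + g) (1 + X * (\<Sum>i\<in>U. c i)) (1 + 2 * y)"
    by (intro cg_add cg_refl) (simp only:)
  with P2 have square: "cg (4 + e + g) (P ^ 2) (1 + 2 * y)" by (rule cg_trans)
  have y: "y \<in> I (3 + (e + g))"
  proof -
    have "y = (- B / 3) * (of_nat p ^ 3 * of_nat (b * ((b + d) * d)))"
      unfolding y_def by (rule mult.assoc)
    moreover have D: "of_nat (b * ((b + d) * d)) \<in> I (e + g)"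
      by (rule I_of_nat) (simp only: power_add mult_dvd_mono assms)
    have "- B / 3 \<in> Zp" using B_Zp by simp
    then have "(- B / 3) * (of_nat p ^ 3 * of_nat (b * ((b + d) * d))) \<in> I (3 + (e + g))"
      by (rule Zp_mult_I[OF _ I_mult[OF I_p_power D]])
    ultimately show ?thesis by (simp only:)
  qed
  have "cg 1 P 1"
  proof -
    have pd: "of_nat (p * d) \<in> I 1" by (rule I_of_nat) simp
    have "cg 1 (\<Prod>i\<in>U. 1 + of_nat (p * d) / of_nat i) (\<Prod>i\<in>U. 1 + 0)"
    proof (rule cg_prod)
      fix i assume "i \<in> U"
      then show "cg 1 (1 + of_nat (p * d) / of_nat i) (1 + 0)"
        by (intro cg_add cg_refl iffD2[OF cg_0] I_divide[OF pd] unit(1))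
    qed simp
    then show ?thesis by (simp only: P_def add_0_right prod.neutral_const)
  qed
  then have "cg (4 + e + g) P (1 + y)"
    by (intro cg_cancel_square[OF square y]) simp_all
  then show ?thesis using that[OF eq] by (simp only: y_def)
qed

section \<open>Comparison of the summands at p j and at j\<close>

definition T :: "nat \<Rightarrow> nat \<Rightarrow> nat \<Rightarrow> nat \<Rightarrow> nat \<Rightarrow> rat" where
  "T r s t n k = of_nat (n choose k) ^ r * of_nat ((n + k) choose k) ^ s * of_nat ((2 * k) choose n) ^ t"

lemma A_seq_eq_sum_T: "of_nat (A_seq r s t n) = (\<Sum>k=0..n. T r s t n k)"
  by (simp add: A_seq_def T_def)

text \<open>e is the exponent of p in j, capped at g. By absorption \<open>j * (M choose j)\<close>
  is a multiple of M, so whatever part of \<open>p^g\<close> is missing in j must divide the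
  binomial coefficient.\<close>

lemma choose_valuation:
  assumes "p ^ g dvd M" "M > 0"
  obtains e where "e \<le> g" "p ^ e dvd j" "p ^ (g - e) dvd (M choose j)" "p ^ g dvd j \<longleftrightarrow> e = g"
proof (cases "p ^ g dvd j")
  case True
  then show ?thesis using that[of g] by simp
next
  case False
  then have "j > 0" by (auto intro: Nat.gr0I)
  moreover have "\<not> is_unit p" using p_ge5 by simp
  ultimately obtain j' where j': "j = p ^ multiplicity p j * j'" "\<not> p dvd j'"
    using multiplicity_decompose' by (metis less_numeral_extra(3))
  define e where "e = multiplicity p j"
  have "\<not> g \<le> e" using False j'(1) by (metis dvd_trans dvd_triv_left e_def le_imp_power_dvd)
  then have e: "e < g" by simp
  have "j * (M choose j) = M * ((M - 1) choose (j - 1))"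
    using \<open>j > 0\<close> assms(2) times_binomial_minus1_eq by blast
  then have "p ^ g dvd p ^ e * (j' * (M choose j))"
    using assms(1) j'(1) e_def by (metis dvd_mult2 mult.assoc)
  moreover have "p ^ g = p ^ e * p ^ (g - e)" using e by (simp add: power_add[symmetric])
  ultimately have "p ^ (g - e) dvd j' * (M choose j)" by simp
  moreover have "coprime (p ^ (g - e)) j'"
    using prime_p j'(2) by (simp add: prime_imp_coprime)
  ultimately have "p ^ (g - e) dvd (M choose j)"
    using coprime_dvd_mult_right_iff by blast
  then show ?thesis using that[of e] e False j'(1) e_def by (metis dvd_triv_left less_imp_le nat_neq_iff)
qed

lemma T_valuation:
  assumes "p ^ c dvd (n choose k)"
  shows "T r s t n k \<in> I (c * r)"
  unfolding T_def using assms by (intro I_mult_Zp I_power I_of_nat Zp_power) auto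

text \<open>Each of the three factors is an instance of \<open>choose_p_multiple\<close>, exact only
  to order K = 4 + g + 2 e. The missing precision is returned by \<open>(M choose j)^r\<close>,
  divisible by \<open>p^(2 (g - e))\<close>: the total is 3 g + 4 for every e. This is where
  \<open>r \<ge> 2\<close> enters.\<close>

lemma T_multiple_p:
  assumes "p ^ g dvd M" "M > 0" "j \<le> M" "r \<ge> 2"
  shows "cg (3 * g + 4) (T r s t (p * M) (p * j) - T r s t M j)
    (T r s t M j * (- B / 3 * of_nat p ^ 3 * (of_nat M * of_nat j *
      (of_nat r * (of_nat M - of_nat j) + of_nat s * (of_nat M + of_nat j)
        + of_nat t * (4 * of_nat j - 2 * of_nat M)))))"
proof -
  obtain e where e: "e \<le> g" "p ^ e dvd j" "p ^ (g - e) dvd (M choose j)"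
    using choose_valuation[OF assms(1,2)] by blast
  define K where "K = 4 + e + (g + e)"
  define x where "x = - B / 3 * of_nat p ^ 3"
  have x: "x \<in> I 3"
    unfolding x_def using B_Zp by (intro Zp_mult_I[OF _ I_p_power]) simp
  have eM: "p ^ e dvd M" using e(1) assms(1) by (meson dvd_trans le_imp_power_dvd)
  have ge: "p ^ (g + e) dvd M * c" "p ^ (g + e) dvd c * M" if "p ^ e dvd c" for c
    unfolding power_add using mult_dvd_mono[OF assms(1) that] by (simp_all add: mult.commute)
  have y: "x * (of_nat M * (c * d)) \<in> I (3 + (g + e))" if "c \<in> I e" "d \<in> Zp" for c d
    using I_mult_Zp[OF that] by (intro I_mult x I_of_nat assms(1))
  have K: "K \<le> 2 * (3 + (g + e))" by (simp add: K_def)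
  define y1 where "y1 = x * (of_nat M * (of_nat j * (of_nat M - of_nat j)))"
  define y2 where "y2 = x * (of_nat M * (of_nat j * (of_nat M + of_nat j)))"
  define y3 where "y3 = x * (of_nat M * ((2 * of_nat j - of_nat M) * (2 * of_nat j)))"
  have "of_nat j \<in> I e" "2 * of_nat j - of_nat M \<in> I e"
    using I_of_nat[OF e(2)] I_diff[OF Zp_mult_I[OF _ I_of_nat[OF e(2)], of 2] I_of_nat[OF eM]]
    by simp_all
  then have ys: "y1 \<in> I (3 + (g + e))" "y2 \<in> I (3 + (g + e))" "y3 \<in> I (3 + (g + e))"
    unfolding y1_def y2_def y3_def by (intro y Zp_mult Zp_diff Zp_add; simp)+
  obtain P1 where P1: "of_nat ((p * M) choose (p * j)) = of_nat (M choose j) * P1" "cg K P1 (1 + y1)"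
  proof -
    have "p ^ (g + e) dvd (j + (M - j)) * (M - j)"
      using ge(1)[of "M - j"] e(2) eM assms(3) by (simp add: dvd_diff_nat)
    from choose_p_multiple[OF e(2) this] obtain P where P:
      "of_nat ((p * (j + (M - j))) choose (p * j)) = of_nat ((j + (M - j)) choose j) * P"
      "cg (4 + e + (g + e)) P (1 + - B / 3 * of_nat p ^ 3 * of_nat (j * ((j + (M - j)) * (M - j))))"
      by auto
    have eq: "- B / 3 * of_nat p ^ 3 * of_nat (j * ((j + (M - j)) * (M - j))) = y1"
      using assms(3) by (simp add: y1_def x_def of_nat_diff mult_ac)
    show ?thesis
      using P(1) P(2)[unfolded eq] assms(3) by (intro that[of P]) (simp_all add: K_def)
  qed
  obtain P2 where P2: "of_nat ((p * (M + j)) choose (p * j)) = of_nat ((M + j) choose j) * P2" "cg K P2 (1 + y2)"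
  proof -
    have "p ^ (g + e) dvd (j + M) * M"
      using ge(2)[of "j + M"] e(2) eM by (simp add: dvd_add)
    from choose_p_multiple[OF e(2) this] obtain P where P:
      "of_nat ((p * (j + M)) choose (p * j)) = of_nat ((j + M) choose j) * P"
      "cg (4 + e + (g + e)) P (1 + - B / 3 * of_nat p ^ 3 * of_nat (j * ((j + M) * M)))"
      by auto
    have eq: "- B / 3 * of_nat p ^ 3 * of_nat (j * ((j + M) * M)) = y2"
      by (simp add: y2_def x_def mult_ac add_ac)
    show ?thesis
      using P(1) P(2)[unfolded eq] by (intro that[of P]) (simp_all add: K_def add.commute[of M j])
  qed
  obtain P3 where P3: "of_nat ((p * (2 * j)) choose (p * M)) = of_nat ((2 * j) choose M) * P3" "cg K P3 (1 + y3)"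
  proof (cases "M \<le> 2 * j")
    case True
    \<comment> \<open>The lower index M is exchanged for 2 j - M, so that b = 2 j - M and d = M
      satisfy the divisibility hypotheses with exponents e and g + e.\<close>
    have "p ^ (g + e) dvd (2 * j - M + M) * M"
      using ge(2)[of "2 * j"] e(2) True by simp
    moreover have "p ^ e dvd 2 * j - M"
      using e(2) eM by (simp add: dvd_diff_nat)
    ultimately obtain P where
      P: "of_nat ((p * (2 * j - M + M)) choose (p * (2 * j - M))) = of_nat ((2 * j - M + M) choose (2 * j - M)) * P"
      "cg (4 + e + (g + e)) P (1 + - B / 3 * of_nat p ^ 3 * of_nat ((2 * j - M) * ((2 * j - M + M) * M)))"
      using choose_p_multiple[of e "2 * j - M" "g + e" M] by auto
    have "p * M \<le> p * (2 * j)" using True by simp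
    from binomial_symmetric[OF this] binomial_symmetric[OF True]
    have sym: "(p * (2 * j)) choose (p * M) = (p * (2 * j - M + M)) choose (p * (2 * j - M))"
      "(2 * j) choose M = (2 * j - M + M) choose (2 * j - M)"
      using True by (simp_all add: diff_mult_distrib2)
    have eq: "- B / 3 * of_nat p ^ 3 * of_nat ((2 * j - M) * ((2 * j - M + M) * M)) = y3"
      using True by (simp add: y3_def x_def of_nat_diff mult_ac)
    show ?thesis
      using P(1) P(2)[unfolded eq] by (intro that[of P]) (simp_all only: sym K_def)
  next
    case False
    then have 0: "(p * (2 * j)) choose (p * M) = 0" "(2 * j) choose M = 0"
      by (simp_all add: binomial_eq_0)
    \<comment> \<open>Both coefficients vanish, so the quotient is free and is chosen to fit the
      congruence exactly.\<close>
    show ?thesis by (rule that[of "1 + y3"]) (simp_all only: 0 of_nat_0 mult_zero_left cg_refl)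
  qed
  define P where "P = P1 ^ r * P2 ^ s * P3 ^ t"
  have "T r s t (p * M) (p * j) =
      of_nat ((p * M) choose (p * j)) ^ r * of_nat ((p * (M + j)) choose (p * j)) ^ s * of_nat ((p * (2 * j)) choose (p * M)) ^ t"
    by (simp add: T_def algebra_simps)
  also have "\<dots> = T r s t M j * P"
    unfolding P1 P2 P3 P_def T_def power_mult_distrib by (simp only: ac_simps)
  finally have TP: "T r s t (p * M) (p * j) - T r s t M j = T r s t M j * (P - 1)"
    by (simp add: algebra_simps)
  have "cg K P (1 + (of_nat r * y1 + of_nat s * y2 + of_nat t * y3))"
    unfolding P_def
    by (intro cg_one_plus_mult[where f = "3 + (g + e)"] cg_one_plus_power[where f = "3 + (g + e)"] I_add Zp_mult_I
        Zp_of_nat ys K P1(2) P2(2) P3(2))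
  then have "cg K (P - 1) (of_nat r * y1 + of_nat s * y2 + of_nat t * y3)"
    by (simp add: cg_def algebra_simps)
  moreover have "T r s t M j \<in> I (2 * (g - e))"
    by (rule I_mono[OF T_valuation[OF e(3)]]) (use assms(4) in simp)
  ultimately have "cg (2 * (g - e) + K) (T r s t M j * (P - 1))
      (T r s t M j * (of_nat r * y1 + of_nat s * y2 + of_nat t * y3))"
    by (intro cg_scale)
  moreover have "2 * (g - e) + K = 3 * g + 4" using e(1) by (simp add: K_def)
  moreover have "of_nat r * y1 + of_nat s * y2 + of_nat t * y3 =
    x * (of_nat M * of_nat j * (of_nat r * (of_nat M - of_nat j) + of_nat s * (of_nat M + of_nat j)
        + of_nat t * (4 * of_nat j - 2 * of_nat M)))"
    by (simp add: y1_def y2_def y3_def algebra_simps)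
  ultimately show ?thesis unfolding TP x_def by (simp only:)
qed

end

section \<open>Passing from half blocks to larger half blocks\<close>

lemma of_nat_mult_harm_sum_Suc: "of_nat (Suc k) * harm_sum (Suc k) = of_nat (Suc k) * harm_sum k + 1"
  by (simp add: harm_sum_Suc field_simps)

lemma sum_harm_sum: "(\<Sum>u<k. harm_sum u) = of_nat k * harm_sum k - of_nat k"
proof (induction k)
  case (Suc k)
  show ?case
    unfolding sum.lessThan_Suc Suc.IH of_nat_mult_harm_sum_Suc by (simp add: algebra_simps)
qed simp

lemma sum_harm_sum_alternating:
  "(\<Sum>u<k. harm_sum u * ((- 1) ^ u * (2 * of_nat u + 1))) =
    - ((- 1) ^ k * (of_nat k * harm_sum k)) - (1 - (- 1) ^ k) / 2"
proof (induction k)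
  case (Suc k)
  show ?case
    unfolding sum.lessThan_Suc Suc.IH of_nat_mult_harm_sum_Suc by (simp add: field_simps)
qed simp

text \<open>The weights are those of \<open>phi_coeff\<close> without B. With 2 l + 1 = p the
  harmonic term is a multiple of p and only the elementary term counts.\<close>

lemma sum_harm_sum_half:
  "(\<Sum>u<2 * l + 1. harm_sum (u div 2) * (4 / 3 + (- 1) ^ u * (2 * of_nat u + 1))) =
    7 / 3 * (of_nat (2 * l + 1) * harm_sum l) - 2 / 3 * of_nat l"
proof (induction l)
  case (Suc l)
  have eq: "2 * Suc l + 1 = Suc (Suc (2 * l + 1))" by simp
  have div: "(2 * l + 1) div 2 = l" "Suc (2 * l + 1) div 2 = Suc l" by simp_all
  define x :: rat where "x = of_nat l"
  define d :: rat where "d = 1 / (x + 1)"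
  have "x + 1 > 0" by (simp add: x_def add_pos_nonneg add.commute)
  then have d: "(x + 1) * d = 1" by (simp add: d_def)
  have h: "harm_sum (Suc l) = harm_sum l + d" by (simp add: harm_sum_Suc d_def x_def add.commute)
  \<comment> \<open>The defect of the induction step is a multiple of
    \<open>1 - (x + 1) * d\<close>, which vanishes because d is the new harmonic term.\<close>
  have "7 / 3 * ((2 * x + 1) * y) - 2 / 3 * x + y * (4 / 3 - (4 * x + 3)) + (y + d) * (4 / 3 + (4 * x + 5)) -
      (7 / 3 * ((2 * x + 3) * (y + d)) - 2 / 3 * (x + 1)) = 2 / 3 * (1 - (x + 1) * d)" for y
    by (simp add: field_simps)
  from this[of "harm_sum l"] show ?case
    unfolding eq sum.lessThan_Suc Suc.IH div h d
    by (simp add: x_def[symmetric]) (simp add: algebra_simps)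
qed simp

context prime_ge5
begin

lemma sum_blocks:
  fixes f :: "nat \<Rightarrow> 'a :: comm_monoid_add"
  shows "(\<Sum>z<2 * (p * M). f z) = (\<Sum>y<2 * M. \<Sum>z=y * p..<y * p + p. f z)"
  by (subst sum.nat_group) (simp add: mult_ac)

lemma block_div_p: "z \<in> {y * p..<y * p + p} \<Longrightarrow> z div p = y"
  by (simp add: div_eq_iff_bounds algebra_simps)

lemma sum_block_shift:
  fixes f :: "nat \<Rightarrow> 'a :: comm_monoid_add"
  shows "(\<Sum>z=y * p..<y * p + p. f z) = (\<Sum>u<p. f (y * p + u))"
  using sum.shift_bounds_nat_ivl[of f 0 "y * p" p]
  by (simp add: lessThan_atLeast0 add.commute)

lemma sum_block_shift_rev:
  fixes f :: "nat \<Rightarrow> 'a :: comm_monoid_add"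
  shows "(\<Sum>z=y * p..<y * p + p. f z) = (\<Sum>u<p. f (y * p + (p - 1 - u)))"
  unfolding sum_block_shift by (subst sum.nat_diff_reindex[symmetric]) simp

lemma half_mod_even: "u < p \<Longrightarrow> (2 * l * p + u) div 2 mod p = u div 2"
proof -
  assume "u < p"
  have "(2 * l * p + u) div 2 = l * p + u div 2" by simp
  then show ?thesis using \<open>u < p\<close> by simp
qed

text \<open>Odd blocks are read from their right end. Halving sends the offset u to
  \<open>u div 2\<close>, again counted from the right, which matches the symmetry of
  \<open>harm_sum_reflect\<close>.\<close>

lemma half_mod_odd: "u < p \<Longrightarrow> ((2 * l + 1) * p + (p - 1 - u)) div 2 mod p = p - 1 - u div 2"
proof -
  assume "u < p"
  then have "((2 * l + 1) * p + (p - 1 - u)) div 2 = (2 * (l * p) + (2 * p - 1 - u)) div 2"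
    by (simp add: algebra_simps)
  also have "\<dots> = l * p + (2 * p - 1 - u) div 2" by simp
  also have "(2 * p - 1 - u) div 2 = p - 1 - u div 2" using \<open>u < p\<close> by linarith
  finally show ?thesis using \<open>u < p\<close> by (simp only: mod_mult_self3) simp
qed

lemma phi_coeff_even: "cg 1 (phi_coeff (2 * l * p + u)) (phi_coeff u)"
proof -
  have sgn: "(- 1 :: rat) ^ (2 * l * p + u) = (- 1) ^ u" by (simp add: minus_one_power_iff)
  have "phi_coeff (2 * l * p + u) - phi_coeff u = of_nat p * (B * (- 1) ^ u * (4 * of_nat l))"
    unfolding phi_coeff_def sgn by (simp add: algebra_simps)
  moreover have "of_nat p * (B * (- 1) ^ u * (4 * of_nat l)) \<in> I 1"
    using B_Zp Zp_of_int[of "- 1"] by (intro I_mult_Zp[OF I_p] Zp_mult Zp_power) auto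
  ultimately show ?thesis by (simp add: cg_def)
qed

text \<open>Here z + u + 1 is an even multiple of p: z and u have opposite parity, while 2 z + 1 is
  congruent to -(2 u + 1), so the two sign changes cancel.\<close>

lemma phi_coeff_odd:
  assumes "u < p"
  shows "cg 1 (phi_coeff ((2 * l + 1) * p + (p - 1 - u))) (phi_coeff u)"
proof -
  define z where "z = (2 * l + 1) * p + (p - 1 - u)"
  have z: "z + u + 1 = (2 * l + 2) * p" using assms by (simp add: z_def algebra_simps)
  then have "even (z + u + 1)" by simp
  then have "odd (z + u)" by simp
  then have sgn: "(- 1 :: rat) ^ z = - ((- 1) ^ u)" by (auto simp: minus_one_power_iff)
  have Z: "of_nat z = (2 * of_nat l + 2) * of_nat p - (of_nat u + 1 :: rat)"
    using arg_cong[OF z, of "of_nat :: nat \<Rightarrow> rat"] by (simp add: algebra_simps)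
  have "phi_coeff z - phi_coeff u = of_nat p * (B * (- 1) ^ u * (- (4 * of_nat l + 4)))"
    unfolding phi_coeff_def sgn Z by (simp add: algebra_simps)
  moreover have "of_nat p * (B * (- 1) ^ u * (- (4 * of_nat l + 4))) \<in> I 1"
    using B_Zp Zp_of_int[of "- 1"] by (intro I_mult_Zp[OF I_p] Zp_mult Zp_power Zp_minus) auto
  ultimately show ?thesis by (simp add: cg_def z_def)
qed

text \<open>Reading even blocks from the left and odd ones from the right, both sums reduce modulo p
  to block 0, where closed forms are available. Hence the residues do not depend on y.\<close>

lemma sum_harm_sum_phi_coeff:
  "cg 1 (\<Sum>z=y * p..<y * p + p. harm_sum (z div 2 mod p) * phi_coeff z) (B / 3)"
  "cg 1 (\<Sum>z=y * p..<y * p + p. harm_sum (z mod p) * phi_coeff z) (4 * B / 3)"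
proof -
  have red: "cg 1 (\<Sum>z=y * p..<y * p + p. harm_sum (z div 2 mod p) * phi_coeff z)
      (\<Sum>u<p. harm_sum (u div 2) * phi_coeff u)"
    "cg 1 (\<Sum>z=y * p..<y * p + p. harm_sum (z mod p) * phi_coeff z)
      (\<Sum>u<p. harm_sum u * phi_coeff u)"
  proof -
    have half: "u div 2 < p" if "u < p" for u using that by simp
    show "cg 1 (\<Sum>z=y * p..<y * p + p. harm_sum (z div 2 mod p) * phi_coeff z)
      (\<Sum>u<p. harm_sum (u div 2) * phi_coeff u)"
    proof (cases "even y")
      case True
      then obtain l where y: "y = 2 * l" by (elim evenE)
      show ?thesis
        unfolding sum_block_shift y
        by (intro cg_sum) (auto simp: half_mod_even intro!: cg_mult_left phi_coeff_even[simplified] harm_sum_Zp half)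
    next
      case False
      then obtain l where y: "y = 2 * l + 1" by (elim oddE)
      show ?thesis
        unfolding sum_block_shift_rev y
      proof (intro cg_sum)
        fix u assume "u \<in> {..<p}"
        then have u: "u < p" by simp
        show "cg 1 (harm_sum (((2 * l + 1) * p + (p - 1 - u)) div 2 mod p) * phi_coeff ((2 * l + 1) * p + (p - 1 - u)))
          (harm_sum (u div 2) * phi_coeff u)"
          unfolding half_mod_odd[OF u]
          by (intro cg_mult harm_sum_reflect phi_coeff_odd harm_sum_Zp phi_coeff_Zp half u)
      qed
    qed
    show "cg 1 (\<Sum>z=y * p..<y * p + p. harm_sum (z mod p) * phi_coeff z)
      (\<Sum>u<p. harm_sum u * phi_coeff u)"
    proof (cases "even y")
      case True
      then obtain l where y: "y = 2 * l" by (elim evenE)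
      show ?thesis
        unfolding sum_block_shift y
        by (intro cg_sum) (auto intro!: cg_mult_left phi_coeff_even[simplified] harm_sum_Zp)
    next
      case False
      then obtain l where y: "y = 2 * l + 1" by (elim oddE)
      show ?thesis
        unfolding sum_block_shift_rev y
      proof (intro cg_sum)
        fix u assume "u \<in> {..<p}"
        then have u: "u < p" by simp
        have "((2 * l + 1) * p + (p - 1 - u)) mod p = p - 1 - u"
          by (simp only: mod_mult_self3) simp
        then show "cg 1 (harm_sum (((2 * l + 1) * p + (p - 1 - u)) mod p) * phi_coeff ((2 * l + 1) * p + (p - 1 - u)))
          (harm_sum u * phi_coeff u)"
          by (simp only:) (intro cg_mult harm_sum_reflect phi_coeff_odd harm_sum_Zp phi_coeff_Zp u)
      qed
    qed
  qed
  have L: "L < p" using p_eq by simp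
  have "(\<Sum>u<p. harm_sum (u div 2) * phi_coeff u) =
      B * (\<Sum>u<2 * L + 1. harm_sum (u div 2) * (4 / 3 + (- 1) ^ u * (2 * of_nat u + 1)))"
    unfolding phi_coeff_def sum_distrib_left using p_eq by (intro sum.cong) auto
  also have "\<dots> = of_nat p * (B * (7 / 3 * harm_sum L)) - B * (2 / 3) * of_nat L"
    unfolding sum_harm_sum_half using p_eq by (simp add: algebra_simps)
  also have "of_nat L = (of_nat p - 1 :: rat) / 2"
    by (subst p_eq) simp
  also have "of_nat p * (B * (7 / 3 * harm_sum L)) - B * (2 / 3) * ((of_nat p - 1) / 2) =
    of_nat p * (B * (7 / 3 * harm_sum L - 1 / 3)) + B / 3"
    by (simp add: field_simps)
  also have "cg 1 \<dots> (0 + B / 3)"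
    using B_Zp harm_sum_Zp[OF L]
    by (intro cg_add cg_refl iffD2[OF cg_0] I_mult_Zp[OF I_p] Zp_mult Zp_diff) auto
  finally have "cg 1 (\<Sum>u<p. harm_sum (u div 2) * phi_coeff u) (B / 3)" by simp
  with red(1) show "cg 1 (\<Sum>z=y * p..<y * p + p. harm_sum (z div 2 mod p) * phi_coeff z) (B / 3)"
    by (rule cg_trans)
  have "(\<Sum>u<p. harm_sum u * phi_coeff u) =
      B * (4 / 3 * (\<Sum>u<p. harm_sum u) + (\<Sum>u<p. harm_sum u * ((- 1) ^ u * (2 * of_nat u + 1))))"
    unfolding phi_coeff_def sum_distrib_left sum.distrib[symmetric]
    by (intro sum.cong) (auto simp: algebra_simps)
  also have "\<dots> = B * (7 / 3 * (of_nat p * harm_sum p) - 4 / 3 * of_nat p - 1)"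
    unfolding sum_harm_sum sum_harm_sum_alternating using p_odd by (simp add: field_simps)
  \<comment> \<open>\<open>harm_sum p\<close> contains 1 / p, so this product is 1 rather than 0
    modulo p.\<close>
  also have "of_nat p * harm_sum p = of_nat p * harm_sum (p - 1) + 1"
    using harm_sum_pred[of p] by (simp add: field_simps)
  also have "B * (7 / 3 * (of_nat p * harm_sum (p - 1) + 1) - 4 / 3 * of_nat p - 1) =
    of_nat p * (B * (7 / 3 * harm_sum (p - 1) - 4 / 3)) + 4 * B / 3"
    by (simp add: field_simps)
  also have "cg 1 \<dots> (0 + 4 * B / 3)"
    using B_Zp I_Zp[OF harm_sum_p_minus_1]
    by (intro cg_add cg_refl iffD2[OF cg_0] I_mult_Zp[OF I_p] Zp_mult Zp_diff) auto
  finally have "cg 1 (\<Sum>u<p. harm_sum u * phi_coeff u) (4 * B / 3)" by simp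
  with red(2) show "cg 1 (\<Sum>z=y * p..<y * p + p. harm_sum (z mod p) * phi_coeff z) (4 * B / 3)"
    by (rule cg_trans)
qed

text \<open>The correction per block caused by one merge, with B/3 and 4 B/3 taken from
  \<open>sum_harm_sum_phi_coeff\<close>. The factor s - 2 + 4 t reappears in
  \<open>T_first_order_nonmultiple_2\<close>, which allows the later cancellation.\<close>

definition slope_const :: "nat \<Rightarrow> nat \<Rightarrow> rat" where
  "slope_const s t = B * (of_nat s - 2 + 4 * of_nat t) / 3"

lemma slope_const_Zp: "slope_const s t \<in> Zp"
  unfolding slope_const_def using B_Zp by (intro Zp_divide_numeral Zp_mult Zp_add Zp_diff) auto

lemma sum_W_slope_phi_coeff:
  "cg 1 (\<Sum>z=y * p..<y * p + p. W_slope s t (z div 2) z * phi_coeff z) (slope_const s t)"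
proof -
  have "(\<Sum>z=y * p..<y * p + p. W_slope s t (z div 2) z * phi_coeff z) =
    (of_nat s - 2) * (\<Sum>z=y * p..<y * p + p. harm_sum (z div 2 mod p) * phi_coeff z) +
    of_nat t * (\<Sum>z=y * p..<y * p + p. harm_sum (z mod p) * phi_coeff z)"
    unfolding W_slope_def sum_distrib_left sum.distrib[symmetric]
    by (intro sum.cong) (auto simp: algebra_simps)
  also have "cg 1 \<dots> ((of_nat s - 2) * (B / 3) + of_nat t * (4 * B / 3))"
    by (intro cg_add cg_mult_left sum_harm_sum_phi_coeff Zp_diff) auto
  also have "\<dots> = slope_const s t" by (simp add: slope_const_def field_simps)
  finally show ?thesis .
qed

text \<open>One merge. \<open>W\<close> is expanded modulo \<open>p^(f+1)\<close> and
  \<open>phi 2 a\<close> supplies \<open>p^a\<close>. The constant part of \<open>W\<close> on a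
  block adds up to \<open>phi 2 (Suc a)\<close>, the linear part to
  \<open>slope_const\<close>.\<close>

lemma sum_W_phi_step:
  assumes "of_nat (p * M) \<in> I f" "f > 0" "M > 0" "a > 0"
  shows "cg (f + a + 1) (\<Sum>z<2 * (p * M). W s t (p * M) z * phi 2 a z)
    (\<Sum>y<2 * M. W s t M y * (phi 2 (Suc a) y + of_nat (p * M) * (of_nat p ^ a * slope_const s t)))"
proof -
  have phi_I: "phi 2 a z \<in> I a" for z
    by (rule cg_imp_I[OF cg_mono[OF phi_2[OF assms(4)]]])
      (simp_all add: I_mult_Zp I_p_power phi_coeff_Zp)
  have block: "cg (f + a + 1) (\<Sum>z=y * p..<y * p + p. W s t (p * M) z * phi 2 a z)
    (W s t M y * (phi 2 (Suc a) y + of_nat (p * M) * (of_nat p ^ a * slope_const s t)))" for y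
  proof -
    have "cg (a + (f + 1)) (\<Sum>z=y * p..<y * p + p. W s t (p * M) z * phi 2 a z)
      (\<Sum>z=y * p..<y * p + p. (W s t M y * (1 + of_nat (p * M) * W_slope s t (z div 2) z)) * phi 2 a z)"
    proof (intro cg_sum)
      fix z assume "z \<in> {y * p..<y * p + p}"
      then have "z div p = y" by (rule block_div_p)
      then have "cg (f + 1) (W s t (p * M) z) (W s t M y * (1 + of_nat (p * M) * W_slope s t (z div 2) z))"
        using W_step[OF assms(1-3), of s t z] by simp
      from cg_scale[OF phi_I this]
      show "cg (a + (f + 1)) (W s t (p * M) z * phi 2 a z)
        (W s t M y * (1 + of_nat (p * M) * W_slope s t (z div 2) z) * phi 2 a z)"
        by (simp add: mult.commute)
    qed
    also have "(\<Sum>z=y * p..<y * p + p. (W s t M y * (1 + of_nat (p * M) * W_slope s t (z div 2) z)) * phi 2 a z) =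
      W s t M y * (phi 2 (Suc a) y + of_nat (p * M) * (\<Sum>z=y * p..<y * p + p. W_slope s t (z div 2) z * phi 2 a z))"
      unfolding phi_Suc sum_distrib_left sum.distrib[symmetric]
      by (intro sum.cong refl) (simp add: algebra_simps)
    also have "cg (a + (f + 1)) \<dots>
      (W s t M y * (phi 2 (Suc a) y + of_nat (p * M) * (of_nat p ^ a * slope_const s t)))"
    proof (rule cg_mult_left[OF W_Zp cg_add[OF cg_refl]])
      have "cg (a + 1) (\<Sum>z=y * p..<y * p + p. W_slope s t (z div 2) z * phi 2 a z)
        (\<Sum>z=y * p..<y * p + p. W_slope s t (z div 2) z * (of_nat p ^ a * phi_coeff z))"
        by (intro cg_sum cg_mult_left W_slope_Zp phi_2 assms(4))
      also have "\<dots> = of_nat p ^ a * (\<Sum>z=y * p..<y * p + p. W_slope s t (z div 2) z * phi_coeff z)"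
        unfolding sum_distrib_left by (intro sum.cong refl) simp
      also have "cg (a + 1) \<dots> (of_nat p ^ a * slope_const s t)"
        by (intro cg_scale I_p_power sum_W_slope_phi_coeff)
      finally have "cg (f + (a + 1)) (of_nat (p * M) * (\<Sum>z=y * p..<y * p + p. W_slope s t (z div 2) z * phi 2 a z))
        (of_nat (p * M) * (of_nat p ^ a * slope_const s t))"
        by (rule cg_scale[OF assms(1)])
      then show "cg (a + (f + 1)) (of_nat (p * M) * (\<Sum>z=y * p..<y * p + p. W_slope s t (z div 2) z * phi 2 a z))
        (of_nat (p * M) * (of_nat p ^ a * slope_const s t))"
        by (simp add: ac_simps)
    qed
    finally show "cg (f + a + 1) (\<Sum>z=y * p..<y * p + p. W s t (p * M) z * phi 2 a z)
      (W s t M y * (phi 2 (Suc a) y + of_nat (p * M) * (of_nat p ^ a * slope_const s t)))"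
      by (simp only: add.assoc add.commute[of a] add.left_commute[of a])
  qed
  show ?thesis
    unfolding sum_blocks by (rule cg_sum) (rule block)
qed

text \<open>Modulo p the weight is constant on blocks of p arguments. For the same reason the
  alternating sum of the next lemma is reproduced instead of annihilated, as p signs leave
  one.\<close>

lemma sum_W_multiple_p:
  assumes "M > 0"
  shows "(\<Sum>z<2 * (p * M). W s t (p * M) z) \<in> I 1"
proof -
  have "cg 1 (\<Sum>z<2 * (p * M). W s t (p * M) z) (\<Sum>y<2 * M. \<Sum>z=y * p..<y * p + p. W s t M y)"
    unfolding sum_blocks
  proof (intro cg_sum)
    fix y z assume "z \<in> {y * p..<y * p + p}"
    then show "cg 1 (W s t (p * M) z) (W s t M y)"
      using W_step_1[OF assms, of s t z] by (simp only: block_div_p)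
  qed
  also have "\<dots> = of_nat p * (\<Sum>y<2 * M. W s t M y)"
    by (simp add: sum_distrib_left)
  finally show ?thesis
    by (rule cg_imp_I) (intro I_mult_Zp[OF I_p] Zp_sum W_Zp)
qed

lemma sum_alternating_W_step:
  assumes "M > 0"
  shows "cg 1 (\<Sum>z<2 * (p * M). (- 1) ^ z * W s t (p * M) z) (\<Sum>y<2 * M. (- 1) ^ y * W s t M y)"
proof -
  have "cg 1 (\<Sum>z<2 * (p * M). (- 1) ^ z * W s t (p * M) z)
      (\<Sum>y<2 * M. \<Sum>z=y * p..<y * p + p. (- 1) ^ z * W s t M y)"
    unfolding sum_blocks
  proof (intro cg_sum)
    fix y z assume "z \<in> {y * p..<y * p + p}"
    then have "cg 1 (W s t (p * M) z) (W s t M y)"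
      using W_step_1[OF assms, of s t z] by (simp only: block_div_p)
    then show "cg 1 ((- 1) ^ z * W s t (p * M) z) ((- 1) ^ z * W s t M y)"
      using Zp_of_int[of "- 1"] by (intro cg_mult_left Zp_power) simp_all
  qed
  then show ?thesis
    unfolding sum_distrib_right[symmetric] sum_alternating_block .
qed

lemma sum_alternating_W_power:
  assumes "n > 0"
  shows "cg 1 (\<Sum>z<2 * (n * p ^ f). (- 1) ^ z * W s t (n * p ^ f) z) (\<Sum>y<2 * n. (- 1) ^ y * W s t n y)"
proof (induction f)
  case (Suc f)
  have eq: "n * p ^ Suc f = p * (n * p ^ f)" by simp
  have "n * p ^ f > 0" using assms by simp
  from cg_trans[OF sum_alternating_W_step[OF this] Suc] show ?case unfolding eq .
qed simp

lemma W_multiple_power: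
  assumes "n > 0"
  shows "cg 1 (W s t (n * p ^ f) (z * p ^ f)) (W s t n z)"
proof (induction f)
  case (Suc f)
  have eq: "n * p ^ Suc f = p * (n * p ^ f)" "z * p ^ Suc f = p * (z * p ^ f)" by simp_all
  have "n * p ^ f > 0" using assms by simp
  from W_step_1[OF this, of s t "p * (z * p ^ f)"]
  have "cg 1 (W s t (n * p ^ Suc f) (z * p ^ Suc f)) (W s t (n * p ^ f) (z * p ^ f))"
    unfolding eq by (simp only: nonzero_mult_div_cancel_left[OF p_neq_0(1)])
  then show ?case using Suc by (rule cg_trans)
qed simp

section \<open>Terms whose index is prime to the prime\<close>

text \<open>Obtained from -B/2, 3 B/2 and -2 B for the three half-period sums. In odd blocks
  reflection replaces \<open>harm_sum u\<close> by \<open>harm_sum u - 1 / u\<close>, likewise at 2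
  u, and reverses the sign of the cubes.\<close>

definition unit_coeff :: "nat \<Rightarrow> nat \<Rightarrow> nat \<Rightarrow> rat" where
  "unit_coeff s t z =
    (if even z then B * (9 * of_nat t - 3 * of_nat s - 18) / 6
     else B * (9 * of_nat s + 15 * of_nat t + 6) / 6)"

lemma harm_sum_reflect_pred:
  assumes "0 < u" "u < p"
  shows "cg 1 (harm_sum (p - u)) (harm_sum u - 1 / of_nat u)"
  using harm_sum_reflect[of "u - 1"] harm_sum_pred[of u] assms by simp

lemma inverse_power_add_block:
  assumes "u \<in> block 1 0"
  shows "cg 1 (1 / of_nat (y * p ^ 1 + u) ^ e) (1 / of_nat u ^ e)"
proof -
  have "1 / of_nat u \<in> Zp" using assms by (simp add: block_half_iff)
  from cg_power[OF inverse_add_block(1)[OF assms] this, of y e] show ?thesis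
    by (simp only: power_one_over)
qed

lemma inverse_power_sub_block:
  assumes "u \<in> block 1 0"
  shows "cg 1 (1 / of_nat ((y + 1) * p ^ 1 - u) ^ e) ((- 1) ^ e * (1 / of_nat u ^ e))"
proof -
  have u: "- 1 / of_nat u \<in> Zp" "\<not> p dvd u" using assms by (simp_all add: block_half_iff)
  from cg_power[OF inverse_sub_block(1)[OF u(2) _ block_half_less[OF assms]] u(1), of y e] show ?thesis
    by (simp only: power_one_over power_divide) simp
qed

text \<open>The summand is the coefficient of N in the expansion of a unit term:
  \<open>2 / k^3\<close> comes from \<open>1 / (N - k)^2\<close>, the other part from the binomial
  factors.\<close>

lemma sum_slope_block:
  "cg 1 (\<Sum>k\<in>block 1 z. W_slope s t k (2 * k) * (1 / of_nat k ^ 2) + 2 * (1 / of_nat k ^ 3)) (unit_coeff s t z)"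
proof (cases "even z")
  case True
  then obtain y where z: "z = 2 * y" by (elim evenE)
  have "cg 1 (\<Sum>k\<in>block 1 z. W_slope s t k (2 * k) * (1 / of_nat k ^ 2) + 2 * (1 / of_nat k ^ 3))
    (\<Sum>u\<in>block 1 0. ((of_nat s - 2) * harm_sum u + of_nat t * harm_sum (2 * u)) * (1 / of_nat u ^ 2)
      + 2 * (1 / of_nat u ^ 3))"
    unfolding z sum_block_even[OF zero_less_one]
  proof (rule cg_sum)
    fix u assume u: "u \<in> block 1 0"
    then have lt: "2 * u < p" by (simp add: block_half_iff)
    have "2 * (y * p ^ 1 + u) = 2 * u + (2 * y) * p" by (simp add: algebra_simps)
    then have "2 * (y * p ^ 1 + u) mod p = 2 * u"
      using lt by (simp only: mod_mult_self1) simp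
    moreover have "(y * p ^ 1 + u) mod p = u" using lt by simp
    ultimately have "W_slope s t (y * p ^ 1 + u) (2 * (y * p ^ 1 + u)) =
        (of_nat s - 2) * harm_sum u + of_nat t * harm_sum (2 * u)"
      unfolding W_slope_def by (simp only:)
    then show "cg 1 (W_slope s t (y * p ^ 1 + u) (2 * (y * p ^ 1 + u)) * (1 / of_nat (y * p ^ 1 + u) ^ 2)
        + 2 * (1 / of_nat (y * p ^ 1 + u) ^ 3))
      (((of_nat s - 2) * harm_sum u + of_nat t * harm_sum (2 * u)) * (1 / of_nat u ^ 2) + 2 * (1 / of_nat u ^ 3))"
      using lt by (simp only:) (intro cg_add cg_mult_left inverse_power_add_block u Zp_add Zp_mult Zp_diff harm_sum_Zp; simp)
  qed
  also have "\<dots> = (of_nat s - 2) * a_half + of_nat t * b_half + 2 * h_half"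
    unfolding block_1_0 a_half_def b_half_def h_half_def sum_distrib_left sum.distrib[symmetric]
    by (intro sum.cong refl) (simp add: distrib_right add_divide_distrib)
  also have "cg 1 \<dots> ((of_nat s - 2) * (- B / 2) + of_nat t * (3 * B / 2) + 2 * (- 2 * B))"
    by (intro cg_add cg_mult_left a_half_B b_half_B h_half_B) simp_all
  also have "\<dots> = unit_coeff s t z"
    using True by (simp add: unit_coeff_def field_simps)
  finally show ?thesis .
next
  case False
  then obtain y where z: "z = 2 * y + 1" by (elim oddE)
  have "cg 1 (\<Sum>k\<in>block 1 z. W_slope s t k (2 * k) * (1 / of_nat k ^ 2) + 2 * (1 / of_nat k ^ 3))
    (\<Sum>u\<in>block 1 0. ((of_nat s - 2) * (harm_sum u - 1 / of_nat u)
      + of_nat t * (harm_sum (2 * u) - 1 / of_nat (2 * u))) * ((- 1) ^ 2 * (1 / of_nat u ^ 2))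
      + 2 * ((- 1) ^ 3 * (1 / of_nat u ^ 3)))"
    unfolding z sum_block_odd[OF zero_less_one]
  proof (rule cg_sum)
    fix u assume u: "u \<in> block 1 0"
    then have lt: "0 < u" "0 < 2 * u" "u < p" "2 * u < p" "\<not> p dvd u" "\<not> p dvd 2 * u"
      using not_dvd_between[of "2 * u"] by (auto simp: block_half_iff intro!: Nat.gr0I)
    define k where "k = (y + 1) * p ^ 1 - u"
    have k: "k = y * p + (p - u)" using lt by (simp add: k_def)
    have nd: "\<not> p dvd k"
      using lt not_dvd_between[of "p - u"] unfolding k
      by (metis diff_less dvd_add_right_iff dvd_triv_right p_pos zero_less_diff)
    have "2 * k = (2 * y + 1) * p + (p - 2 * u)" using lt unfolding k by (simp add: algebra_simps)
    then have "2 * k mod p = p - 2 * u"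
      using lt by (simp only: mod_mult_self3) simp
    moreover have "k mod p = p - u" using lt unfolding k by (simp only: mod_mult_self3) simp
    ultimately have "W_slope s t k (2 * k) = (of_nat s - 2) * harm_sum (p - u) + of_nat t * harm_sum (p - 2 * u)"
      unfolding W_slope_def by (simp only:)
    also have "cg 1 \<dots> ((of_nat s - 2) * (harm_sum u - 1 / of_nat u)
        + of_nat t * (harm_sum (2 * u) - 1 / of_nat (2 * u)))"
      using lt by (intro cg_add cg_mult_left harm_sum_reflect_pred) simp_all
    finally have slope: "cg 1 (W_slope s t k (2 * k)) ((of_nat s - 2) * (harm_sum u - 1 / of_nat u)
        + of_nat t * (harm_sum (2 * u) - 1 / of_nat (2 * u)))" .
    show "cg 1 (W_slope s t ((y + 1) * p ^ 1 - u) (2 * ((y + 1) * p ^ 1 - u)) * (1 / of_nat ((y + 1) * p ^ 1 - u) ^ 2)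
        + 2 * (1 / of_nat ((y + 1) * p ^ 1 - u) ^ 3))
      (((of_nat s - 2) * (harm_sum u - 1 / of_nat u) + of_nat t * (harm_sum (2 * u) - 1 / of_nat (2 * u)))
        * ((- 1) ^ 2 * (1 / of_nat u ^ 2)) + 2 * ((- 1) ^ 3 * (1 / of_nat u ^ 3)))"
      unfolding k_def[symmetric]
    proof (rule cg_add[OF cg_mult[OF slope] cg_mult_left])
      show "cg 1 (1 / of_nat k ^ 2) ((- 1) ^ 2 * (1 / of_nat u ^ 2))"
        "cg 1 (1 / of_nat k ^ 3) ((- 1) ^ 3 * (1 / of_nat u ^ 3))"
        unfolding k_def by (rule inverse_power_sub_block[OF u])+
      show "(of_nat s - 2) * (harm_sum u - 1 / of_nat u) + of_nat t * (harm_sum (2 * u) - 1 / of_nat (2 * u)) \<in> Zp"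
        by (rule cg_Zp'[OF slope W_slope_Zp])
      show "1 / of_nat k ^ 2 \<in> Zp" using nd by simp
    qed simp
  qed
  also have "\<dots> = (of_nat s - 2) * (a_half - h_half) + of_nat t * (b_half - h_half / 2) - 2 * h_half"
    unfolding block_1_0 a_half_def b_half_def h_half_def sum_distrib_left sum_divide_distrib
      sum.distrib[symmetric] sum_subtractf[symmetric]
    by (intro sum.cong refl) (simp add: power3_eq_cube power2_eq_square field_simps)
  also have "cg 1 \<dots> ((of_nat s - 2) * (- B / 2 - (- 2 * B)) + of_nat t * (3 * B / 2 - (- 2 * B) / 2) - 2 * (- 2 * B))"
    using cg_divide[OF h_half_B, of 2]
    by (intro cg_diff cg_add cg_mult_left a_half_B b_half_B h_half_B) simp_all
  also have "\<dots> = unit_coeff s t z"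
    using False by (simp add: unit_coeff_def field_simps)
  finally show ?thesis .
qed

lemma choose_eq_choose_pred:
  assumes "k < n"
  shows "of_nat (n choose k) = of_nat n * (1 / of_nat (n - k)) * (of_nat ((n - 1) choose k) :: rat)"
proof -
  have "(n - k) * (n choose k) = n * ((n - 1) choose k)"
    by (rule binomial_absorb_comp)
  then have "of_nat (n - k) * of_nat (n choose k) = (of_nat n * of_nat ((n - 1) choose k) :: rat)"
    by (metis of_nat_mult)
  then show ?thesis using assms by (simp add: field_simps)
qed

text \<open>The prefactor \<open>N^2\<close> has order 2 f, so its cofactor matters only modulo
  \<open>p^(f+1)\<close>, where products of two first-order terms, of order 2 f, may be
  dropped.\<close>

lemma sum_T_units_2:
  assumes N: "p * M = n * p ^ f" and "f > 0" "M > 0"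
  shows "cg (3 * f + 1) (\<Sum>k\<in>units_upto (p * M). T 2 s t (p * M) k)
    (of_nat (p * M) ^ 2 * (\<Sum>z<2 * M. W s t M z * (phi 2 1 z + of_nat (p * M) * unit_coeff s t z)))"
proof -
  define x :: rat where "x = of_nat (p * M)"
  have x: "x \<in> I f"
    unfolding x_def N by (rule I_of_nat) simp
  then have xZ: "x \<in> Zp" by (rule I_Zp)
  have prec: "3 * f + 1 = 2 * f + (f + 1)" by simp
  have x2: "x ^ 2 \<in> I (2 * f)" using I_power[OF x, of 2] by (simp add: mult.commute)
  have unit_term: "cg (f + 1)
      (1 / of_nat (p * M - k) ^ 2 *
        (of_nat ((p * M - 1) choose k) ^ 2 * of_nat ((p * M + k) choose k) ^ s * of_nat ((2 * k) choose (p * M)) ^ t))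
      (W s t M z * (1 / of_nat k ^ 2 + x * (W_slope s t k (2 * k) * (1 / of_nat k ^ 2) + 2 * (1 / of_nat k ^ 3))))"
    (is "cg _ (?i * ?w) _") if "k < p * M" "k \<in> block 1 z" for k z
  proof -
    have nd: "\<not> p dvd k" and z: "2 * k div p = z" using that(2) by (auto simp: block_def)
    define u :: rat where "u = 1 / of_nat k"
    have u: "u \<in> Zp" unfolding u_def using nd by simp
    define S where "S = W_slope s t k (2 * k)"
    have S: "S \<in> Zp" unfolding S_def by (rule W_slope_Zp)
    have "k < n * p ^ f" using that(1) N by simp
    from cg_mono[OF inverse_sub_block(2)[OF nd assms(2) this], of "f + 1"]
    have i: "cg (f + 1) ?i (u ^ 2 + 2 * x * u ^ 3)"
      using assms(2) unfolding N[symmetric] x_def u_def power_one_over by (simp add: N mult.assoc)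
    have "k div p = 2 * k div p div 2"
      using div_p_div_2[of "2 * k"] by simp
    from W_cg[OF x[unfolded x_def] assms(2,3) this]
    have w: "cg (f + 1) ?w (W s t M z * (1 + x * S))"
      unfolding z x_def S_def .
    have "cg (f + 1) (?i * ?w) ((u ^ 2 + 2 * x * u ^ 3) * (W s t M z * (1 + x * S)))"
      by (rule cg_mult[OF i w]) (intro Zp_add Zp_mult Zp_power Zp_of_nat Zp_numeral u xZ)+
    also have "cg (f + 1) \<dots> (W s t M z * (u ^ 2 + x * (S * u ^ 2 + 2 * u ^ 3)))"
    proof -
      have "(u ^ 2 + 2 * x * u ^ 3) * (W s t M z * (1 + x * S)) - W s t M z * (u ^ 2 + x * (S * u ^ 2 + 2 * u ^ 3)) =
        x * x * (W s t M z * (2 * u ^ 3 * S))"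
        by (simp add: algebra_simps)
      moreover have "x * x * (W s t M z * (2 * u ^ 3 * S)) \<in> I (f + f)"
        by (intro I_mult_Zp[OF I_mult[OF x x]] Zp_mult W_Zp Zp_power u S Zp_numeral)
      then have "x * x * (W s t M z * (2 * u ^ 3 * S)) \<in> I (f + 1)"
        by (rule I_mono) (use assms(2) in simp)
      ultimately show ?thesis
        unfolding cg_def by (simp only:)
    qed
    finally show ?thesis by (simp only: u_def S_def power_one_over)
  qed
  have "(\<Sum>k\<in>units_upto (p * M). T 2 s t (p * M) k) = (\<Sum>z<2 * M. \<Sum>k\<in>block 1 z. T 2 s t (p * M) k)"
    using sum_units_upto[of 1 "T 2 s t (p * M)" M] by (simp add: mult.commute)
  also have "cg (3 * f + 1) \<dots> (\<Sum>z<2 * M. \<Sum>k\<in>block 1 z. x ^ 2 * (W s t M z *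
      (1 / of_nat k ^ 2 + x * (W_slope s t k (2 * k) * (1 / of_nat k ^ 2) + 2 * (1 / of_nat k ^ 3)))))"
  proof (rule cg_sum, rule cg_sum)
    fix z k assume z: "z \<in> {..<2 * M}" and k: "k \<in> block 1 z"
    have "2 * k < (z + 1) * p" using k by (auto simp: block_def div_eq_iff_bounds)
    also have "\<dots> \<le> 2 * M * p" using z by (intro mult_right_mono) auto
    finally have lt: "k < p * M" by (simp add: mult.commute)
    have "T 2 s t (p * M) k = x ^ 2 * (1 / of_nat (p * M - k) ^ 2 *
        (of_nat ((p * M - 1) choose k) ^ 2 * of_nat ((p * M + k) choose k) ^ s * of_nat ((2 * k) choose (p * M)) ^ t))"
      unfolding T_def choose_eq_choose_pred[OF lt] power_mult_distrib power_one_over x_def by (simp only: mult.assoc)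
    also have "cg (2 * f + (f + 1)) \<dots> (x ^ 2 * (W s t M z *
      (1 / of_nat k ^ 2 + x * (W_slope s t k (2 * k) * (1 / of_nat k ^ 2) + 2 * (1 / of_nat k ^ 3)))))"
      by (rule cg_scale[OF x2 unit_term[OF lt k]])
    finally show "cg (3 * f + 1) (T 2 s t (p * M) k) (x ^ 2 * (W s t M z *
      (1 / of_nat k ^ 2 + x * (W_slope s t k (2 * k) * (1 / of_nat k ^ 2) + 2 * (1 / of_nat k ^ 3)))))"
      by simp
  qed
  also have "(\<Sum>z<2 * M. \<Sum>k\<in>block 1 z. x ^ 2 * (W s t M z *
      (1 / of_nat k ^ 2 + x * (W_slope s t k (2 * k) * (1 / of_nat k ^ 2) + 2 * (1 / of_nat k ^ 3))))) =
    x ^ 2 * (\<Sum>z<2 * M. W s t M z * (phi 2 1 z + x *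
      (\<Sum>k\<in>block 1 z. W_slope s t k (2 * k) * (1 / of_nat k ^ 2) + 2 * (1 / of_nat k ^ 3))))"
    by (simp only: phi_def sum_distrib_left sum.distrib distrib_left)
  also have "cg (3 * f + 1) \<dots> (x ^ 2 * (\<Sum>z<2 * M. W s t M z * (phi 2 1 z + x * unit_coeff s t z)))"
    unfolding prec
    by (intro cg_scale[OF x2] cg_sum cg_mult_left[OF W_Zp] cg_add[OF cg_refl] cg_scale[OF x] sum_slope_block)
  finally show ?thesis by (simp add: x_def)
qed

section \<open>Unit terms for r = 3 and for larger r\<close>

text \<open>The sum of \<open>1 / v^3\<close> over even v < p in two ways: directly it is
  \<open>h_half / 8\<close>; folded at p/2, an odd w stands for the even number p - w and enters
  with a minus sign.\<close>

lemma sum_alternating_inverse_cube: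
  "cg 1 (\<Sum>u=1..L. (- 1) ^ u * (1 / of_nat u ^ 3)) (- B / 4)"
proof -
  define f :: "nat \<Rightarrow> rat" where "f v = (if even v then 1 / of_nat v ^ 3 else 0)" for v
  have "(\<Sum>w=1..L. f w + f (p - w)) = (\<Sum>w=1..L. f (2 * w) + f (p - 2 * w))"
    unfolding sum_half_reflect_p[symmetric] by (rule sum_even_odd_reflect_p)
  also have "\<dots> = h_half / 8"
    unfolding h_half_def sum_divide_distrib using p_odd p_eq
    by (intro sum.cong refl) (auto simp: f_def power_mult_distrib)
  finally have eq: "(\<Sum>w=1..L. f w + f (p - w)) = h_half / 8" .
  have "cg 1 (\<Sum>w=1..L. f w + f (p - w)) (\<Sum>w=1..L. (- 1) ^ w * (1 / of_nat w ^ 3))"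
  proof (rule cg_sum)
    fix w assume "w \<in> {1..L}"
    then have w: "0 < w" "w < p" using p_eq by auto
    show "cg 1 (f w + f (p - w)) ((- 1) ^ w * (1 / of_nat w ^ 3))"
    proof (cases "even w")
      case True
      then show ?thesis using w p_odd by (simp add: f_def)
    next
      case False
      then have "f w + f (p - w) = 1 / of_nat (p - w) ^ 3"
        using w p_odd by (simp add: f_def)
      then show ?thesis using cg_inverse_reflect[OF w, of 3] False by simp
    qed
  qed
  then have "cg 1 (\<Sum>w=1..L. (- 1) ^ w * (1 / of_nat w ^ 3)) (h_half / 8)"
    unfolding eq by (rule cg_sym)
  also have "cg 1 (h_half / 8) (- 2 * B / 8)"
    using cg_divide[OF h_half_B, of 8] by simp
  finally show ?thesis by simp
qed

text \<open>Reflection changes the sign of the cube and, as p is odd, also the parity of the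
  residue; therefore all half blocks agree.\<close>

lemma sum_alternating_block_cube:
  "cg 1 (\<Sum>k\<in>block 1 z. (- 1) ^ (k mod p) * (1 / of_nat k ^ 3)) (- B / 4)"
proof -
  have sign: "(- 1 :: rat) ^ j \<in> Zp" for j using Zp_of_int[of "- 1"] by (intro Zp_power) simp
  have "cg 1 (\<Sum>k\<in>block 1 z. (- 1) ^ (k mod p) * (1 / of_nat k ^ 3))
    (\<Sum>u\<in>block 1 0. (- 1) ^ u * (1 / of_nat u ^ 3))"
  proof (cases "even z")
    case True
    then obtain y where z: "z = 2 * y" by (elim evenE)
    show ?thesis
      unfolding z sum_block_even[OF zero_less_one]
    proof (rule cg_sum)
      fix u assume u: "u \<in> block 1 0"
      then have "(y * p ^ 1 + u) mod p = u" by (simp add: block_half_iff)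
      then show "cg 1 ((- 1) ^ ((y * p ^ 1 + u) mod p) * (1 / of_nat (y * p ^ 1 + u) ^ 3)) ((- 1) ^ u * (1 / of_nat u ^ 3))"
        by (simp only:) (rule cg_mult_left[OF sign inverse_power_add_block[OF u]])
    qed
  next
    case False
    then obtain y where z: "z = 2 * y + 1" by (elim oddE)
    show ?thesis
      unfolding z sum_block_odd[OF zero_less_one]
    proof (rule cg_sum)
      fix u assume u: "u \<in> block 1 0"
      then have lt: "0 < u" "u < p" by (auto simp: block_half_iff intro!: Nat.gr0I)
      then have "(y + 1) * p ^ 1 - u = y * p + (p - u)" by simp
      then have "((y + 1) * p ^ 1 - u) mod p = p - u" using lt by (simp only: mod_mult_self3) simp
      moreover have "(- 1 :: rat) ^ (p - u) = - ((- 1) ^ u)"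
        using lt p_odd by (simp add: minus_one_power_iff)
      moreover have "cg 1 (- ((- 1) ^ u) * (1 / of_nat ((y + 1) * p ^ 1 - u) ^ 3))
          (- ((- 1) ^ u) * ((- 1) ^ 3 * (1 / of_nat u ^ 3)))"
        by (rule cg_mult_left[OF Zp_minus[OF sign] inverse_power_sub_block[OF u]])
      ultimately show "cg 1 ((- 1) ^ (((y + 1) * p ^ 1 - u) mod p) * (1 / of_nat ((y + 1) * p ^ 1 - u) ^ 3))
          ((- 1) ^ u * (1 / of_nat u ^ 3))"
        by simp
    qed
  qed
  also have "cg 1 \<dots> (- B / 4)"
    unfolding block_1_0 by (rule sum_alternating_inverse_cube)
  finally show ?thesis .
qed

text \<open>The counterpart of \<open>W\<close> for r = 3, with the sign of the cubed binomial kept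
  separate in the congruences.\<close>

definition V :: "nat \<Rightarrow> nat \<Rightarrow> nat \<Rightarrow> nat \<Rightarrow> rat" where
  "V s t M z = of_nat ((M - 1) choose (z div 2)) ^ 3 * of_nat ((M + z div 2) choose (z div 2)) ^ s
     * of_nat (z choose M) ^ t"

lemma V_Zp: "V s t M z \<in> Zp"
  unfolding V_def by (intro Zp_mult Zp_power Zp_of_nat)

lemma V_cg:
  assumes "M > 0" "k div p = z div p div 2"
  shows "cg 1 (of_nat ((p * M - 1) choose k) ^ 3 * of_nat ((p * M + k) choose k) ^ s * of_nat (z choose (p * M)) ^ t)
    ((- 1) ^ (k mod p) * V s t M (z div p))"
proof -
  have I: "of_nat (p * M) \<in> I 1" by (rule I_of_nat) simp
  have drop: "cg 1 u v" if "cg (1 + 1) u (v * (1 + of_nat (p * M) * c))" "v \<in> Zp" "c \<in> Zp" for u v c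
  proof -
    have "cg 1 u (v * (1 + of_nat (p * M) * c))" by (rule cg_mono[OF that(1)]) simp
    also have "cg 1 \<dots> (v * (1 + 0))"
      by (intro cg_mult_left[OF that(2)] cg_add[OF cg_refl] iffD2[OF cg_0] I_mult_Zp[OF I that(3)])
    finally show ?thesis by simp
  qed
  have sign: "(- 1 :: rat) ^ j \<in> Zp" for j using Zp_of_int[of "- 1"] by (intro Zp_power) simp
  have "cg 1 (of_nat ((p * M - 1) choose k) ^ 3 * of_nat ((p * M + k) choose k) ^ s * of_nat (z choose (p * M)) ^ t)
    (((- 1) ^ (k mod p) * of_nat ((M - 1) choose (k div p))) ^ 3 *
      of_nat ((M + k div p) choose (k div p)) ^ s * of_nat ((z div p) choose M) ^ t)"
    by (intro cg_mult cg_power choose_pred_cg assms drop[OF choose_add_cg[OF I]] drop[OF choose_lower_cg[OF I]]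
        harm_sum_mod_Zp Zp_mult Zp_power Zp_of_nat sign zero_less_one)
  also have "((- 1) ^ (k mod p) * of_nat ((M - 1) choose (k div p))) ^ 3 *
      of_nat ((M + k div p) choose (k div p)) ^ s * of_nat ((z div p) choose M) ^ t =
      (- 1) ^ (k mod p) * V s t M (z div p)"
  proof -
    have "((- 1) ^ (k mod p)) ^ 3 = (- 1 :: rat) ^ (k mod p)"
      by (simp add: minus_one_power_iff)
    then show ?thesis unfolding V_def assms(2)[symmetric] power_mult_distrib by (simp only: mult.assoc)
  qed
  finally show ?thesis .
qed

text \<open>The signs come from the cubed binomial. Because they add up to 1 on every block, the sum
  of \<open>V\<close> is preserved modulo p when M is multiplied by p, in contrast to the sum of
  \<open>W\<close>.\<close>

lemma sum_alternating_half:
  "(\<Sum>z=y * p..<y * p + p. (- 1) ^ (z div 2 mod p)) = (1 :: rat)"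
proof -
  have "(\<Sum>u<2 * l + 1. (- 1) ^ (u div 2)) = (1 :: rat)" for l
    by (induction l) simp_all
  then have *: "(\<Sum>u<p. (- 1) ^ (u div 2)) = (1 :: rat)" using p_eq by metis
  show ?thesis
  proof (cases "even y")
    case True
    then obtain l where y: "y = 2 * l" by (elim evenE)
    have "(\<Sum>z=y * p..<y * p + p. (- 1) ^ (z div 2 mod p)) = (\<Sum>u<p. (- 1) ^ (u div 2) :: rat)"
      unfolding sum_block_shift y by (intro sum.cong) (auto simp: half_mod_even)
    then show ?thesis using * by (rule trans)
  next
    case False
    then obtain l where y: "y = 2 * l + 1" by (elim oddE)
    have sign: "(- 1 :: rat) ^ (p - 1 - u div 2) = (- 1) ^ (u div 2)" if "u < p" for u
    proof -
      have "even (p - 1)" "u div 2 \<le> p - 1" using p_odd that by simp_all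
      then show ?thesis by (simp add: minus_one_power_iff)
    qed
    have "(\<Sum>z=y * p..<y * p + p. (- 1) ^ (z div 2 mod p)) = (\<Sum>u<p. (- 1) ^ (u div 2) :: rat)"
      unfolding sum_block_shift_rev y by (intro sum.cong refl) (simp only: half_mod_odd lessThan_iff sign)
    then show ?thesis using * by (rule trans)
  qed
qed

lemma sum_V_step:
  assumes "M > 0"
  shows "cg 1 (\<Sum>z<2 * (p * M). V s t (p * M) z) (\<Sum>y<2 * M. V s t M y)"
proof -
  have "cg 1 (\<Sum>z<2 * (p * M). V s t (p * M) z)
      (\<Sum>y<2 * M. \<Sum>z=y * p..<y * p + p. (- 1) ^ (z div 2 mod p) * V s t M y)"
    unfolding sum_blocks
  proof (intro cg_sum)
    fix y z assume "z \<in> {y * p..<y * p + p}"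
    then have "z div p = y" by (rule block_div_p)
    with V_cg[OF assms div_p_div_2, of z s t]
    show "cg 1 (V s t (p * M) z) ((- 1) ^ (z div 2 mod p) * V s t M y)"
      unfolding V_def[of s t "p * M"] by (simp only:)
  qed
  then show ?thesis
    unfolding sum_distrib_right[symmetric] sum_alternating_half by simp
qed

lemma sum_V_power:
  assumes "n > 0"
  shows "cg 1 (\<Sum>z<2 * (n * p ^ f). V s t (n * p ^ f) z) (\<Sum>y<2 * n. V s t n y)"
proof (induction f)
  case (Suc f)
  have eq: "n * p ^ Suc f = p * (n * p ^ f)" by simp
  have "n * p ^ f > 0" using assms by simp
  from cg_trans[OF sum_V_step[OF this] Suc] show ?case unfolding eq .
qed simp

text \<open>\<open>N^3\<close> already has order 3 f, so everything else is needed only modulo p and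
  no merging of inverse power sums occurs.\<close>

lemma sum_T_units_3:
  assumes N: "p * M = n * p ^ f" and "f > 0" "M > 0"
  shows "cg (3 * f + 1) (\<Sum>k\<in>units_upto (p * M). T 3 s t (p * M) k)
    (of_nat (p * M) ^ 3 * (B / 4 * (\<Sum>z<2 * M. V s t M z)))"
proof -
  define x :: rat where "x = of_nat (p * M)"
  have "x \<in> I f" unfolding x_def N by (rule I_of_nat) simp
  from I_power[OF this, of 3] have x3: "x ^ 3 \<in> I (3 * f)" by (simp add: mult.commute)
  have sign: "(- 1 :: rat) ^ j \<in> Zp" for j using Zp_of_int[of "- 1"] by (intro Zp_power) simp
  have "(\<Sum>k\<in>units_upto (p * M). T 3 s t (p * M) k) = (\<Sum>z<2 * M. \<Sum>k\<in>block 1 z. T 3 s t (p * M) k)"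
    using sum_units_upto[of 1 "T 3 s t (p * M)" M] by (simp add: mult.commute)
  also have "cg (3 * f + 1) \<dots> (\<Sum>z<2 * M. \<Sum>k\<in>block 1 z. x ^ 3 *
      (- (1 / of_nat k ^ 3) * ((- 1) ^ (k mod p) * V s t M z)))"
  proof (rule cg_sum, rule cg_sum)
    fix z k assume z: "z \<in> {..<2 * M}" and k: "k \<in> block 1 z"
    have nd: "\<not> p dvd k" and zk: "2 * k div p = z" using k by (auto simp: block_def)
    have "2 * k < (z + 1) * p" using k by (auto simp: block_def div_eq_iff_bounds)
    also have "\<dots> \<le> 2 * M * p" using z by (intro mult_right_mono) auto
    finally have lt: "k < p * M" by (simp add: mult.commute)
    have "k < M * p ^ 1" using lt by (simp add: mult.commute)
    from inverse_sub_block(1)[OF nd zero_less_one this]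
    have "cg 1 (1 / of_nat (p * M - k)) (- 1 / of_nat k)" by (simp only: power_one_right mult.commute)
    from cg_power[OF this, of 3] have inv: "cg 1 (1 / of_nat (p * M - k) ^ 3) (- (1 / of_nat k ^ 3))"
      using nd Zp_divide_of_nat(1)[of "- 1" k] by (simp only: power_one_over power_divide) simp
    have "k div p = 2 * k div p div 2"
      using div_p_div_2[of "2 * k"] by simp
    from V_cg[OF assms(3) this, of s t]
    have v: "cg 1 (of_nat ((p * M - 1) choose k) ^ 3 * of_nat ((p * M + k) choose k) ^ s * of_nat ((2 * k) choose (p * M)) ^ t)
        ((- 1) ^ (k mod p) * V s t M z)"
      unfolding zk .
    have "T 3 s t (p * M) k = x ^ 3 * (1 / of_nat (p * M - k) ^ 3 *
        (of_nat ((p * M - 1) choose k) ^ 3 * of_nat ((p * M + k) choose k) ^ s * of_nat ((2 * k) choose (p * M)) ^ t))"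
      unfolding T_def choose_eq_choose_pred[OF lt] power_mult_distrib power_one_over x_def by (simp only: mult.assoc)
    also have "cg (3 * f + 1) \<dots> (x ^ 3 * (- (1 / of_nat k ^ 3) * ((- 1) ^ (k mod p) * V s t M z)))"
    proof (rule cg_scale[OF x3 cg_mult[OF inv v]])
      show "- (1 / of_nat k ^ 3) \<in> Zp" using nd by simp
    qed (intro Zp_mult Zp_power Zp_of_nat)
    finally show "cg (3 * f + 1) (T 3 s t (p * M) k)
      (x ^ 3 * (- (1 / of_nat k ^ 3) * ((- 1) ^ (k mod p) * V s t M z)))" .
  qed
  also have "(\<Sum>z<2 * M. \<Sum>k\<in>block 1 z. x ^ 3 * (- (1 / of_nat k ^ 3) * ((- 1) ^ (k mod p) * V s t M z))) =
    x ^ 3 * (\<Sum>z<2 * M. - V s t M z * (\<Sum>k\<in>block 1 z. (- 1) ^ (k mod p) * (1 / of_nat k ^ 3)))"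
    unfolding sum_distrib_left by (intro sum.cong refl) simp
  also have "cg (3 * f + 1) \<dots> (x ^ 3 * (\<Sum>z<2 * M. - V s t M z * (- B / 4)))"
    by (intro cg_scale[OF x3] cg_sum cg_mult_left[OF Zp_minus[OF V_Zp]] sum_alternating_block_cube)
  also have "(\<Sum>z<2 * M. - V s t M z * (- B / 4)) = B / 4 * (\<Sum>z<2 * M. V s t M z)"
    unfolding sum_distrib_left by (intro sum.cong refl) simp
  finally show ?thesis by (simp only: x_def)
qed

text \<open>For a unit k the whole of \<open>p^f\<close> divides \<open>N choose k\<close>, and r f
  is at least 4 f, hence at least 3 f + 1.\<close>

lemma sum_T_units_4:
  assumes "p * M = n * p ^ f" "f > 0" "M > 0" "r \<ge> 4"
  shows "(\<Sum>k\<in>units_upto (p * M). T r s t (p * M) k) \<in> I (3 * f + 1)"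
proof (rule I_sum)
  fix k assume k: "k \<in> units_upto (p * M)"
  have "coprime (p ^ f) k"
    using prime_p units_upto_not_dvd[OF k] by (simp add: prime_imp_coprime)
  moreover have "k * ((p * M) choose k) = p * M * ((p * M - 1) choose (k - 1))"
    using k times_binomial_minus1_eq[of k "p * M"] by (simp add: units_upto_def)
  then have "p ^ f dvd k * ((p * M) choose k)"
    unfolding assms(1) by (metis dvd_mult2 dvd_triv_right)
  ultimately have "p ^ f dvd ((p * M) choose k)"
    using coprime_dvd_mult_right_iff by blast
  from T_valuation[OF this] show "T r s t (p * M) k \<in> I (3 * f + 1)"
  proof (rule I_mono)
    have "3 * f + 1 \<le> f * 4" using assms(2) by simp
    also have "\<dots> \<le> f * r" using assms(4) by simp
    finally show "3 * f + 1 \<le> f * r" .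
  qed
qed

section \<open>Assembling the congruence\<close>

lemma sum_split_multiples:
  fixes f :: "nat \<Rightarrow> 'a :: comm_monoid_add"
  shows "(\<Sum>k=0..p * M. f k) = (\<Sum>j=0..M. f (p * j)) + (\<Sum>k\<in>units_upto (p * M). f k)"
proof -
  have "{0..p * M} = (\<lambda>j. p * j) ` {0..M} \<union> units_upto (p * M)"
  proof (rule Set.set_eqI)
    fix k
    show "k \<in> {0..p * M} \<longleftrightarrow> k \<in> (\<lambda>j. p * j) ` {0..M} \<union> units_upto (p * M)"
    proof (cases "p dvd k")
      case True
      then obtain j where "k = p * j" by (elim dvdE)
      then show ?thesis by (auto simp: units_upto_def)
    next
      case False
      then have "k > 0" by (auto intro: Nat.gr0I)
      with False show ?thesis by (auto simp: units_upto_def)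
    qed
  qed
  moreover have "(\<lambda>j. p * j) ` {0..M} \<inter> units_upto (p * M) = {}"
    by (auto simp: units_upto_def)
  moreover have "inj_on (\<lambda>j. p * j) {0..M}" by (rule inj_onI) simp
  ultimately show ?thesis
    by (simp add: sum.union_disjoint sum.reindex)
qed

lemma T_multiple_p_power:
  assumes "n > 0" "k \<le> n" "r \<ge> 2"
  shows "cg 1 (T r s t (n * p ^ f) (k * p ^ f)) (T r s t n k)"
proof (induction f)
  case (Suc f)
  have eq: "n * p ^ Suc f = p * (n * p ^ f)" "k * p ^ Suc f = p * (k * p ^ f)" by simp_all
  define M where "M = n * p ^ f"
  define j where "j = k * p ^ f"
  have M: "p ^ 0 dvd M" "M > 0" "j \<le> M" using assms by (simp_all add: M_def j_def)
  have TZ: "T r s t M j \<in> Zp" unfolding T_def by (intro Zp_mult Zp_power Zp_of_nat)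
  from cg_mono[OF T_multiple_p[OF M assms(3), of s t], of 1]
  have "cg 1 (T r s t (p * M) (p * j) - T r s t M j)
    (T r s t M j * (- B / 3 * of_nat p ^ 3 * (of_nat M * of_nat j *
      (of_nat r * (of_nat M - of_nat j) + of_nat s * (of_nat M + of_nat j)
        + of_nat t * (4 * of_nat j - 2 * of_nat M)))))"
    by simp
  moreover have "of_nat p ^ 3 \<in> I 1" by (rule I_mono[OF I_p_power]) simp
  then have "T r s t M j * (- B / 3 * of_nat p ^ 3 * (of_nat M * of_nat j *
      (of_nat r * (of_nat M - of_nat j) + of_nat s * (of_nat M + of_nat j)
        + of_nat t * (4 * of_nat j - 2 * of_nat M)))) \<in> I 1"
    using B_Zp by (intro Zp_mult_I[OF TZ] I_mult_Zp[OF Zp_mult_I] Zp_mult Zp_add Zp_diff) simp_all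
  ultimately have "cg 1 (T r s t (p * M) (p * j)) (T r s t M j)"
    using cg_imp_I unfolding cg_def by blast
  then show ?case
    unfolding eq M_def j_def using Suc by (rule cg_trans)
qed simp

text \<open>The cubic form common to \<open>T_multiple_p\<close> and \<open>calA_generic\<close>.
  Its homogeneity extracts \<open>p^(3 g)\<close> from the indices divisible by
  \<open>p^g\<close>.\<close>

definition first_order :: "nat \<Rightarrow> nat \<Rightarrow> nat \<Rightarrow> nat \<Rightarrow> nat \<Rightarrow> rat" where
  "first_order r s t M j = of_nat M * of_nat j *
      (of_nat r * (of_nat M - of_nat j) + of_nat s * (of_nat M + of_nat j)
        + of_nat t * (4 * of_nat j - 2 * of_nat M))"

lemma first_order_Zp: "first_order r s t M j \<in> Zp"
  unfolding first_order_def by (intro Zp_mult Zp_add Zp_diff Zp_of_nat Zp_numeral)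

lemma first_order_scale:
  "first_order r s t (n * q) (k * q) = of_nat q ^ 3 * first_order r s t n k"
  by (simp add: first_order_def power3_eq_cube algebra_simps)

text \<open>If j has exactly e < g usable factors p, the binomial power has order at least 3 (g - e)
  and the cubic form g + 2 e, together 4 g - e > 3 g.\<close>

lemma T_first_order_nonmultiple:
  assumes "p ^ g dvd M" "M > 0" "\<not> p ^ g dvd j" "r \<ge> 3"
  shows "T r s t M j * first_order r s t M j \<in> I (3 * g + 1)"
proof -
  obtain e where e: "e \<le> g" "p ^ e dvd j" "p ^ (g - e) dvd (M choose j)" "e \<noteq> g"
    using choose_valuation[OF assms(1,2), of j] assms(3) by blast
  have M: "of_nat M \<in> I g" "of_nat M \<in> I e" and j: "of_nat j \<in> I e"
    using I_of_nat assms(1) e dvd_trans[OF le_imp_power_dvd assms(1)] by auto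
  have "of_nat r * (of_nat M - of_nat j) + of_nat s * (of_nat M + of_nat j)
      + of_nat t * (4 * of_nat j - 2 * of_nat M) \<in> I e"
    by (rule I_add[OF I_add[OF Zp_mult_I[OF _ I_diff[OF M(2) j]] Zp_mult_I[OF _ I_add[OF M(2) j]]]
          Zp_mult_I[OF _ I_diff[OF Zp_mult_I[OF _ j] Zp_mult_I[OF _ M(2)]]]]) simp_all
  from I_mult[OF I_mult[OF M(1) j] this]
  have "first_order r s t M j \<in> I (g + e + e)" unfolding first_order_def .
  from I_mult[OF T_valuation[OF e(3)] this]
  show ?thesis
  proof (rule I_mono)
    have "(g - e) * 3 \<le> (g - e) * r" using assms(4) by simp
    then show "3 * g + 1 \<le> (g - e) * r + (g + e + e)" using e(1,4) by linarith
  qed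
qed

text \<open>For r = 2 the count gives exactly 3 g, so a leading term remains. As M has more factors
  p than j is guaranteed to have, only the \<open>M j^2\<close> part of the cubic form matters, and
  absorption turns \<open>j^2 (M choose j)^2\<close> into
  \<open>M^2 ((M - 1) choose j)^2\<close>.\<close>

lemma T_first_order_nonmultiple_2:
  assumes "p ^ g dvd M" "M > 0" "\<not> p ^ g dvd j" "j < M"
  shows "cg (3 * g + 1) (T 2 s t M j * first_order 2 s t M j)
    (of_nat M ^ 3 * (of_nat s - 2 + 4 * of_nat t) * W s t M (2 * j))"
proof -
  obtain e where e: "e \<le> g" "p ^ e dvd j" "p ^ (g - e) dvd (M choose j)" "e \<noteq> g"
    using choose_valuation[OF assms(1,2), of j] assms(3) by blast
  have M: "of_nat M \<in> I g" "of_nat M \<in> I e" and j: "of_nat j \<in> I e"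
    using I_of_nat assms(1) e dvd_trans[OF le_imp_power_dvd assms(1)] by auto
  define x :: rat where "x = of_nat M"
  define y :: rat where "y = of_nat j"
  define c :: rat where "c = of_nat (M choose j)"
  define d :: rat where "d = of_nat ((M - 1) choose j)"
  define w :: rat where "w = of_nat ((M + j) choose j) ^ s * of_nat ((2 * j) choose M) ^ t"
  define a :: rat where "a = of_nat s - 2 + 4 * of_nat t"
  define b :: rat where "b = 2 + of_nat s - 2 * of_nat t"
  have "(M - j) * (M choose j) = M * ((M - 1) choose j)" by (rule binomial_absorb_comp)
  then have "of_nat (M - j) * of_nat (M choose j) = (of_nat M * of_nat ((M - 1) choose j) :: rat)"
    by (metis of_nat_mult)
  then have cd: "(x - y) * c = x * d"
    using assms(4) by (simp add: x_def y_def c_def d_def of_nat_diff)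
  have T: "T 2 s t M j = c ^ 2 * w" by (simp add: T_def c_def w_def)
  have W: "W s t M (2 * j) = d ^ 2 * w" by (simp add: W_def d_def w_def)
  have F: "first_order 2 s t M j = x * y * (y * a + x * b)"
    by (simp add: first_order_def x_def y_def a_def b_def algebra_simps)
  \<comment> \<open>Here a and b are the coefficients of j and of M in the last factor of the cubic
    form. Both terms on the right contain \<open>x^2\<close> and a further factor of order
    e.\<close>
  have "c ^ 2 * w * (x * y * (y * a + x * b)) - x ^ 3 * a * (d ^ 2 * w) =
      c ^ 2 * (x * (x * (y * (w * b)))) + (c ^ 2 * y ^ 2 - (x * d) ^ 2) * (x * (a * w))"
    by (simp add: power2_eq_square power3_eq_cube algebra_simps)
  also have "c ^ 2 * y ^ 2 - (x * d) ^ 2 = c ^ 2 * (x * (2 * y - x))"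
    unfolding cd[symmetric] by (simp add: power2_eq_square algebra_simps)
  finally have diff: "c ^ 2 * w * (x * y * (y * a + x * b)) - x ^ 3 * a * (d ^ 2 * w) =
      c ^ 2 * (x * (x * (y * (w * b)))) + c ^ 2 * (x * (2 * y - x)) * (x * (a * w))" .
  have Z: "w \<in> Zp" "a \<in> Zp" "b \<in> Zp"
    unfolding w_def a_def b_def by (intro Zp_mult Zp_power Zp_add Zp_diff Zp_of_nat Zp_numeral)+
  have c2: "c ^ 2 \<in> I ((g - e) * 2)"
    unfolding c_def by (rule I_power[OF I_of_nat[OF e(3)]])
  have x: "x \<in> I g" "x \<in> I e" and y: "y \<in> I e" using M j by (simp_all add: x_def y_def)
  have "2 * y - x \<in> I e" by (rule I_diff[OF Zp_mult_I[OF _ y] x(2)]) simp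
  have "c ^ 2 * (x * (x * (y * (w * b)))) \<in> I ((g - e) * 2 + (g + (g + e)))"
    by (intro I_mult[OF c2 I_mult[OF x(1) I_mult[OF x(1) I_mult_Zp[OF y]]]] Zp_mult Z)
  moreover have "c ^ 2 * (x * (2 * y - x)) * (x * (a * w)) \<in> I ((g - e) * 2 + (g + e) + g)"
    by (intro I_mult[OF I_mult[OF c2 I_mult[OF x(1) \<open>2 * y - x \<in> I e\<close>]] I_mult_Zp[OF x(1)]] Zp_mult Z)
  moreover have "(g - e) * 2 + (g + e) + g = (g - e) * 2 + (g + (g + e))" by simp
  ultimately have "c ^ 2 * w * (x * y * (y * a + x * b)) - x ^ 3 * a * (d ^ 2 * w) \<in> I ((g - e) * 2 + (g + (g + e)))"
    unfolding diff by (simp only: I_add)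
  then have "c ^ 2 * w * (x * y * (y * a + x * b)) - x ^ 3 * a * (d ^ 2 * w) \<in> I (3 * g + 1)"
    by (rule I_mono) (use e(1,4) in linarith)
  then show ?thesis
    unfolding cg_def T W F by (simp only: x_def a_def)
qed

lemma sum_split_prime_power:
  fixes f :: "nat \<Rightarrow> 'a :: comm_monoid_add"
  shows "(\<Sum>j=0..n * p ^ g. f j) = (\<Sum>k=0..n. f (k * p ^ g)) + (\<Sum>j | j < n * p ^ g \<and> \<not> p ^ g dvd j. f j)"
    and "(\<Sum>j<n * p ^ g. f j) = (\<Sum>k<n. f (k * p ^ g)) + (\<Sum>j | j < n * p ^ g \<and> \<not> p ^ g dvd j. f j)"
proof -
  let ?A = "{j. j < n * p ^ g \<and> \<not> p ^ g dvd j}"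
  have inj: "inj_on (\<lambda>k. k * p ^ g) S" for S by (rule inj_onI) simp
  have disj: "(\<lambda>k. k * p ^ g) ` S \<inter> ?A = {}" for S by auto
  have "{0..n * p ^ g} = (\<lambda>k. k * p ^ g) ` {0..n} \<union> ?A" "{..<n * p ^ g} = (\<lambda>k. k * p ^ g) ` {..<n} \<union> ?A"
  proof -
    have "j \<in> {0..n * p ^ g} \<longleftrightarrow> j \<in> (\<lambda>k. k * p ^ g) ` {0..n} \<union> ?A"
      "j \<in> {..<n * p ^ g} \<longleftrightarrow> j \<in> (\<lambda>k. k * p ^ g) ` {..<n} \<union> ?A" for j
    proof -
      show "j \<in> {0..n * p ^ g} \<longleftrightarrow> j \<in> (\<lambda>k. k * p ^ g) ` {0..n} \<union> ?A"
      proof (cases "p ^ g dvd j")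
        case True
        then obtain k where "j = k * p ^ g" by (metis dvdE mult.commute)
        then show ?thesis by auto
      next
        case False
        then have "j \<noteq> n * p ^ g" by auto
        with False show ?thesis by auto
      qed
      show "j \<in> {..<n * p ^ g} \<longleftrightarrow> j \<in> (\<lambda>k. k * p ^ g) ` {..<n} \<union> ?A"
      proof (cases "p ^ g dvd j")
        case True
        then obtain k where "j = k * p ^ g" by (metis dvdE mult.commute)
        then show ?thesis by auto
      qed auto
    qed
    then show "{0..n * p ^ g} = (\<lambda>k. k * p ^ g) ` {0..n} \<union> ?A" "{..<n * p ^ g} = (\<lambda>k. k * p ^ g) ` {..<n} \<union> ?A"
      by blast+
  qed
  then show "(\<Sum>j=0..n * p ^ g. f j) = (\<Sum>k=0..n. f (k * p ^ g)) + sum f ?A"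
    "(\<Sum>j<n * p ^ g. f j) = (\<Sum>k<n. f (k * p ^ g)) + sum f ?A"
    by (simp_all add: sum.union_disjoint disj sum.reindex inj)
qed

text \<open>What r = 2 leaves over from the multiples of p; the index set is empty for g = 0, since
  \<open>p^0\<close> divides everything.\<close>

definition W_nonmultiples :: "nat \<Rightarrow> nat \<Rightarrow> nat \<Rightarrow> nat \<Rightarrow> rat" where
  "W_nonmultiples s t n g = (\<Sum>j | j < n * p ^ g \<and> \<not> p ^ g dvd j. W s t (n * p ^ g) (2 * j))"

lemma sum_T_first_order:
  assumes "n > 0" "r \<ge> 2"
  shows "cg (3 * g + 1) (\<Sum>j=0..n * p ^ g. T r s t (n * p ^ g) j * first_order r s t (n * p ^ g) j)
    (of_nat p ^ (3 * g) * (\<Sum>k=0..n. T r s t n k * first_order r s t n k)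
      + (if r = 2 then of_nat (n * p ^ g) ^ 3 * (of_nat s - 2 + 4 * of_nat t) * W_nonmultiples s t n g else 0))"
  unfolding sum_split_prime_power
proof (rule cg_add)
  have "T r s t (n * p ^ g) (k * p ^ g) * first_order r s t (n * p ^ g) (k * p ^ g) =
      of_nat p ^ (3 * g) * (T r s t (n * p ^ g) (k * p ^ g) * first_order r s t n k)" for k
    unfolding first_order_scale by (simp add: power_mult[symmetric] mult.commute)
  moreover have "cg (3 * g + 1) (of_nat p ^ (3 * g) * (T r s t (n * p ^ g) (k * p ^ g) * first_order r s t n k))
      (of_nat p ^ (3 * g) * (T r s t n k * first_order r s t n k))" if "k \<in> {0..n}" for k
    using that by (intro cg_scale[OF I_p_power] cg_mult_right[OF first_order_Zp] T_multiple_p_power assms) simp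
  ultimately show "cg (3 * g + 1)
      (\<Sum>k=0..n. T r s t (n * p ^ g) (k * p ^ g) * first_order r s t (n * p ^ g) (k * p ^ g))
      (of_nat p ^ (3 * g) * (\<Sum>k=0..n. T r s t n k * first_order r s t n k))"
    unfolding sum_distrib_left by (intro cg_sum) (simp only:)
next
  let ?A = "{j. j < n * p ^ g \<and> \<not> p ^ g dvd j}"
  have M: "p ^ g dvd n * p ^ g" "n * p ^ g > 0" using assms(1) by simp_all
  show "cg (3 * g + 1) (\<Sum>j\<in>?A. T r s t (n * p ^ g) j * first_order r s t (n * p ^ g) j)
    (if r = 2 then of_nat (n * p ^ g) ^ 3 * (of_nat s - 2 + 4 * of_nat t) * W_nonmultiples s t n g else 0)"
  proof (cases "r = 2")
    case True
    have "cg (3 * g + 1) (\<Sum>j\<in>?A. T 2 s t (n * p ^ g) j * first_order 2 s t (n * p ^ g) j)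
      (\<Sum>j\<in>?A. of_nat (n * p ^ g) ^ 3 * (of_nat s - 2 + 4 * of_nat t) * W s t (n * p ^ g) (2 * j))"
      by (intro cg_sum T_first_order_nonmultiple_2[OF M]) simp_all
    then show ?thesis using True unfolding W_nonmultiples_def sum_distrib_left[symmetric] by simp
  next
    case False
    then have "(\<Sum>j\<in>?A. T r s t (n * p ^ g) j * first_order r s t (n * p ^ g) j) \<in> I (3 * g + 1)"
      using assms(2) by (intro I_sum T_first_order_nonmultiple[OF M]) simp_all
    then show ?thesis using False by (simp add: cg_0)
  qed
qed

lemma A_seq_diff:
  assumes "n > 0" "r \<ge> 2"
  shows "cg (3 * g + 4) (of_nat (A_seq r s t (n * p ^ (g + 1))))
    (of_nat (A_seq r s t (n * p ^ g))
      + (of_nat p ^ (3 * (g + 1)) * B * calA_generic r s t n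
        - (if r = 2 then of_nat (n * p ^ (g + 1)) ^ 3 * slope_const s t * W_nonmultiples s t n g else 0))
      + (\<Sum>k\<in>units_upto (n * p ^ (g + 1)). T r s t (n * p ^ (g + 1)) k))"
proof -
  define M where "M = n * p ^ g"
  have N: "n * p ^ (g + 1) = p * M" by (simp add: M_def)
  have M: "p ^ g dvd M" "M > 0" using assms by (simp_all add: M_def)
  define G where "G = (\<Sum>k=0..n. T r s t n k * first_order r s t n k)"
  define X where "X = (if r = 2 then of_nat M ^ 3 * (of_nat s - 2 + 4 * of_nat t) * W_nonmultiples s t n g else 0)"
  have prec: "3 * g + 4 = 3 + (3 * g + 1)" by simp
  have c: "- B / 3 * of_nat p ^ 3 \<in> I 3"
    using B_Zp by (intro Zp_mult_I[OF _ I_p_power]) simp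
  have "cg (3 * g + 4) (\<Sum>j=0..M. T r s t (p * M) (p * j) - T r s t M j)
      (\<Sum>j=0..M. T r s t M j * (- B / 3 * of_nat p ^ 3 * first_order r s t M j))"
    unfolding first_order_def by (intro cg_sum T_multiple_p M assms(2)) simp
  also have "\<dots> = - B / 3 * of_nat p ^ 3 * (\<Sum>j=0..M. T r s t M j * first_order r s t M j)"
    unfolding sum_distrib_left by (intro sum.cong refl) (simp add: mult_ac)
  also have "cg (3 * g + 4) \<dots> (- B / 3 * of_nat p ^ 3 * (of_nat p ^ (3 * g) * G + X))"
    unfolding prec M_def G_def X_def by (rule cg_scale[OF c sum_T_first_order[OF assms]])
  finally have D: "cg (3 * g + 4) (\<Sum>j=0..M. T r s t (p * M) (p * j) - T r s t M j)
    (- B / 3 * of_nat p ^ 3 * (of_nat p ^ (3 * g) * G + X))" .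
  have gen: "calA_generic r s t n = - (1 / 3) * G"
    unfolding calA_generic_def G_def T_def first_order_def
    by (rule arg_cong2[where f = "(*)", OF refl sum.cong[OF refl]]) (simp add: algebra_simps)
  have "- B / 3 * of_nat p ^ 3 * (of_nat p ^ (3 * g) * G + X) =
    of_nat p ^ (3 * (g + 1)) * B * calA_generic r s t n
      - (if r = 2 then of_nat (p * M) ^ 3 * slope_const s t * W_nonmultiples s t n g else 0)"
    unfolding gen by (simp add: X_def slope_const_def power_mult_distrib power_add field_simps)
  note D' = D[unfolded this]
  have "of_nat (A_seq r s t (p * M)) = (\<Sum>j=0..M. T r s t M j)
      + (\<Sum>j=0..M. T r s t (p * M) (p * j) - T r s t M j) + (\<Sum>k\<in>units_upto (p * M). T r s t (p * M) k)"
    unfolding A_seq_eq_sum_T sum_split_multiples by (simp add: sum_subtractf)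
  then show ?thesis
    unfolding N M_def[symmetric] by (simp only: A_seq_eq_sum_T) (intro cg_add cg_refl D')
qed

section \<open>Recombination of the contributions for r = 2\<close>

definition W_even :: "nat \<Rightarrow> nat \<Rightarrow> nat \<Rightarrow> rat" where
  "W_even s t n = (\<Sum>k<n. W s t n (2 * k))"

definition W_odd :: "nat \<Rightarrow> nat \<Rightarrow> nat \<Rightarrow> rat" where
  "W_odd s t n = (\<Sum>k<n. W s t n (2 * k + 1))"

lemma sum_W: "(\<Sum>z<2 * n. W s t n z) = W_even s t n + W_odd s t n"
  unfolding sum_even_odd W_even_def W_odd_def by (rule sum.distrib)

lemma sum_alternating_W: "(\<Sum>z<2 * n. (- 1) ^ z * W s t n z) = W_even s t n - W_odd s t n"
  unfolding sum_even_odd W_even_def W_odd_def by (simp add: sum.distrib sum_subtractf sum_negf power_mult)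

text \<open>Merging g times. Every merge adds a correction proportional to the total weight at the
  next level, which is divisible by p except at level n. Hence the correction appears once if g > 0
  and not at all if g = 0.\<close>

lemma sum_W_phi:
  assumes "n > 0" "a > 0"
  shows "cg (g + a + 1) (\<Sum>z<2 * (n * p ^ g). W s t (n * p ^ g) z * phi 2 a z)
    (of_nat p ^ (g + a) * ((\<Sum>z<2 * n. W s t n z * phi_coeff z)
      + (if g = 0 then 0 else of_nat n * slope_const s t * (W_even s t n + W_odd s t n))))"
  using assms(2)
proof (induction g arbitrary: a)
  case 0
  have "cg (a + 1) (\<Sum>z<2 * n. W s t n z * phi 2 a z) (\<Sum>z<2 * n. W s t n z * (of_nat p ^ a * phi_coeff z))"
    by (intro cg_sum cg_mult_left[OF W_Zp] phi_2 0)
  also have "\<dots> = of_nat p ^ a * (\<Sum>z<2 * n. W s t n z * phi_coeff z)"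
    unfolding sum_distrib_left by (intro sum.cong refl) (simp add: mult_ac)
  finally show ?case by simp
next
  case (Suc g)
  define M where "M = n * p ^ g"
  have M: "M > 0" using assms by (simp add: M_def)
  have N: "n * p ^ Suc g = p * M" by (simp add: M_def)
  have "of_nat (p * M) \<in> I (Suc g)"
    by (rule I_of_nat) (simp add: M_def)
  define \<Phi> where "\<Phi> = (\<Sum>z<2 * n. W s t n z * phi_coeff z)"
  define C where "C = of_nat n * slope_const s t * (W_even s t n + W_odd s t n)"
  have "cg (Suc g + a + 1) (\<Sum>z<2 * (p * M). W s t (p * M) z * phi 2 a z)
    (\<Sum>y<2 * M. W s t M y * (phi 2 (Suc a) y + of_nat (p * M) * (of_nat p ^ a * slope_const s t)))"
    by (rule sum_W_phi_step[OF \<open>of_nat (p * M) \<in> I (Suc g)\<close> _ M Suc.prems]) simp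
  also have "\<dots> = (\<Sum>y<2 * M. W s t M y * phi 2 (Suc a) y)
      + of_nat (p * M) * of_nat p ^ a * (slope_const s t * (\<Sum>y<2 * M. W s t M y))"
    unfolding sum_distrib_left sum.distrib[symmetric] by (intro sum.cong refl) (simp add: algebra_simps)
  also have "of_nat (p * M) * of_nat p ^ a = of_nat p ^ (Suc g + a) * (of_nat n :: rat)"
    by (simp add: M_def power_add mult_ac)
  also have "cg (Suc g + a + 1) ((\<Sum>y<2 * M. W s t M y * phi 2 (Suc a) y)
      + of_nat p ^ (Suc g + a) * of_nat n * (slope_const s t * (\<Sum>y<2 * M. W s t M y)))
    (of_nat p ^ (Suc g + a) * (\<Phi> + (if g = 0 then 0 else C)) + of_nat p ^ (Suc g + a) * (if g = 0 then C else 0))"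
  proof (rule cg_add)
    show "cg (Suc g + a + 1) (\<Sum>y<2 * M. W s t M y * phi 2 (Suc a) y)
      (of_nat p ^ (Suc g + a) * (\<Phi> + (if g = 0 then 0 else C)))"
      using Suc.IH[of "Suc a"] by (simp only: M_def \<Phi>_def C_def add_Suc add_Suc_right zero_less_Suc simp_thms)
    have "cg 1 (\<Sum>y<2 * M. W s t M y) (if g = 0 then W_even s t n + W_odd s t n else 0)"
    proof (cases g)
      case 0
      then show ?thesis by (simp add: M_def sum_W)
    next
      case (Suc g')
      have "M = p * (n * p ^ g')" "n * p ^ g' > 0" using assms(1) by (simp_all add: M_def Suc)
      then show ?thesis using sum_W_multiple_p[of "n * p ^ g'" s t] Suc by (simp add: cg_0)
    qed
    then have "cg 1 (of_nat n * slope_const s t * (\<Sum>y<2 * M. W s t M y))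
        (of_nat n * slope_const s t * (if g = 0 then W_even s t n + W_odd s t n else 0))"
      by (intro cg_mult_left Zp_mult slope_const_Zp Zp_of_nat)
    from cg_scale[OF I_p_power[of "Suc g + a"] this]
    show "cg (Suc g + a + 1) (of_nat p ^ (Suc g + a) * of_nat n * (slope_const s t * (\<Sum>y<2 * M. W s t M y)))
      (of_nat p ^ (Suc g + a) * (if g = 0 then C else 0))"
      by (simp only: C_def mult.assoc if_distrib mult_zero_right)
  qed
  also have "of_nat p ^ (Suc g + a) * (\<Phi> + (if g = 0 then 0 else C)) + of_nat p ^ (Suc g + a) * (if g = 0 then C else 0) =
      of_nat p ^ (Suc g + a) * (\<Phi> + (if Suc g = 0 then 0 else C))"
    by (simp add: algebra_simps)
  finally show ?case unfolding N \<Phi>_def C_def .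
qed

lemma sum_unit_coeff:
  "(\<Sum>z<2 * n. W s t n z * unit_coeff s t z) = unit_coeff s t 0 * W_even s t n + unit_coeff s t 1 * W_odd s t n"
  unfolding sum_even_odd W_even_def W_odd_def sum_distrib_left sum.distrib[symmetric]
  by (intro sum.cong refl) (simp add: unit_coeff_def mult.commute)

text \<open>The relation on which the independence of m rests for r = 2.\<close>

lemma unit_coeff_sum: "unit_coeff s t 0 + unit_coeff s t 1 = 3 * slope_const s t"
  by (simp add: unit_coeff_def slope_const_def field_simps)

lemma unit_coeff_Zp: "unit_coeff s t z \<in> Zp"
  unfolding unit_coeff_def using B_Zp by (auto intro!: Zp_divide_numeral Zp_mult Zp_add Zp_diff)

text \<open>
  For \<open>g > 0\<close> the values of \<^term>\<open>W\<close> at even and at odd arguments have opposite sums modulo \<open>p\<close>;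
  the three contributions of this lemma then recombine into the expression that is valid for \<open>g = 0\<close>.
\<close>

lemma combine_contributions:
  assumes "n > 0"
  shows "cg 1 (- (slope_const s t * W_nonmultiples s t n g)
      + (if g = 0 then 0 else slope_const s t * (W_even s t n + W_odd s t n))
      + (\<Sum>z<2 * (n * p ^ g). W s t (n * p ^ g) z * unit_coeff s t z))
    (unit_coeff s t 0 * W_even s t n + unit_coeff s t 1 * W_odd s t n)"
proof (cases "g = 0")
  case True
  then show ?thesis by (simp add: W_nonmultiples_def sum_unit_coeff)
next
  case False
  define M where "M = n * p ^ g"
  define sc where "sc = slope_const s t"
  define \<alpha> where "\<alpha> = unit_coeff s t 0"
  define \<beta> where "\<beta> = unit_coeff s t 1"
  define X where "X = W_nonmultiples s t n g"
  define E where "E = W_even s t M"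
  define D where "D = W_odd s t M"
  define e where "e = W_even s t n"
  define d where "d = W_odd s t n"
  obtain g' where g': "g = Suc g'" using False not0_implies_Suc by blast
  have "M = p * (n * p ^ g')" "n * p ^ g' > 0" using assms by (simp_all add: M_def g')
  then have 1: "E + D \<in> I 1"
    using sum_W_multiple_p[of "n * p ^ g'" s t] unfolding E_def D_def sum_W[symmetric] by simp
  have 2: "E - D - (e - d) \<in> I 1"
    using sum_alternating_W_power[OF assms, where f = g and s = s and t = t]
    unfolding cg_def M_def[symmetric] sum_alternating_W E_def D_def e_def d_def .
  have "E = (\<Sum>k<n. W s t M (2 * (k * p ^ g))) + X"
    unfolding E_def W_even_def X_def W_nonmultiples_def M_def by (rule sum_split_prime_power(2))
  moreover have "cg 1 (\<Sum>k<n. W s t M (2 * k * p ^ g)) (\<Sum>k<n. W s t n (2 * k))"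
    unfolding M_def by (intro cg_sum W_multiple_power assms)
  ultimately have 3: "E - X - e \<in> I 1"
    by (simp add: cg_def e_def W_even_def mult.assoc)
  have Z: "sc \<in> Zp" "\<alpha> \<in> Zp" "\<beta> \<in> Zp"
    unfolding sc_def \<alpha>_def \<beta>_def by (rule slope_const_Zp unit_coeff_Zp)+
  have "3 * sc = \<alpha> + \<beta>" unfolding sc_def \<alpha>_def \<beta>_def by (rule unit_coeff_sum[symmetric])
  then have \<alpha>: "\<alpha> = 3 * sc - \<beta>" by simp
  \<comment> \<open>With \<open>\<alpha>\<close> eliminated, the coefficients are forced: X occurs
    only in the third relation, and D then fixes the coefficient of the second.\<close>
  have "- (sc * X) + sc * (e + d) + (\<alpha> * E + \<beta> * D) - (\<alpha> * e + \<beta> * d) =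
      sc * (E + D) + (sc - \<beta>) * (E - D - (e - d)) + sc * (E - X - e)"
    unfolding \<alpha> by (simp add: algebra_simps)
  moreover have "sc * (E + D) + (sc - \<beta>) * (E - D - (e - d)) + sc * (E - X - e) \<in> I 1"
    by (rule I_add[OF I_add[OF Zp_mult_I[OF Z(1) 1] Zp_mult_I[OF Zp_diff[OF Z(1,3)] 2]] Zp_mult_I[OF Z(1) 3]])
  ultimately have "cg 1 (- (sc * X) + sc * (e + d) + (\<alpha> * E + \<beta> * D)) (\<alpha> * e + \<beta> * d)"
    unfolding cg_def by (simp only:)
  then show ?thesis
    using False unfolding M_def[symmetric] sum_unit_coeff
    by (simp only: sc_def X_def e_def d_def \<alpha>_def \<beta>_def E_def D_def if_False)
qed

lemma W_eq_choose:
  assumes "k < n" "z div 2 = k"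
  shows "of_nat n ^ 2 * W s t n z =
    of_nat (n choose k) ^ 2 * of_nat ((n + k) choose k) ^ s * of_nat (z choose n) ^ t * (of_nat n - of_nat k) ^ 2"
proof -
  have "of_nat n * of_nat ((n - 1) choose k) = (of_nat n - of_nat k) * (of_nat (n choose k) :: rat)"
    using binomial_absorb_comp[of n k] assms(1) by (metis of_nat_mult of_nat_diff less_imp_le)
  then have "(of_nat n * of_nat ((n - 1) choose k)) ^ 2 = ((of_nat n - of_nat k) * (of_nat (n choose k) :: rat)) ^ 2"
    by (simp only:)
  then show ?thesis
    unfolding W_def assms(2) power_mult_distrib by (simp add: mult_ac)
qed

lemma V_eq_choose:
  assumes "k < n" "z div 2 = k"
  shows "of_nat n ^ 3 * V s t n z =
    (of_nat n - of_nat k) ^ 3 * of_nat (n choose k) ^ 3 * of_nat ((n + k) choose k) ^ s * of_nat (z choose n) ^ t"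
proof -
  have "of_nat n * of_nat ((n - 1) choose k) = (of_nat n - of_nat k) * (of_nat (n choose k) :: rat)"
    using binomial_absorb_comp[of n k] assms(1) by (metis of_nat_mult of_nat_diff less_imp_le)
  then have "(of_nat n * of_nat ((n - 1) choose k)) ^ 3 = ((of_nat n - of_nat k) * (of_nat (n choose k) :: rat)) ^ 3"
    by (simp only:)
  then show ?thesis
    unfolding V_def assms(2) power_mult_distrib by (simp add: mult_ac)
qed

text \<open>The constants of the claim: 6 \<open>phi_coeff\<close> / B is 24 k + 14 at 2 k and -24 k
  - 10 at 2 k + 1, and n times \<open>unit_coeff\<close> supplies the terms containing n.\<close>

lemma calA_2:
  "B * calA 2 s t n = B * calA_generic 2 s t n + of_nat n ^ 2 * (\<Sum>z<2 * n. W s t n z * phi_coeff z)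
    + of_nat n ^ 3 * (unit_coeff s t 0 * W_even s t n + unit_coeff s t 1 * W_odd s t n)"
proof -
  define even_term :: "nat \<Rightarrow> rat" where "even_term k = of_nat (n choose k) ^ 2 * of_nat ((n + k) choose k) ^ s *
    of_nat ((2 * k) choose n) ^ t * (of_nat n - of_nat k) ^ 2" for k
  define odd_term :: "nat \<Rightarrow> rat" where "odd_term k = of_nat (n choose k) ^ 2 * of_nat ((n + k) choose k) ^ s *
    of_nat ((2 * k + 1) choose n) ^ t * (of_nat n - of_nat k) ^ 2" for k
  define ca :: "nat \<Rightarrow> rat" where
    "ca k = 9 * of_nat n * of_nat t - 3 * of_nat n * of_nat s + 24 * of_nat k - 18 * of_nat n + 14" for k
  define cb :: "nat \<Rightarrow> rat" where
    "cb k = 9 * of_nat n * of_nat s + 15 * of_nat n * of_nat t - 24 * of_nat k + 6 * of_nat n - 10" for k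
  have "of_nat n ^ 2 * (\<Sum>z<2 * n. W s t n z * phi_coeff z)
      + of_nat n ^ 3 * (unit_coeff s t 0 * W_even s t n + unit_coeff s t 1 * W_odd s t n) =
    of_nat n ^ 2 * (\<Sum>z<2 * n. W s t n z * (phi_coeff z + of_nat n * unit_coeff s t z))"
    unfolding sum_unit_coeff[symmetric] sum_distrib_left sum.distrib[symmetric]
    by (intro sum.cong refl) (simp add: power2_eq_square power3_eq_cube algebra_simps)
  also have "\<dots> = (\<Sum>k<n. of_nat n ^ 2 * W s t n (2 * k) * (phi_coeff (2 * k) + of_nat n * unit_coeff s t (2 * k))
      + of_nat n ^ 2 * W s t n (2 * k + 1) * (phi_coeff (2 * k + 1) + of_nat n * unit_coeff s t (2 * k + 1)))"
    unfolding sum_even_odd sum_distrib_left by (intro sum.cong refl) (simp only: distrib_left mult.assoc)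
  also have "\<dots> = (\<Sum>k<n. B * (1 / 6 * (even_term k * ca k) + 1 / 6 * (odd_term k * cb k)))"
  proof (intro sum.cong refl)
    fix k assume "k \<in> {..<n}"
    then have k: "k < n" by simp
    have "of_nat n ^ 2 * W s t n (2 * k) = even_term k" "of_nat n ^ 2 * W s t n (2 * k + 1) = odd_term k"
      unfolding even_term_def odd_term_def by (rule W_eq_choose[OF k], simp)+
    moreover have "phi_coeff (2 * k) + of_nat n * unit_coeff s t (2 * k) = B * (ca k / 6)"
      "phi_coeff (2 * k + 1) + of_nat n * unit_coeff s t (2 * k + 1) = B * (cb k / 6)"
      by (simp_all add: phi_coeff_def unit_coeff_def ca_def cb_def field_simps)
    ultimately show "of_nat n ^ 2 * W s t n (2 * k) * (phi_coeff (2 * k) + of_nat n * unit_coeff s t (2 * k))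
      + of_nat n ^ 2 * W s t n (2 * k + 1) * (phi_coeff (2 * k + 1) + of_nat n * unit_coeff s t (2 * k + 1)) =
      B * (1 / 6 * (even_term k * ca k) + 1 / 6 * (odd_term k * cb k))"
      by (simp only:) (simp add: algebra_simps)
  qed
  also have "\<dots> = B * (1 / 6 * (\<Sum>k<n. even_term k * ca k) + 1 / 6 * (\<Sum>k<n. odd_term k * cb k))"
    by (simp only: sum_distrib_left[symmetric] sum.distrib)
  finally have eq: "of_nat n ^ 2 * (\<Sum>z<2 * n. W s t n z * phi_coeff z)
      + of_nat n ^ 3 * (unit_coeff s t 0 * W_even s t n + unit_coeff s t 1 * W_odd s t n) =
    B * (1 / 6 * (\<Sum>k<n. even_term k * ca k) + 1 / 6 * (\<Sum>k<n. odd_term k * cb k))" .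
  have "calA 2 s t n = calA_generic 2 s t n + 1 / 6 * (\<Sum>k<n. even_term k * ca k) + 1 / 6 * (\<Sum>k<n. odd_term k * cb k)"
    unfolding calA_def even_term_def odd_term_def ca_def cb_def by simp
  then show ?thesis unfolding add.assoc eq by (simp add: distrib_left)
qed

lemma calA_3:
  "B * calA 3 s t n = B * calA_generic 3 s t n + of_nat n ^ 3 * (B / 4 * (\<Sum>z<2 * n. V s t n z))"
proof -
  have "of_nat n ^ 3 * (\<Sum>z<2 * n. V s t n z) =
    (\<Sum>k<n. of_nat n ^ 3 * V s t n (2 * k) + of_nat n ^ 3 * V s t n (2 * k + 1))"
    unfolding sum_even_odd sum_distrib_left by (intro sum.cong refl) (simp only: distrib_left)
  also have "\<dots> = (\<Sum>k<n. (of_nat n - of_nat k) ^ 3 * of_nat (n choose k) ^ 3 * of_nat ((n + k) choose k) ^ s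
      * (of_nat ((2 * k) choose n) ^ t + of_nat ((2 * k + 1) choose n) ^ t))"
  proof (intro sum.cong refl)
    fix k assume "k \<in> {..<n}"
    then have k: "k < n" by simp
    have V: "of_nat n ^ 3 * V s t n (2 * k) = (of_nat n - of_nat k) ^ 3 * of_nat (n choose k) ^ 3 * of_nat ((n + k) choose k) ^ s * of_nat ((2 * k) choose n) ^ t"
      "of_nat n ^ 3 * V s t n (2 * k + 1) = (of_nat n - of_nat k) ^ 3 * of_nat (n choose k) ^ 3 * of_nat ((n + k) choose k) ^ s * of_nat ((2 * k + 1) choose n) ^ t"
      by (rule V_eq_choose[OF k], simp)+
    show "of_nat n ^ 3 * V s t n (2 * k) + of_nat n ^ 3 * V s t n (2 * k + 1) =
      (of_nat n - of_nat k) ^ 3 * of_nat (n choose k) ^ 3 * of_nat ((n + k) choose k) ^ s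
      * (of_nat ((2 * k) choose n) ^ t + of_nat ((2 * k + 1) choose n) ^ t)"
      unfolding V by (simp only: distrib_left)
  qed
  finally have eq: "of_nat n ^ 3 * (\<Sum>z<2 * n. V s t n z) = \<dots>" .
  have "calA 3 s t n = calA_generic 3 s t n + 1 / 4 * (of_nat n ^ 3 * (\<Sum>z<2 * n. V s t n z))"
    unfolding eq calA_def by simp
  then show ?thesis by (simp add: algebra_simps)
qed

lemma A_seq_cg:
  assumes "n > 0" "r \<ge> 2"
  shows "cg (3 * (g + 1) + 1) (of_nat (A_seq r s t (n * p ^ (g + 1))))
    (of_nat (A_seq r s t (n * p ^ g)) + of_nat p ^ (3 * (g + 1)) * B * calA r s t n)"
proof -
  define M where "M = n * p ^ g"
  have N: "p * M = n * p ^ (g + 1)" by (simp add: M_def)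
  have M: "M > 0" using assms(1) by (simp add: M_def)
  define P :: rat where "P = of_nat p ^ (g + 1)"
  define U where "U = (\<Sum>k\<in>units_upto (p * M). T r s t (p * M) k)"
  define X where "X = W_nonmultiples s t n g"
  have x: "of_nat (p * M) = of_nat n * P" by (simp add: N P_def)
  have P3: "of_nat p ^ (3 * (g + 1)) = P ^ 3"
    unfolding P_def by (simp only: power_mult[symmetric] mult.commute)
  have P3_I: "P ^ 3 * c \<in> I (3 * (g + 1))" if "c \<in> Zp" for c
    unfolding P3[symmetric] using that by (intro I_mult_Zp[OF I_p_power])
  define R where "R = (if r = 2 then of_nat (p * M) ^ 3 * slope_const s t * X else 0)"
  have diff: "cg (3 * (g + 1) + 1) (of_nat (A_seq r s t (p * M)))
    (of_nat (A_seq r s t M) + (P ^ 3 * B * calA_generic r s t n - R) + U)"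
    using A_seq_diff[OF assms, of g s t]
    unfolding N[symmetric] M_def[symmetric] P3 X_def[symmetric] R_def[symmetric] U_def[symmetric] by (simp add: add.commute)
  \<comment> \<open>The remainder R of the multiples of p is joined to the units, since for r = 2
    only their combination is independent of g.\<close>
  have "cg (3 * (g + 1) + 1) (U - R) (P ^ 3 * (B * calA r s t n - B * calA_generic r s t n))"
  proof -
    consider "r = 2" | "r = 3" | "r \<ge> 4" using assms(2) by linarith
    then show ?thesis
    proof cases
      case 1
      define \<Phi> where "\<Phi> = (\<Sum>z<2 * n. W s t n z * phi_coeff z)"
      define C where "C = (if g = 0 then 0 else slope_const s t * (W_even s t n + W_odd s t n))"
      define E where "E = (\<Sum>z<2 * M. W s t M z * unit_coeff s t z)"
      define Y where "Y = unit_coeff s t 0 * W_even s t n + unit_coeff s t 1 * W_odd s t n"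
      have "of_nat n * P \<in> I (g + 1)"
        unfolding P_def by (intro p_power_mult_I) simp
      from I_power[OF this, of 2] have x2: "(of_nat n * P) ^ 2 \<in> I (2 * (g + 1))" by (simp add: mult.commute)
      have prec: "3 * (g + 1) + 1 = 2 * (g + 1) + (g + 1 + 1)" by simp
      have "cg (g + 1 + 1) (\<Sum>z<2 * M. W s t M z * phi 2 1 z)
        (P * (\<Phi> + (if g = 0 then 0 else of_nat n * slope_const s t * (W_even s t n + W_odd s t n))))"
        unfolding P_def M_def \<Phi>_def by (rule sum_W_phi[OF assms(1) zero_less_one])
      moreover have "(if g = 0 then 0 else of_nat n * slope_const s t * (W_even s t n + W_odd s t n)) = of_nat n * C"
        by (simp add: C_def)
      ultimately have 2: "cg (g + 1 + 1) (\<Sum>z<2 * M. W s t M z * phi 2 1 z) (P * (\<Phi> + of_nat n * C))"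
        by (simp only:)
      have "cg (3 * (g + 1) + 1) U ((of_nat n * P) ^ 2 * (\<Sum>z<2 * M. W s t M z * (phi 2 1 z + of_nat n * P * unit_coeff s t z)))"
        using sum_T_units_2[OF N _ M, of s t] unfolding U_def 1 x by simp
      also have "(\<Sum>z<2 * M. W s t M z * (phi 2 1 z + of_nat n * P * unit_coeff s t z)) =
          (\<Sum>z<2 * M. W s t M z * phi 2 1 z) + of_nat n * P * E"
        unfolding E_def sum_distrib_left sum.distrib[symmetric] by (intro sum.cong refl) (simp add: algebra_simps)
      also have "cg (3 * (g + 1) + 1) ((of_nat n * P) ^ 2 * ((\<Sum>z<2 * M. W s t M z * phi 2 1 z) + of_nat n * P * E))
          ((of_nat n * P) ^ 2 * (P * (\<Phi> + of_nat n * C) + of_nat n * P * E))"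
        unfolding prec by (rule cg_scale[OF x2 cg_add[OF 2 cg_refl]])
      finally have "cg (3 * (g + 1) + 1) (U - R) ((of_nat n * P) ^ 2 * (P * (\<Phi> + of_nat n * C) + of_nat n * P * E) - R)"
        by (rule cg_diff[OF _ cg_refl])
      also have "(of_nat n * P) ^ 2 * (P * (\<Phi> + of_nat n * C) + of_nat n * P * E) - R =
          P ^ 3 * (of_nat n ^ 2 * \<Phi>) + P ^ 3 * of_nat n ^ 3 * (- (slope_const s t * X) + C + E)"
        unfolding R_def x using 1 by (simp add: power2_eq_square power3_eq_cube algebra_simps)
      also have "cg (3 * (g + 1) + 1) \<dots> (P ^ 3 * (of_nat n ^ 2 * \<Phi>) + P ^ 3 * of_nat n ^ 3 * Y)"
        unfolding X_def C_def E_def Y_def M_def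
        by (intro cg_add[OF cg_refl] cg_scale[OF P3_I] combine_contributions assms(1)) simp
      also have "P ^ 3 * (of_nat n ^ 2 * \<Phi>) + P ^ 3 * of_nat n ^ 3 * Y =
          P ^ 3 * (B * calA r s t n - B * calA_generic r s t n)"
        unfolding 1 calA_2 \<Phi>_def Y_def by (simp add: algebra_simps)
      finally show ?thesis .
    next
      case 2
      have "cg (3 * (g + 1) + 1) U ((of_nat n * P) ^ 3 * (B / 4 * (\<Sum>z<2 * M. V s t M z)))"
        using sum_T_units_3[OF N _ M, of s t] unfolding U_def 2 x by simp
      also have "(of_nat n * P) ^ 3 * (B / 4 * (\<Sum>z<2 * M. V s t M z)) =
          P ^ 3 * (of_nat n ^ 3 * (B / 4)) * (\<Sum>z<2 * M. V s t M z)"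
        by (simp add: power_mult_distrib)
      also have "cg (3 * (g + 1) + 1) \<dots> (P ^ 3 * (of_nat n ^ 3 * (B / 4)) * (\<Sum>z<2 * n. V s t n z))"
        unfolding M_def using B_Zp by (intro cg_scale[OF P3_I] sum_V_power assms(1)) simp
      finally show ?thesis
        unfolding 2 calA_3 R_def by (simp add: algebra_simps)
    next
      case 3
      have "U \<in> I (3 * (g + 1) + 1)"
        unfolding U_def by (rule sum_T_units_4[OF N _ M 3]) simp
      then show ?thesis using 3 by (simp add: R_def calA_def cg_0)
    qed
  qed
  from cg_add[OF cg_refl[of _ "of_nat (A_seq r s t M) + P ^ 3 * B * calA_generic r s t n"] this]
  have "cg (3 * (g + 1) + 1) (of_nat (A_seq r s t M) + (P ^ 3 * B * calA_generic r s t n - R) + U)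
    (of_nat (A_seq r s t M) + P ^ 3 * B * calA r s t n)"
    by (simp add: algebra_simps)
  with diff show ?thesis
    unfolding N[symmetric] M_def[symmetric] P3 by (rule cg_trans)
qed

end

theorem theorem1p1:
  fixes p n m r s t :: nat
  assumes "prime p" and "p \<ge> 5" and "n \<ge> 1" and "m \<ge> 1" and "r \<ge> 2"
  shows "rat_cong p (3 * int m + 1)
           (of_nat (A_seq r s t (n * p ^ m)))
           (of_nat (A_seq r s t (n * p ^ (m - 1)))
             + of_nat p ^ (3 * m) * bernoulli (p - 3) * calA r s t n)"
proof -
  interpret prime_ge5 p
    using assms(1,2) by unfold_locales
  obtain g where m: "m = g + 1"
    using assms(4) by (metis le_add_diff_inverse2)
  have "n > 0" using assms(3) by simp
  from A_seq_cg[OF this assms(5), of g s t]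
  have "rat_cong p (int (3 * m + 1)) (of_nat (A_seq r s t (n * p ^ m)))
      (of_nat (A_seq r s t (n * p ^ (m - 1))) + of_nat p ^ (3 * m) * bernoulli (p - 3) * calA r s t n)"
    unfolding rat_cong_iff m by simp
  moreover have "int (3 * m + 1) = 3 * int m + 1" by simp
  ultimately show ?thesis by (simp only:)
qed

end
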